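(* Let $\Omega\subset\mathbb{R}^2$ be a bounded domain with $C^3$ smooth boundary $\Gamma$ and outward unit normal $\nu$. Let $\kappa>0$, $c>0$, $\beta_n=\frac{\kappa^2}{c^2}(n+1)$ for $n=0,1,\ldots$, and $\gamma=\kappa/c$ (so $\gamma^2=\beta_0$). Let $f_n$, $n=0,1,\ldots$, be the Laguerre coefficients on $\Gamma$ of a given boundary function $f$, and let $\Phi_n$ be the functions defined in the context. Let $0<\alpha<1$ and let $q_n\in C^{1,\alpha}(\Gamma)$, $n=0,1,\ldots$, satisfy the sequence of boundary integral equations $$(\mathcal{T}_0q_n)(x)=f_n(x)-\sum_{m=0}^{n-1}(\mathcal{T}_{n-m}q_m)(x),\qquad x\in\Gamma,\quad n=0,1,\ldots,$$ where $$(\mathcal{T}_ng)(x)=\frac1\pi\frac{\partial}{\partial\nu(x)}\int_\Gamma g(y)\frac{\partial}{\partial\nu(y)}\Phi_n(x,y)\,ds(y),\qquad x\in\Gamma.$$ Then the functions $$u_n(x)=\frac1\pi\sum_{m=0}^n\int_\Gamma q_m(y)\frac{\partial}{\partial\nu(y)}\Phi_{n-m}(x,y)\,ds(y),\qquad x\in\Omega,\quad n=0,1,\ldots,$$ solve the sequence of boundary value problems $$\Delta u_n-\gamma^2u_n=\sum_{m=0}^{n-1}\beta_{n-m}u_m\quad\text{in }\Omega,\qquad\frac{\partial u_n}{\partial\nu}=f_n\quad\text{on }\Gamma,\qquad n=0,1,\ldots.$$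
   Context: Laguerre coefficients: $f_n(x)=\int_0^\infty e^{-\kappa t}L_n(\kappa t)f(x,t)\,dt$ with $L_n$ the Laguerre polynomial of degree $n$. The functions $\Phi_n$: let $K_0,K_1$ be the modified Bessel functions of the second kind (modified Hankel/Macdonald functions) of orders $0$ and $1$. Define real numbers $a_{n,k}$, $0\le k\le n$, by $a_{n,0}=1$ for $n\ge0$; $a_{n,n}=-\frac{1}{2\gamma n}\beta_1a_{n-1,n-1}$ for $n\ge1$; and $$a_{n,k}=\frac{1}{2\gamma k}\left\{4\left[\tfrac{k+1}{2}\right]^2a_{n,k+1}-\sum_{m=k-1}^{n-1}\beta_{n-m}a_{m,k-1}\right\},\qquad k=n-1,\ldots,1,$$ where $[\cdot]$ denotes the integer part. Set $$v_n(r)=\sum_{k=0}^{[n/2]}a_{n,2k}r^{2k},\qquad w_n(r)=\sum_{k=0}^{[(n-1)/2]}a_{n,2k+1}r^{2k+1},\qquad w_0(r)=0,$$ and, for $x\ne y$ in $\mathbb{R}^2$, $$\Phi_n(x,y)=\Phi_n(|x-y|)=K_0(\gamma|x-y|)v_n(|x-y|)+K_1(\gamma|x-y|)w_n(|x-y|).$$ Empty sums are zero. Normal derivatives on $\Gamma$ of functions defined in $\Omega$ (including the outer normal derivative in $\mathcal{T}_n$, applied to the double-layer potential in $\Omega$) are understood as limits $\frac{\partial u}{\partial\nu}(x)=\lim_{h\to0^+}\nu(x)\cdot\nabla u(x-h\nu(x))$, $x\in\Gamma$. *)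

theory Defs
  imports "HOL-Analysis.Analysis"
begin

definition laguerre :: "nat \<Rightarrow> real \<Rightarrow> real" where
  "laguerre n x = (\<Sum>k\<le>n. real (n choose k) * (- 1) ^ k / fact k * x ^ k)"

text \<open>
  The modified Bessel function of the second kind of order \<open>\<mu>\<close> at \<open>z > 0\<close>, by its standard
  representation \<open>K\<^sub>\<mu>(z) = \<integral>\<^sub>0\<^sup>\<infinity> exp (- z cosh t) cosh (\<mu> t) dt\<close>.
\<close>
definition bessel_K :: "real \<Rightarrow> real \<Rightarrow> real" where
  "bessel_K \<mu> z = integral {0..} (\<lambda>t. exp (- z * cosh t) * cosh (\<mu> * t))"

text \<open>The value \<open>0\<close> for \<open>k > n\<close> is a dummy; these entries are never used.\<close>
function coeff_a :: "real \<Rightarrow> (nat \<Rightarrow> real) \<Rightarrow> nat \<Rightarrow> nat \<Rightarrow> real" where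
  "coeff_a \<gamma> \<beta> n k =
    (if k = 0 then 1
     else if k = n then - (1 / (2 * \<gamma> * real n)) * \<beta> 1 * coeff_a \<gamma> \<beta> (n - 1) (n - 1)
     else if k < n then
       1 / (2 * \<gamma> * real k) *
         (4 * (real ((k + 1) div 2))\<^sup>2 * coeff_a \<gamma> \<beta> n (k + 1)
          - (\<Sum>m\<in>{k - 1..n - 1}. \<beta> (n - m) * coeff_a \<gamma> \<beta> m (k - 1)))
     else 0)"
  by pat_completeness auto
termination
  by (relation "measures [\<lambda>(_, _, n, _). n, \<lambda>(_, _, n, k). n - k]") auto

declare coeff_a.simps [simp del]

definition poly_v :: "real \<Rightarrow> (nat \<Rightarrow> real) \<Rightarrow> nat \<Rightarrow> real \<Rightarrow> real" where
  "poly_v \<gamma> \<beta> n r = (\<Sum>k=0..n div 2. coeff_a \<gamma> \<beta> n (2 * k) * r ^ (2 * k))"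

definition poly_w :: "real \<Rightarrow> (nat \<Rightarrow> real) \<Rightarrow> nat \<Rightarrow> real \<Rightarrow> real" where
  "poly_w \<gamma> \<beta> n r =
    (if n = 0 then 0
     else (\<Sum>k=0..(n - 1) div 2. coeff_a \<gamma> \<beta> n (2 * k + 1) * r ^ (2 * k + 1)))"

definition Phi :: "real \<Rightarrow> (nat \<Rightarrow> real) \<Rightarrow> nat \<Rightarrow> real^2 \<Rightarrow> real^2 \<Rightarrow> real" where
  "Phi \<gamma> \<beta> n x y =
    bessel_K 0 (\<gamma> * norm (x - y)) * poly_v \<gamma> \<beta> n (norm (x - y))
    + bessel_K 1 (\<gamma> * norm (x - y)) * poly_w \<gamma> \<beta> n (norm (x - y))"

primrec C_times :: "nat \<Rightarrow> (real \<Rightarrow> 'a::real_normed_vector) \<Rightarrow> bool" where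
  "C_times 0 f \<longleftrightarrow> continuous_on UNIV f"
| "C_times (Suc k) f \<longleftrightarrow>
     (\<exists>f'. (\<forall>t. (f has_vector_derivative f' t) (at t)) \<and> C_times k f')"

text \<open>A regular simple closed \<open>C\<^sup>3\<close> curve, given by a parametrization of period \<open>1\<close>.\<close>
definition C3_closed_curve :: "(real \<Rightarrow> real^2) \<Rightarrow> bool" where
  "C3_closed_curve p \<longleftrightarrow>
     C_times 3 p \<and> (\<forall>t. p (t + 1) = p t) \<and> inj_on p {0..<1} \<and>
     (\<forall>t. vector_derivative p (at t) \<noteq> 0)"

text \<open>
  \<open>\<Omega>\<close> is a bounded plane domain with \<open>C\<^sup>3\<close> boundary: the boundary is the disjoint union of
  finitely many regular simple closed \<open>C\<^sup>3\<close> curves, of which \<open>C\<close> is a choice of parametrizations.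
  Several boundary components are allowed. Since \<open>\<Omega>\<close> is connected and the curves are closed,
  \<open>\<Omega>\<close> automatically lies on one side of each of them.
\<close>
definition C3_domain :: "(real^2) set \<Rightarrow> (real \<Rightarrow> real^2) set \<Rightarrow> bool" where
  "C3_domain \<Omega> C \<longleftrightarrow>
     open \<Omega> \<and> connected \<Omega> \<and> \<Omega> \<noteq> {} \<and> bounded \<Omega> \<and>
     finite C \<and> (\<forall>p\<in>C. C3_closed_curve p) \<and>
     pairwise (\<lambda>p p'. disjnt (range p) (range p')) C \<and>
     frontier \<Omega> = (\<Union>p\<in>C. range p)"

definition outward_unit_normal ::
  "(real^2) set \<Rightarrow> (real \<Rightarrow> real^2) set \<Rightarrow> (real^2 \<Rightarrow> real^2) \<Rightarrow> bool" where
  "outward_unit_normal \<Omega> C \<nu> \<longleftrightarrow>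
     (\<forall>p\<in>C. \<forall>t. norm (\<nu> (p t)) = 1 \<and> \<nu> (p t) \<bullet> vector_derivative p (at t) = 0) \<and>
     (\<forall>x\<in>frontier \<Omega>. \<forall>\<^sub>F h in at_right 0.
        x - h *\<^sub>R \<nu> x \<in> \<Omega> \<and> x + h *\<^sub>R \<nu> x \<notin> closure \<Omega>)"

text \<open>\<open>\<integral>\<^sub>\<Gamma> g ds\<close> with \<open>ds\<close> the arc length element on the curves parametrized by \<open>C\<close>.\<close>
definition arc_integral :: "(real \<Rightarrow> real^2) set \<Rightarrow> (real^2 \<Rightarrow> real) \<Rightarrow> real" where
  "arc_integral C g =
     (\<Sum>p\<in>C. integral {0..1} (\<lambda>t. g (p t) * norm (vector_derivative p (at t))))"

text \<open>
  \<open>g \<in> C\<^sup>1\<^sup>,\<^sup>\<alpha>(\<Gamma>)\<close>, by means of the regular \<open>C\<^sup>3\<close> parametrizations in \<open>C\<close>; by periodicity a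
  Hoelder bound on the whole line amounts to one on the closed curve.
\<close>
definition C1_alpha :: "real \<Rightarrow> (real \<Rightarrow> real^2) set \<Rightarrow> (real^2 \<Rightarrow> real) \<Rightarrow> bool" where
  "C1_alpha \<alpha> C g \<longleftrightarrow>
     (\<forall>p\<in>C. \<exists>g' B. (\<forall>t. ((\<lambda>s. g (p s)) has_real_derivative g' t) (at t)) \<and>
                    (\<forall>s t. \<bar>g' s - g' t\<bar> \<le> B * \<bar>s - t\<bar> powr \<alpha>))"

text \<open>The directional derivative \<open>v \<cdot> \<nabla>u(x)\<close>.\<close>
definition dir_deriv :: "real^2 \<Rightarrow> (real^2 \<Rightarrow> real) \<Rightarrow> real^2 \<Rightarrow> real" where
  "dir_deriv v u x = frechet_derivative u (at x) v"

definition C2_on :: "(real^2) set \<Rightarrow> (real^2 \<Rightarrow> real) \<Rightarrow> bool" where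
  "C2_on \<Omega> u \<longleftrightarrow>
     u differentiable_on \<Omega> \<and>
     (\<forall>b\<in>Basis. dir_deriv b u differentiable_on \<Omega>) \<and>
     (\<forall>b\<in>Basis. \<forall>b'\<in>Basis. continuous_on \<Omega> (dir_deriv b' (dir_deriv b u)))"

definition laplacian :: "(real^2 \<Rightarrow> real) \<Rightarrow> real^2 \<Rightarrow> real" where
  "laplacian u x = (\<Sum>b\<in>Basis. dir_deriv b (dir_deriv b u) x)"

text \<open>The normal derivative from inside \<open>\<Omega>\<close>, as a one-sided limit along the normal.\<close>
definition has_normal_derivative ::
  "(real^2 \<Rightarrow> real^2) \<Rightarrow> (real^2 \<Rightarrow> real) \<Rightarrow> real^2 \<Rightarrow> real \<Rightarrow> bool" where
  "has_normal_derivative \<nu> u x l \<longleftrightarrow>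
     ((\<lambda>h. dir_deriv (\<nu> x) u (x - h *\<^sub>R \<nu> x)) \<longlongrightarrow> l) (at_right 0)"

definition normal_derivative ::
  "(real^2 \<Rightarrow> real^2) \<Rightarrow> (real^2 \<Rightarrow> real) \<Rightarrow> real^2 \<Rightarrow> real" where
  "normal_derivative \<nu> u x = (THE l. has_normal_derivative \<nu> u x l)"

text \<open>\<open>\<integral>\<^sub>\<Gamma> g(y) \<partial>\<Phi>\<^sub>n(x,y)/\<partial>\<nu>(y) ds(y)\<close>, without the factor \<open>1/\<pi>\<close>.\<close>
definition double_layer ::
  "real \<Rightarrow> (nat \<Rightarrow> real) \<Rightarrow> (real \<Rightarrow> real^2) set \<Rightarrow> (real^2 \<Rightarrow> real^2) \<Rightarrow>
   nat \<Rightarrow> (real^2 \<Rightarrow> real) \<Rightarrow> real^2 \<Rightarrow> real" where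
  "double_layer \<gamma> \<beta> C \<nu> n g x =
     arc_integral C (\<lambda>y. g y * dir_deriv (\<nu> y) (Phi \<gamma> \<beta> n x) y)"

definition op_T ::
  "real \<Rightarrow> (nat \<Rightarrow> real) \<Rightarrow> (real \<Rightarrow> real^2) set \<Rightarrow> (real^2 \<Rightarrow> real^2) \<Rightarrow>
   nat \<Rightarrow> (real^2 \<Rightarrow> real) \<Rightarrow> real^2 \<Rightarrow> real" where
  "op_T \<gamma> \<beta> C \<nu> n g x = 1 / pi * normal_derivative \<nu> (double_layer \<gamma> \<beta> C \<nu> n g) x"

end

theory Submission
  imports Defs
begin

text \<open>
  Each \<open>u\<^sub>n\<close> is a finite sum of double-layer potentials, so three things have to be seen: the
  potentials are twice continuously differentiable off the boundary, they satisfy the coupled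
  differential equations, and they have a normal derivative at every boundary point. The last
  point is where the work lies. The operators \<open>\<T>\<^sub>n\<close> are by definition one-sided limits; once these
  limits are known to exist for \<open>C\<^sup>1\<^sup>,\<^sup>\<alpha>\<close> densities, the normal derivative of \<open>u\<^sub>n\<close> is a sum of values
  of these operators, and the integral equations say that this sum is the given boundary value.

  The differential equations. As a function of the squared distance \<open>s = \<bar>x - y\<bar>\<^sup>2\<close>, the
  fundamental solution is \<open>A V\<^sub>n + B W\<^sub>n\<close> with polynomials \<open>V\<^sub>n\<close>, \<open>W\<^sub>n\<close> and with
  \<open>A = K\<^sub>0(\<gamma>\<surd>s)\<close>, \<open>B = \<gamma>\<surd>s K\<^sub>1(\<gamma>\<surd>s)\<close>, which obey \<open>A' = - B / (2s)\<close> and \<open>B' = - \<gamma>\<^sup>2 A / 2\<close>.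
  In these terms the recursion for the coefficients is exactly the statement
  \<open>4 s \<phi>\<^sub>n'' + 4 \<phi>\<^sub>n' - \<gamma>\<^sup>2 \<phi>\<^sub>n = \<Sum> \<beta>\<^sub>n\<^sub>-\<^sub>m \<phi>\<^sub>m\<close> (lemmas \<open>V_poly_ode\<close> and \<open>W_poly_ode\<close>), and one
  differentiation of it gives the equation for the dipole kernel (\<open>phi3_ode\<close>, \<open>sum_dl_hess\<close>).
  Off the boundary the kernels are smooth, so the equation passes to the potentials by
  differentiation under the integral sign.

  The normal derivative. All the \<open>\<phi>\<^sub>n\<close> have the same leading singularity \<open>- c log \<bar>x - y\<bar>\<close>, with
  one constant \<open>c\<close>, and what remains of the second derivatives is of order \<open>\<bar>x - y\<bar>\<close> to the power \<open>-1/2\<close> at most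
  (\<open>phi_singularity\<close>). For the logarithm, the second derivative in the two normal directions is,
  up to sign, the derivative along the curve of \<open>(d \<bullet> \<tau>) / \<bar>d\<bar>\<^sup>2\<close>, where \<open>d = p t - x\<close> and \<open>\<tau>\<close> is the unit
  tangent at the boundary point; this is a consequence of harmonicity in the plane, and it allows
  one to move one derivative to the density (\<open>integral_by_parts_conjugate\<close>). The resulting kernel
  is of Cauchy type. To remove the value of the differentiated density at the boundary point, a
  multiple of \<open>(d \<bullet> p' t) / \<bar>d\<bar>\<^sup>2\<close> is subtracted, which is half the derivative of \<open>log \<bar>d\<bar>\<^sup>2\<close> and has
  integral zero over the closed curve (\<open>integral_log_derivative\<close>). The integrand that is left
  (\<open>normal_component_of_gradient\<close>) is dominated by integrable powers of the parameter distance,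
  uniformly as the point approaches the boundary along the normal, and dominated convergence
  yields the limit (\<open>normal_derivative_limit\<close>).

  The integrals over the curves contain the normal field \<open>\<nu>\<close>, which is determined only pointwise.
  That \<open>\<nu>\<close> is continuous along each boundary curve, that is, a constant sign times the rotated
  tangent, follows from a collar of the curve that meets the boundary only in the curve itself
  (\<open>normal_collar\<close>, \<open>outward_normal_sign\<close>).
\<close>

section \<open>The modified Bessel functions near the origin\<close>

text \<open>
  The Bessel functions are the moments of order zero and one. The family of all moments is closed
  under differentiation, which the two functions alone are not.
\<close>
definition cosh_moment :: "nat \<Rightarrow> real \<Rightarrow> real" where
  "cosh_moment k z = integral {0..} (\<lambda>t. cosh t ^ k * exp (- z * cosh t))"

lemma half_exp_le_cosh: "exp t / 2 \<le> cosh (t::real)"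
  by (simp add: cosh_def)

text \<open>
  Since \<open>e\<^sup>x\<close> outgrows every power, the integrand is at most a multiple of \<open>1 / cosh t\<close>.
\<close>
lemma cosh_moment_integrable:
  fixes z :: real
  assumes "z > 0"
  shows "(\<lambda>t. cosh t ^ k * exp (- z * cosh t)) integrable_on {0..}"
proof -
  let ?c = "2 * (real (Suc k) / z) ^ Suc k"
  show ?thesis
  proof (rule measurable_bounded_by_integrable_imp_integrable_real[where g = "\<lambda>t. ?c * exp (-1 * t)"])
  show "(\<lambda>t. cosh t ^ k * exp (- z * cosh t)) \<in> borel_measurable (lebesgue_on {0::real..})"
    by (intro continuous_imp_measurable_on_sets_lebesgue continuous_intros) auto
  show "(\<lambda>t::real. ?c * exp (-1 * t)) integrable_on {0..}"
    by (intro integrable_on_mult_right integrable_on_exp_minus_to_infinity) auto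
  fix t :: real assume "t \<in> {0..}"
  let ?u = "cosh t"
  have u: "?u \<ge> exp t / 2" "?u > 0" by (rule half_exp_le_cosh) simp
  \<comment> \<open>The inequality \<open>(1 + x / n)\<^sup>n \<le> e\<^sup>x\<close> with \<open>n = k + 1\<close>: one power more than needed, which leaves the
    factor \<open>1 / cosh t\<close>.\<close>
  have "(z * ?u / real (Suc k)) ^ Suc k \<le> (1 + z * ?u / real (Suc k)) ^ Suc k"
    using u assms by (intro power_mono) auto
  also have "\<dots> \<le> exp (z * ?u)"
  proof (rule exp_ge_one_plus_x_over_n_power_n)
    have "0 < z * ?u" using u(2) assms by (rule mult_pos_pos[rotated])
    then show "- real (Suc k) \<le> z * ?u" by (smt (verit) of_nat_0_le_iff)
  qed auto
  finally have "(z * ?u / real (Suc k)) ^ Suc k * exp (- (z * ?u)) \<le> 1"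
    using mult_right_mono[of "(z * ?u / real (Suc k)) ^ Suc k" "exp (z * ?u)" "exp (- (z * ?u))"]
    by (simp only: exp_ge_zero) (simp only: flip: exp_add, simp)
  then have "?u ^ Suc k * exp (- (z * ?u)) \<le> (real (Suc k) / z) ^ Suc k"
  proof -
    assume a: "(z * ?u / real (Suc k)) ^ Suc k * exp (- (z * ?u)) \<le> 1"
    have e: "?u = (real (Suc k) / z) * (z * ?u / real (Suc k))" using assms by simp
    have "?u ^ Suc k = (real (Suc k) / z) ^ Suc k * (z * ?u / real (Suc k)) ^ Suc k"
      by (subst e, rule power_mult_distrib)
    then show ?thesis
      using mult_left_mono[OF a, of "(real (Suc k) / z) ^ Suc k"] assms by (simp only: mult.assoc) simp
  qed
  then have "?u ^ k * exp (- (z * ?u)) * ?u \<le> (real (Suc k) / z) ^ Suc k"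
    by (simp add: mult_ac)
  then have "?u ^ k * exp (- (z * ?u)) \<le> (real (Suc k) / z) ^ Suc k / ?u"
    by (simp only: pos_le_divide_eq[OF u(2)])
  also have "\<dots> \<le> (real (Suc k) / z) ^ Suc k / (exp t / 2)"
    using u assms by (intro divide_left_mono) auto
  finally show "\<bar>?u ^ k * exp (- z * ?u)\<bar> \<le> ?c * exp (-1 * t)"
    by (simp add: exp_minus abs_mult field_simps)
  qed auto
qed

lemma cosh_moment_nonneg: "z > 0 \<Longrightarrow> cosh_moment k z \<ge> 0"
  unfolding cosh_moment_def by (intro integral_nonneg cosh_moment_integrable) auto

lemma exp_taylor_bound: "\<bar>exp u - 1 - u\<bar> \<le> u\<^sup>2 * exp \<bar>u::real\<bar>"
proof -
  obtain t where t: "\<bar>t\<bar> \<le> \<bar>u\<bar>" "exp u = (\<Sum>m<2. u ^ m / fact m) + exp t / fact 2 * u ^ 2"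
    using Maclaurin_exp_le by blast
  have "exp u - 1 - u = exp t / 2 * u\<^sup>2" using t(2) by (simp add: numeral_2_eq_2)
  moreover have "exp t / 2 \<le> exp \<bar>u\<bar>" using t(1)
    by (smt (verit) exp_le_cancel_iff exp_gt_zero field_sum_of_halves)
  ultimately show ?thesis
    using mult_right_mono[of "exp t / 2" "exp \<bar>u\<bar>" "u\<^sup>2"]
    by (simp only: abs_mult abs_of_nonneg exp_ge_zero zero_le_power2 mult.commute[of "u\<^sup>2"] abs_divide)
qed

text \<open>
  A quantitative form of differentiation under the integral: the second order Taylor remainder of the
  exponential is a moment of order \<open>k + 2\<close>, and the factor \<open>exp \<bar>u\<bar>\<close> costs at most half of the decay
  rate as long as \<open>w\<close> stays within \<open>z / 2\<close> of \<open>z\<close>.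
\<close>
lemma cosh_moment_taylor:
  assumes "z > 0" "\<bar>w - z\<bar> \<le> z / 2"
  shows "\<bar>cosh_moment k w - cosh_moment k z + (w - z) * cosh_moment (Suc k) z\<bar>
         \<le> (w - z)\<^sup>2 * cosh_moment (k + 2) (z / 2)"
proof -
  have w: "w > 0" using assms by (simp add: abs_if split: if_splits)
  let ?f = "\<lambda>t. cosh t ^ k * exp (- w * cosh t) - cosh t ^ k * exp (- z * cosh t)
                + (w - z) * (cosh t ^ Suc k * exp (- z * cosh t))"
  let ?g = "\<lambda>t. (w - z)\<^sup>2 * (cosh t ^ (k + 2) * exp (- (z / 2) * cosh t))"
  have i: "\<And>k. (\<lambda>t. cosh t ^ k * exp (- w * cosh t)) integrable_on {0..}"
     "\<And>k. (\<lambda>t. cosh t ^ k * exp (- z * cosh t)) integrable_on {0..}"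
     "\<And>k. (\<lambda>t. cosh t ^ k * exp (- (z/2) * cosh t)) integrable_on {0..}"
    using assms w by (auto intro: cosh_moment_integrable[simplified] cosh_moment_integrable[of "z/2",simplified])
  have "norm (integral {0..} ?f) \<le> integral {0..} ?g"
  proof (rule integral_norm_bound_integral)
    show "?f integrable_on {0..}"
      by (intro integrable_add integrable_diff integrable_on_mult_right i)
    show "?g integrable_on {0..}"
      by (intro integrable_on_mult_right i)
    fix t :: real
    let ?c = "cosh t" let ?h = "- (w - z) * cosh t"
    have "?f t = ?c ^ k * exp (- z * ?c) * (exp ?h - 1 - ?h)"
      by (simp add: algebra_simps flip: exp_add)
    also have "norm \<dots> = ?c ^ k * exp (- z * ?c) * \<bar>exp ?h - 1 - ?h\<bar>"
      by (simp add: abs_mult)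
    also have "\<dots> \<le> ?c ^ k * exp (- z * ?c) * (?h\<^sup>2 * exp \<bar>?h\<bar>)"
      by (intro mult_left_mono exp_taylor_bound) auto
    also have "\<dots> = (w - z)\<^sup>2 * (?c ^ (k + 2) * exp (- z * ?c + \<bar>?h\<bar>))"
      by (simp add: power_mult_distrib exp_add power_add exp_diff exp_minus field_simps power2_eq_square)
    also have "\<dots> \<le> ?g t"
    proof -
      have "\<bar>?h\<bar> \<le> z / 2 * ?c" using mult_right_mono[OF assms(2), of ?c]
        by (simp only: abs_mult abs_minus_cancel cosh_real_abs abs_of_pos cosh_real_pos mult.assoc) simp
      then show ?thesis by (intro mult_left_mono) auto
    qed
    finally show "norm (?f t) \<le> ?g t" .
  qed
  moreover have "integral {0..} ?f = cosh_moment k w - cosh_moment k z + (w - z) * cosh_moment (Suc k) z"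
    unfolding cosh_moment_def
    by (intro integral_unique has_integral_add has_integral_diff has_integral_mult_right integrable_integral i)
  moreover have "integral {0..} ?g = (w - z)\<^sup>2 * cosh_moment (k + 2) (z / 2)"
    unfolding cosh_moment_def by (simp add: mult.assoc)
  ultimately show ?thesis by (simp only: real_norm_def)
qed

lemma cosh_moment_deriv:
  assumes "z > 0"
  shows "(cosh_moment k has_real_derivative - cosh_moment (Suc k) z) (at z)"
proof -
  let ?M = "cosh_moment (k + 2) (z / 2)"
  have "((\<lambda>w. (cosh_moment k w - cosh_moment k z) / (w - z) - (- cosh_moment (Suc k) z)) \<longlongrightarrow> 0) (at z)"
  proof (rule Lim_null_comparison)
    show "((\<lambda>w. \<bar>w - z\<bar> * ?M) \<longlongrightarrow> 0) (at z)"
      by (auto intro!: tendsto_eq_intros)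
    have "eventually (\<lambda>w. w \<noteq> z \<and> \<bar>w - z\<bar> < z / 2) (at z)"
      using assms by (auto simp: eventually_at dist_real_def intro!: exI[of _ "z/2"])
    then show "\<forall>\<^sub>F w in at z. norm ((cosh_moment k w - cosh_moment k z) / (w - z) - - cosh_moment (Suc k) z) \<le> \<bar>w - z\<bar> * ?M"
    proof eventually_elim
      case (elim w)
      have "(cosh_moment k w - cosh_moment k z) / (w - z) - - cosh_moment (Suc k) z
         = (cosh_moment k w - cosh_moment k z + (w - z) * cosh_moment (Suc k) z) / (w - z)"
        using elim by (simp add: field_simps)
      also have "norm \<dots> \<le> ((w - z)\<^sup>2 * ?M) / \<bar>w - z\<bar>"
        using cosh_moment_taylor[of z w k] assms elim by (simp add: divide_right_mono)
      also have "\<dots> = \<bar>w - z\<bar> * ?M"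
      proof -
        have "(w - z)\<^sup>2 = \<bar>w - z\<bar> * \<bar>w - z\<bar>" by (simp add: power2_eq_square)
        moreover have "\<bar>w - z\<bar> \<noteq> 0" using elim by simp
        ultimately show ?thesis by (metis mult.assoc nonzero_mult_div_cancel_left)
      qed
      finally show ?case .
    qed
  qed
  then show ?thesis
    unfolding has_field_derivative_iff using LIM_zero_cancel by fastforce
qed

lemma integral_half_line_limit:
  fixes f :: "real \<Rightarrow> real"
  assumes "f absolutely_integrable_on {0..}"
  shows "((\<lambda>b. integral {0..b} f) \<longlongrightarrow> integral {0..} f) at_top"
proof -
  have "((\<lambda>b. set_lebesgue_integral lebesgue {0..b} f) \<longlongrightarrow> set_lebesgue_integral lebesgue {0..} f) at_top"
    by (rule tendsto_set_lebesgue_integral_at_top) (use assms in auto)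
  moreover have "set_lebesgue_integral lebesgue {0..b} f = integral {0..b} f" for b
    by (rule set_lebesgue_integral_eq_integral(2))
      (rule set_integrable_subset[OF assms], auto)
  ultimately show ?thesis using set_lebesgue_integral_eq_integral(2)[OF assms] by simp
qed

text \<open>
  The modified Bessel equation in integrated form: the integrand of the difference of the two sides
  is the derivative of \<open>sinh t exp (- z cosh t)\<close>, which vanishes at both ends.
\<close>
lemma cosh_moment_recurrence:
  assumes z: "z > 0"
  shows "z * cosh_moment 2 z - z * cosh_moment 0 z = cosh_moment 1 z"
proof -
  let ?m = "\<lambda>k t. cosh t ^ k * exp (- z * cosh (t::real))"
  let ?f = "\<lambda>t. ?m 1 t - z * ?m 2 t + z * ?m 0 t"
  have a: "?m k absolutely_integrable_on {0..}" for k
    by (rule nonnegative_absolutely_integrable_1[OF cosh_moment_integrable[OF z]]) auto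
  have F: "(?f has_integral sinh b * exp (- z * cosh b) - sinh 0 * exp (- z * cosh 0)) {0..b}" if "b \<ge> 0" for b
  proof (rule fundamental_theorem_of_calculus[OF that])
    fix t :: real
    have "((\<lambda>t. sinh t * exp (- z * cosh t)) has_real_derivative
            cosh t * exp (- z * cosh t) + sinh t * (exp (- z * cosh t) * (- z * sinh t))) (at t within {0..b})"
      by (auto intro!: derivative_eq_intros)
    moreover have "cosh t * exp (- z * cosh t) + sinh t * (exp (- z * cosh t) * (- z * sinh t)) = ?f t"
    proof -
      have "sinh t * (exp (- z * cosh t) * (- z * sinh t)) = - z * exp (- z * cosh t) * (sinh t)\<^sup>2"
        by (simp add: power2_eq_square)
      then show ?thesis unfolding sinh_square_eq by (simp add: algebra_simps)
    qed
    ultimately have "((\<lambda>t. sinh t * exp (- z * cosh t)) has_real_derivative ?f t) (at t within {0..b})"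
      by (simp only:)
    then show "((\<lambda>t. sinh t * exp (- z * cosh t)) has_vector_derivative ?f t) (at t within {0..b})"
      by (simp only: has_real_derivative_iff_has_vector_derivative)
  qed
  have "((\<lambda>b. sinh b * exp (- z * cosh b)) \<longlongrightarrow> 0) at_top"
  proof (rule Lim_null_comparison)
    show "((\<lambda>b. 8 / z\<^sup>2 * exp (- b)) \<longlongrightarrow> 0) at_top"
      by (intro tendsto_mult_right_zero filterlim_compose[OF exp_at_bot] filterlim_uminus_at_bot_at_top)
    have "norm (sinh b * exp (- z * cosh b)) \<le> 8 / z\<^sup>2 * exp (- b)" if "b \<ge> 0" for b
    proof -
      let ?u = "cosh b"
      have "sinh b \<le> ?u" by (rule less_imp_le[OF sinh_less_cosh_real])
      have "(z * ?u / 2)\<^sup>2 \<le> (1 + z * ?u / real 2) ^ 2" using z by (intro power_mono) auto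
      also have "\<dots> \<le> exp (z * ?u)"
        by (rule exp_ge_one_plus_x_over_n_power_n) (use z in \<open>auto intro: order_trans[of _ 0]\<close>)
      finally have "(z * ?u)\<^sup>2 * exp (- (z * ?u)) \<le> 4" by (simp add: exp_minus field_simps)
      then have "?u * exp (- (z * ?u)) \<le> 4 / z\<^sup>2 / ?u"
        using z by (simp add: field_simps power2_eq_square)
      also have "\<dots> \<le> 4 / z\<^sup>2 / (exp b / 2)"
        using z half_exp_le_cosh[of b] by (intro divide_left_mono) auto
      finally have "?u * exp (- (z * ?u)) \<le> 8 / z\<^sup>2 * exp (- b)" by (simp add: exp_minus field_simps)
      moreover have "sinh b * exp (- (z * ?u)) \<le> ?u * exp (- (z * ?u))"
        using \<open>sinh b \<le> ?u\<close> by (intro mult_right_mono) auto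
      ultimately have "sinh b * exp (- (z * ?u)) \<le> 8 / z\<^sup>2 * exp (- b)" by (rule order_trans[rotated])
      then show ?thesis using that by (simp add: abs_mult)
    qed
    then show "\<forall>\<^sub>F b in at_top. norm (sinh b * exp (- z * cosh b)) \<le> 8 / z\<^sup>2 * exp (- b)"
      by (auto simp: eventually_at_top_linorder intro!: exI[of _ 0])
  qed
  moreover have "eventually (\<lambda>b. sinh b * exp (- z * cosh b) = integral {0..b} ?f) at_top"
    using F by (auto simp: eventually_at_top_linorder integral_unique intro!: exI[of _ 0] integral_unique[OF F, simplified, symmetric])
  ultimately have "((\<lambda>b. integral {0..b} ?f) \<longlongrightarrow> 0) at_top"
    by (rule Lim_transform_eventually)
  moreover have "?f absolutely_integrable_on {0..}"
    using set_integral_add(1)[OF set_integral_diff(1)[OF a[of 1] set_integrable_mult_right[of z, OF a[of 2]]]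
      set_integrable_mult_right[of z, OF a[of 0]]] by simp
  ultimately have "integral {0..} ?f = 0"
    using integral_half_line_limit tendsto_unique trivial_limit_at_top_linorder by blast
  moreover have "integral {0..} ?f = cosh_moment 1 z - z * cosh_moment 2 z + z * cosh_moment 0 z"
    unfolding cosh_moment_def
    using cosh_moment_integrable[OF z, of 1] cosh_moment_integrable[OF z, of 2] cosh_moment_integrable[OF z, of 0]
    by (subst integral_add) (auto intro!: integrable_diff integrable_on_mult_right simp: integral_diff integrable_on_mult_right)
  ultimately show ?thesis by simp
qed

text \<open>
  The true order is logarithmic. The weaker power bound follows at once from \<open>e\<^sup>-\<^sup>x \<le> x\<^sup>-\<^sup>1\<^sup>/\<^sup>2\<close>, and it is
  integrable along a curve, which is what matters in the end.
\<close>
lemma cosh_moment_0_bound: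
  obtains C where "C > 0" "\<And>z. z > 0 \<Longrightarrow> cosh_moment 0 z \<le> C * z powr (-1/2)"
proof
  let ?I = "integral {0..} (\<lambda>t::real. sqrt 2 * exp (- (1/2) * t))"
  have int: "(\<lambda>t::real. sqrt 2 * exp (- (1/2) * t)) integrable_on {0..}"
    using integrable_on_mult_right[OF integrable_on_exp_minus_to_infinity[of "1/2" 0], of "sqrt 2"] by simp
  have "?I \<ge> 0" by (intro integral_nonneg int) auto
  then show "?I + 1 > 0" by simp
  fix z :: real assume z: "z > 0"
  have "cosh_moment 0 z \<le> integral {0..} (\<lambda>t. z powr (-1/2) * (sqrt 2 * exp (- (1/2) * t)))"
    unfolding cosh_moment_def
  proof (intro integral_le cosh_moment_integrable z integrable_on_mult_right[OF int])
    fix t :: real assume "t \<in> {0..}"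
    have pos: "z * cosh t > 0" using z by simp
    have e: "z * (exp t / 2) \<le> z * cosh t" using z half_exp_le_cosh[of t] by simp
    have "sqrt (z * cosh t) \<le> exp (z * cosh t)"
    proof (rule real_le_lsqrt)
      show "0 \<le> exp (z * cosh t)" by simp
      have "z * cosh t \<le> exp (z * cosh t)" using exp_ge_add_one_self[of "z * cosh t"] by linarith
      also have "\<dots> \<le> exp (z * cosh t) ^ 2" using pos by (simp add: power2_eq_square)
      finally show "z * cosh t \<le> (exp (z * cosh t))\<^sup>2" .
    qed
    then have "exp (- (z * cosh t)) \<le> 1 / sqrt (z * cosh t)"
      using pos by (simp add: exp_minus field_simps)
    also have "\<dots> \<le> 1 / sqrt (z * (exp t / 2))"
      using z e by (intro divide_left_mono real_sqrt_le_mono mult_pos_pos) auto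
    also have "sqrt (exp t) = exp (t / 2)"
      by (rule real_sqrt_unique) (simp_all add: power2_eq_square flip: exp_add)
    then have "1 / sqrt (z * (exp t / 2)) = z powr (-1/2) * (sqrt 2 * exp (- (1/2) * t))"
      using z by (simp add: real_sqrt_mult real_sqrt_divide powr_minus powr_half_sqrt exp_minus field_simps)
    finally show "cosh t ^ 0 * exp (- z * cosh t) \<le> z powr (-1/2) * (sqrt 2 * exp (- (1/2) * t))" by simp
  qed
  also have "\<dots> = z powr (-1/2) * ?I" by (rule integral_mult_right)
  also have "\<dots> \<le> (?I + 1) * z powr (-1/2)" by (simp add: algebra_simps)
  finally show "cosh_moment 0 z \<le> (?I + 1) * z powr (-1/2)" .
qed

text \<open>
  In terms of the squared distance \<open>s\<close> the two Bessel functions satisfy a first order system without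
  square roots, if \<open>K\<^sub>1\<close> is multiplied by its argument.
\<close>
definition kernel_A :: "real \<Rightarrow> real \<Rightarrow> real" where
  "kernel_A \<gamma> s = bessel_K 0 (\<gamma> * sqrt s)"

definition kernel_B :: "real \<Rightarrow> real \<Rightarrow> real" where
  "kernel_B \<gamma> s = \<gamma> * sqrt s * bessel_K 1 (\<gamma> * sqrt s)"

lemma bessel_K_eq_cosh_moment: "bessel_K 0 z = cosh_moment 0 z" "bessel_K 1 z = cosh_moment 1 z"
  by (simp_all add: bessel_K_def cosh_moment_def mult.commute)

lemma bessel_K0_deriv: "z > 0 \<Longrightarrow> (bessel_K 0 has_real_derivative - bessel_K 1 z) (at z)"
  using cosh_moment_deriv[of z 0] by (simp add: bessel_K_eq_cosh_moment[abs_def])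

lemma z_bessel_K1_deriv:
  assumes "z > 0"
  shows "((\<lambda>z. z * bessel_K 1 z) has_real_derivative - (z * bessel_K 0 z)) (at z)"
proof -
  have "((\<lambda>z. z * cosh_moment 1 z) has_real_derivative
          1 * cosh_moment 1 z + - cosh_moment (Suc 1) z * z) (at z)"
    by (intro DERIV_mult DERIV_ident cosh_moment_deriv assms)
  moreover have "1 * cosh_moment 1 z + - cosh_moment (Suc 1) z * z = - (z * cosh_moment 0 z)"
    using cosh_moment_recurrence[OF assms] by (simp add: numeral_2_eq_2 algebra_simps)
  ultimately show ?thesis by (simp only: bessel_K_eq_cosh_moment)
qed

lemma kernel_A_deriv:
  assumes "\<gamma> > 0" "s > 0"
  shows "(kernel_A \<gamma> has_real_derivative - kernel_B \<gamma> s / (2 * s)) (at s)"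
proof -
  have "((\<lambda>s. bessel_K 0 (\<gamma> * sqrt s)) has_real_derivative
     - bessel_K 1 (\<gamma> * sqrt s) * (\<gamma> * (inverse (sqrt s) / 2))) (at s)"
    by (rule DERIV_chain2[OF bessel_K0_deriv]) (use assms in \<open>auto intro!: derivative_eq_intros\<close>)
  moreover have "- bessel_K 1 (\<gamma> * sqrt s) * (\<gamma> * (inverse (sqrt s) / 2)) = - kernel_B \<gamma> s / (2 * s)"
    using assms by (simp add: kernel_B_def field_simps)
  ultimately show ?thesis by (simp only: kernel_A_def[abs_def])
qed

lemma kernel_B_deriv:
  assumes "\<gamma> > 0" "s > 0"
  shows "(kernel_B \<gamma> has_real_derivative - (\<gamma>\<^sup>2 / 2) * kernel_A \<gamma> s) (at s)"
proof -
  have "((\<lambda>s. (\<lambda>z. z * bessel_K 1 z) (\<gamma> * sqrt s)) has_real_derivative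
     - (\<gamma> * sqrt s * bessel_K 0 (\<gamma> * sqrt s)) * (\<gamma> * (inverse (sqrt s) / 2))) (at s)"
    by (rule DERIV_chain2[OF z_bessel_K1_deriv]) (use assms in \<open>auto intro!: derivative_eq_intros\<close>)
  moreover have "- (\<gamma> * sqrt s * bessel_K 0 (\<gamma> * sqrt s)) * (\<gamma> * (inverse (sqrt s) / 2))
       = - (\<gamma>\<^sup>2 / 2) * kernel_A \<gamma> s"
    using assms by (simp add: kernel_A_def field_simps power2_eq_square)
  ultimately show ?thesis by (simp add: kernel_B_def[abs_def])
qed

text \<open>
  The limit \<open>c\<close> at the origin will be the common coefficient of the logarithms in all the fundamental
  solutions. Both \<open>z K\<^sub>1(z)\<close> and its sum with a
  suitable multiple of \<open>z\<^sup>3\<^sup>/\<^sup>2\<close> are monotone, in opposite directions, because the derivative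
  \<open>- z K\<^sub>0(z)\<close> is of order \<open>z\<^sup>1\<^sup>/\<^sup>2\<close>. Hence the supremum of the first lies between the two.
\<close>
lemma z_bessel_K1_near_0:
  obtains c C where "C > 0" "\<And>z. z > 0 \<Longrightarrow> \<bar>z * bessel_K 1 z - c\<bar> \<le> C * z powr (3/2)"
proof -
  obtain C where C: "C > 0" "\<And>z. z > 0 \<Longrightarrow> cosh_moment 0 z \<le> C * z powr (-1/2)"
    using cosh_moment_0_bound by blast
  \<comment> \<open>The coefficient \<open>2/3\<close> makes the derivative of \<open>?r\<close> equal to \<open>C z\<^sup>1\<^sup>/\<^sup>2\<close>.\<close>
  let ?f = "\<lambda>z. z * bessel_K 1 z" and ?r = "\<lambda>z::real. 2/3 * C * z powr (3/2)"
  have anti: "?f z \<le> ?f w" if "0 < w" "w \<le> z" for w z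
  proof (rule DERIV_nonpos_imp_nonincreasing[OF that(2)])
    fix x assume x: "w \<le> x" "x \<le> z"
    then have "x * bessel_K 0 x \<ge> 0"
      using that cosh_moment_nonneg[of x 0] by (simp add: bessel_K_eq_cosh_moment)
    then show "\<exists>y. (?f has_real_derivative y) (at x) \<and> y \<le> 0"
      using z_bessel_K1_deriv[of x] x that by force
  qed
  have incr: "?f w + ?r w \<le> ?f z + ?r z" if "0 < w" "w \<le> z" for w z
  proof (rule DERIV_nonneg_imp_nondecreasing[OF that(2)])
    fix x assume x: "w \<le> x" "x \<le> z"
    then have x0: "x > 0" using that by simp
    have d: "((\<lambda>z. ?f z + ?r z) has_real_derivative - (x * bessel_K 0 x) + 2/3 * C * ((3/2) * x powr (3/2 - 1))) (at x)"
      by (intro DERIV_add z_bessel_K1_deriv x0 DERIV_cmult has_real_derivative_powr)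
    have "x * bessel_K 0 x \<le> x * (C * x powr (-1/2))"
      using C(2)[OF x0] x0 by (simp add: bessel_K_eq_cosh_moment)
    also have "\<dots> = C * x powr (3/2 - 1)" using x0 powr_add[of x 1 "-1/2"] by simp
    finally show "\<exists>y. ((\<lambda>z. ?f z + ?r z) has_real_derivative y) (at x) \<and> 0 \<le> y"
      using d by (intro exI conjI) auto
  qed
  have le: "?f w \<le> ?f z + ?r z" if "0 < w" "0 < z" for w z
  proof (cases "w \<le> z")
    case True
    have "0 \<le> ?r w" using C by simp
    with incr[OF that(1) True] show ?thesis by linarith
  next
    case False
    have "0 \<le> ?r z" using C by simp
    with False anti[of z w] that show ?thesis by linarith
  qed
  let ?c = "SUP w\<in>{0<..}. ?f w"
  have bdd: "bdd_above (?f ` {0<..})" using le[of _ 1] by (intro bdd_aboveI[of _ "?f 1 + ?r 1"]) auto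
  have "\<bar>?f z - ?c\<bar> \<le> 2/3 * C * z powr (3/2)" if "z > 0" for z
  proof -
    have "?f z \<le> ?c" using that by (intro cSUP_upper bdd) auto
    moreover have "?c \<le> ?f z + ?r z" using le that by (intro cSUP_least) auto
    ultimately show ?thesis by simp
  qed
  then show thesis using C(1) by (intro that[of "2/3*C" ?c]) auto
qed

section \<open>The polynomial factors of the fundamental solutions\<close>

lemma coeff_a_0: "coeff_a \<gamma> \<beta> n 0 = 1"
  by (subst coeff_a.simps) simp

lemma coeff_a_eq_0: "k > n \<Longrightarrow> coeff_a \<gamma> \<beta> n k = 0"
  by (subst coeff_a.simps) simp

text \<open>
  The separate rule for \<open>k = n\<close> is the general one, once the coefficients with \<open>k > n\<close> count as zero; then
  the sum may also start at \<open>m = 0\<close>.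
\<close>
lemma coeff_a_recursion:
  assumes "\<gamma> \<noteq> 0" "k \<ge> 1"
  shows "2 * \<gamma> * real k * coeff_a \<gamma> \<beta> n k =
    4 * (real ((k + 1) div 2))\<^sup>2 * coeff_a \<gamma> \<beta> n (k + 1) - (\<Sum>m<n. \<beta> (n - m) * coeff_a \<gamma> \<beta> m (k - 1))"
proof -
  have S: "(\<Sum>m<n. \<beta> (n - m) * coeff_a \<gamma> \<beta> m (k - 1)) = (\<Sum>m\<in>{k - 1..<n}. \<beta> (n - m) * coeff_a \<gamma> \<beta> m (k - 1))"
    by (rule sum.mono_neutral_right) (auto simp: coeff_a_eq_0)
  consider "k = n" | "k < n" | "k > n" by linarith
  then show ?thesis
  proof cases
    case 1
    have "{k - 1..<n} = {n - 1}" using 1 assms by auto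
    then have "(\<Sum>m<n. \<beta> (n - m) * coeff_a \<gamma> \<beta> m (k - 1)) = \<beta> 1 * coeff_a \<gamma> \<beta> (n - 1) (n - 1)"
      using 1 assms by (subst S) simp
    moreover have "coeff_a \<gamma> \<beta> n k = - (1 / (2 * \<gamma> * real n)) * \<beta> 1 * coeff_a \<gamma> \<beta> (n - 1) (n - 1)"
      using 1 assms by (subst coeff_a.simps) simp
    ultimately show ?thesis using 1 assms by (simp add: coeff_a_eq_0)
  next
    case 2
    then have "{k - 1..n - 1} = {k - 1..<n}" by auto
    then have "coeff_a \<gamma> \<beta> n k = 1 / (2 * \<gamma> * real k) * (4 * (real ((k + 1) div 2))\<^sup>2 * coeff_a \<gamma> \<beta> n (k + 1)
          - (\<Sum>m\<in>{k - 1..<n}. \<beta> (n - m) * coeff_a \<gamma> \<beta> m (k - 1)))"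
      using 2 assms by (subst coeff_a.simps) simp
    then show ?thesis using assms unfolding S by simp
  next
    case 3
    then have "{k - 1..<n} = {}" by auto
    then have "(\<Sum>m<n. \<beta> (n - m) * coeff_a \<gamma> \<beta> m (k - 1)) = 0" by (subst S) simp
    then show ?thesis using 3 by (simp add: coeff_a_eq_0)
  qed
qed

text \<open>
  The upper summation bound \<open>n\<close> may exceed the degree; the surplus coefficients vanish, and no case
  distinction on the parity of \<open>n\<close> is needed.
\<close>
definition V_poly :: "real \<Rightarrow> (nat \<Rightarrow> real) \<Rightarrow> nat \<Rightarrow> real poly" where
  "V_poly \<gamma> \<beta> n = (\<Sum>k\<le>n. monom (coeff_a \<gamma> \<beta> n (2 * k)) k)"

definition W_poly :: "real \<Rightarrow> (nat \<Rightarrow> real) \<Rightarrow> nat \<Rightarrow> real poly" where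
  "W_poly \<gamma> \<beta> n = (\<Sum>k\<le>n. monom (coeff_a \<gamma> \<beta> n (2 * k + 1) / \<gamma>) k)"

lemma coeff_V_poly: "coeff (V_poly \<gamma> \<beta> n) k = coeff_a \<gamma> \<beta> n (2 * k)"
  by (simp add: V_poly_def coeff_sum coeff_a_eq_0)

lemma coeff_W_poly: "coeff (W_poly \<gamma> \<beta> n) k = coeff_a \<gamma> \<beta> n (2 * k + 1) / \<gamma>"
  by (simp add: W_poly_def coeff_sum coeff_a_eq_0)

lemma poly_v_eq: "poly_v \<gamma> \<beta> n r = poly (V_poly \<gamma> \<beta> n) (r\<^sup>2)"
proof -
  have "(\<Sum>k=0..n div 2. coeff_a \<gamma> \<beta> n (2 * k) * r ^ (2 * k)) = (\<Sum>k\<le>n. coeff_a \<gamma> \<beta> n (2 * k) * r ^ (2 * k))"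
    by (rule sum.mono_neutral_left) (auto simp: coeff_a_eq_0)
  then show ?thesis by (simp add: poly_v_def V_poly_def poly_sum poly_monom power_mult)
qed

lemma poly_w_eq:
  assumes "\<gamma> \<noteq> 0"
  shows "poly_w \<gamma> \<beta> n r = \<gamma> * r * poly (W_poly \<gamma> \<beta> n) (r\<^sup>2)"
proof (cases "n = 0")
  case True
  then show ?thesis by (simp add: poly_w_def W_poly_def coeff_a_eq_0)
next
  case False
  have "(\<Sum>k=0..(n - 1) div 2. coeff_a \<gamma> \<beta> n (2 * k + 1) * r ^ (2 * k + 1)) = (\<Sum>k\<le>n. coeff_a \<gamma> \<beta> n (2 * k + 1) * r ^ (2 * k + 1))"
    by (rule sum.mono_neutral_left) (auto intro!: coeff_a_eq_0)
  then show ?thesis using False assms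
    by (simp add: poly_w_def W_poly_def poly_sum poly_monom sum_distrib_left mult_ac flip: power_mult)
qed

text \<open>
  Comparison of coefficients: at \<open>s\<^sup>k\<close> this is the recursion for the odd index \<open>2k + 1\<close>. The two terms
  with \<open>\<gamma>\<^sup>2\<close> combine to \<open>2 \<gamma> (2k + 1)\<close> times an odd coefficient.
\<close>
lemma V_poly_ode:
  assumes "\<gamma> \<noteq> 0"
  shows "smult 4 (pCons 0 (pderiv (pderiv (V_poly \<gamma> \<beta> n)))) + smult 4 (pderiv (V_poly \<gamma> \<beta> n))
    - smult (4 * \<gamma>\<^sup>2) (pCons 0 (pderiv (W_poly \<gamma> \<beta> n))) - smult (2 * \<gamma>\<^sup>2) (W_poly \<gamma> \<beta> n)
    = (\<Sum>m<n. smult (\<beta> (n - m)) (V_poly \<gamma> \<beta> m))"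
proof (rule poly_eqI)
  fix k
  have "2 * \<gamma> * real (2 * k + 1) * coeff_a \<gamma> \<beta> n (2 * k + 1) =
    4 * (real k + 1)\<^sup>2 * coeff_a \<gamma> \<beta> n (2 * k + 2) - (\<Sum>m<n. \<beta> (n - m) * coeff_a \<gamma> \<beta> m (2 * k))"
    using coeff_a_recursion[OF assms, of "2 * k + 1" \<beta> n] by (simp add: add.commute)
  moreover have "coeff_a \<gamma> \<beta> n (2 * k + 1) = \<gamma> * coeff (W_poly \<gamma> \<beta> n) k"
    using assms by (simp add: coeff_W_poly)
  ultimately have *: "2 * \<gamma>\<^sup>2 * real (2 * k + 1) * coeff (W_poly \<gamma> \<beta> n) k =
    4 * (real k + 1)\<^sup>2 * coeff (V_poly \<gamma> \<beta> n) (Suc k) - (\<Sum>m<n. \<beta> (n - m) * coeff (V_poly \<gamma> \<beta> m) k)"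
    by (simp add: coeff_V_poly power2_eq_square algebra_simps)
  show "coeff (smult 4 (pCons 0 (pderiv (pderiv (V_poly \<gamma> \<beta> n)))) + smult 4 (pderiv (V_poly \<gamma> \<beta> n))
    - smult (4 * \<gamma>\<^sup>2) (pCons 0 (pderiv (W_poly \<gamma> \<beta> n))) - smult (2 * \<gamma>\<^sup>2) (W_poly \<gamma> \<beta> n)) k
    = coeff (\<Sum>m<n. smult (\<beta> (n - m)) (V_poly \<gamma> \<beta> m)) k"
    using * by (cases k) (simp_all add: coeff_sum coeff_pderiv power2_eq_square algebra_simps)
qed

text \<open>
  The same comparison, now with the recursion for the even index \<open>2k + 2\<close>.
\<close>
lemma W_poly_ode:
  assumes "\<gamma> \<noteq> 0"
  shows "smult 4 (pCons 0 (pderiv (pderiv (W_poly \<gamma> \<beta> n)))) + smult 4 (pderiv (W_poly \<gamma> \<beta> n))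
    - smult 4 (pderiv (V_poly \<gamma> \<beta> n)) = (\<Sum>m<n. smult (\<beta> (n - m)) (W_poly \<gamma> \<beta> m))"
proof (rule poly_eqI)
  fix k
  have "2 * \<gamma> * real (2 * k + 2) * coeff_a \<gamma> \<beta> n (2 * k + 2) =
    4 * (real k + 1)\<^sup>2 * coeff_a \<gamma> \<beta> n (2 * k + 3) - (\<Sum>m<n. \<beta> (n - m) * coeff_a \<gamma> \<beta> m (2 * k + 1))"
  proof -
    have "2 * k + 2 + 1 = 2 * k + 3" "2 * k + 2 - 1 = 2 * k + 1" "real ((2 * k + 3) div 2) = real k + 1"
      by (simp_all add: add.commute)
    then show ?thesis using coeff_a_recursion[OF assms, of "2 * k + 2" \<beta> n]
      by (simp add: add.commute numeral_3_eq_3)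
  qed
  moreover have "coeff_a \<gamma> \<beta> m (2 * k + 1) = \<gamma> * coeff (W_poly \<gamma> \<beta> m) k" for k m
    using assms by (simp add: coeff_W_poly)
  from this[of n "Suc k"] this have "coeff_a \<gamma> \<beta> n (2 * k + 3) = \<gamma> * coeff (W_poly \<gamma> \<beta> n) (Suc k)"
     "\<And>m. coeff_a \<gamma> \<beta> m (2 * k + 1) = \<gamma> * coeff (W_poly \<gamma> \<beta> m) k"
    by (simp_all add: eval_nat_numeral)
  ultimately have "\<gamma> * (2 * real (2 * k + 2) * coeff (V_poly \<gamma> \<beta> n) (Suc k)) =
    \<gamma> * (4 * (real k + 1)\<^sup>2 * coeff (W_poly \<gamma> \<beta> n) (Suc k) - (\<Sum>m<n. \<beta> (n - m) * coeff (W_poly \<gamma> \<beta> m) k))"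
    by (simp add: coeff_V_poly right_diff_distrib sum_distrib_left mult_ac)
  then have *: "2 * real (2 * k + 2) * coeff (V_poly \<gamma> \<beta> n) (Suc k) =
    4 * (real k + 1)\<^sup>2 * coeff (W_poly \<gamma> \<beta> n) (Suc k) - (\<Sum>m<n. \<beta> (n - m) * coeff (W_poly \<gamma> \<beta> m) k)"
    using assms by simp
  show "coeff (smult 4 (pCons 0 (pderiv (pderiv (W_poly \<gamma> \<beta> n)))) + smult 4 (pderiv (W_poly \<gamma> \<beta> n))
    - smult 4 (pderiv (V_poly \<gamma> \<beta> n))) k = coeff (\<Sum>m<n. smult (\<beta> (n - m)) (W_poly \<gamma> \<beta> m)) k"
    using * by (cases k) (simp_all add: coeff_sum coeff_pderiv power2_eq_square algebra_simps)
qed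

section \<open>The fundamental solutions as functions of the squared distance\<close>

text \<open>
  The functions \<open>phi1\<close>, \<open>phi2\<close>, \<open>phi3\<close> are the first three derivatives of \<open>phi0\<close>. The last two are
  written down by solving the differential equation, and its derivative, for the highest order term:
  this keeps explicit formulas short and makes \<open>phi3_ode\<close> immediate. That they are
  derivatives is the content of \<open>phi1_deriv\<close> and \<open>phi2_deriv\<close>.
\<close>
definition phi0 :: "real \<Rightarrow> (nat \<Rightarrow> real) \<Rightarrow> nat \<Rightarrow> real \<Rightarrow> real" where
  "phi0 \<gamma> \<beta> n s = kernel_A \<gamma> s * poly (V_poly \<gamma> \<beta> n) s + kernel_B \<gamma> s * poly (W_poly \<gamma> \<beta> n) s"

definition phi1 :: "real \<Rightarrow> (nat \<Rightarrow> real) \<Rightarrow> nat \<Rightarrow> real \<Rightarrow> real" where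
  "phi1 \<gamma> \<beta> n s =
     kernel_A \<gamma> s * (poly (pderiv (V_poly \<gamma> \<beta> n)) s - \<gamma>\<^sup>2 / 2 * poly (W_poly \<gamma> \<beta> n) s)
     + kernel_B \<gamma> s * (poly (pderiv (W_poly \<gamma> \<beta> n)) s - poly (V_poly \<gamma> \<beta> n) s / (2 * s))"

definition phi2 :: "real \<Rightarrow> (nat \<Rightarrow> real) \<Rightarrow> nat \<Rightarrow> real \<Rightarrow> real" where
  "phi2 \<gamma> \<beta> n s = ((\<Sum>m<n. \<beta> (n - m) * phi0 \<gamma> \<beta> m s) + \<gamma>\<^sup>2 * phi0 \<gamma> \<beta> n s - 4 * phi1 \<gamma> \<beta> n s) / (4 * s)"

definition phi3 :: "real \<Rightarrow> (nat \<Rightarrow> real) \<Rightarrow> nat \<Rightarrow> real \<Rightarrow> real" where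
  "phi3 \<gamma> \<beta> n s = ((\<Sum>m<n. \<beta> (n - m) * phi1 \<gamma> \<beta> m s) + \<gamma>\<^sup>2 * phi1 \<gamma> \<beta> n s - 8 * phi2 \<gamma> \<beta> n s) / (4 * s)"

lemma Phi_eq_phi0:
  assumes "\<gamma> > 0"
  shows "Phi \<gamma> \<beta> n x y = phi0 \<gamma> \<beta> n ((norm (x - y))\<^sup>2)"
  using assms by (simp add: Phi_def phi0_def poly_v_eq poly_w_eq kernel_A_def kernel_B_def)

lemma phi0_deriv:
  assumes "\<gamma> > 0" "s > 0"
  shows "(phi0 \<gamma> \<beta> n has_real_derivative phi1 \<gamma> \<beta> n s) (at s)"
proof -
  let ?V = "V_poly \<gamma> \<beta> n" and ?W = "W_poly \<gamma> \<beta> n"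
  have "((\<lambda>s. kernel_A \<gamma> s * poly ?V s + kernel_B \<gamma> s * poly ?W s) has_real_derivative
     (- kernel_B \<gamma> s / (2 * s) * poly ?V s + poly (pderiv ?V) s * kernel_A \<gamma> s)
     + (- (\<gamma>\<^sup>2 / 2) * kernel_A \<gamma> s * poly ?W s + poly (pderiv ?W) s * kernel_B \<gamma> s)) (at s)"
    by (intro DERIV_add DERIV_mult kernel_A_deriv kernel_B_deriv assms poly_DERIV)
  moreover have "(- kernel_B \<gamma> s / (2 * s) * poly ?V s + poly (pderiv ?V) s * kernel_A \<gamma> s)
     + (- (\<gamma>\<^sup>2 / 2) * kernel_A \<gamma> s * poly ?W s + poly (pderiv ?W) s * kernel_B \<gamma> s) = phi1 \<gamma> \<beta> n s"
    by (simp add: phi1_def algebra_simps)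
  ultimately show ?thesis by (simp only: phi0_def[abs_def])
qed

text \<open>
  The right-hand side is the second derivative as the product rule produces it. The equality is the
  differential equation for \<open>phi0\<close>, separated into its components along \<open>kernel_A\<close> and \<open>kernel_B\<close>; each
  component is one of the two polynomial identities.
\<close>
lemma phi2_eq:
  fixes \<gamma> s :: real and \<beta> :: "nat \<Rightarrow> real" and n :: nat
  assumes "\<gamma> > 0" "s > 0"
  defines "V \<equiv> poly (V_poly \<gamma> \<beta> n) s" and "V' \<equiv> poly (pderiv (V_poly \<gamma> \<beta> n)) s"
    and "V'' \<equiv> poly (pderiv (pderiv (V_poly \<gamma> \<beta> n))) s"
    and "W \<equiv> poly (W_poly \<gamma> \<beta> n) s" and "W' \<equiv> poly (pderiv (W_poly \<gamma> \<beta> n)) s"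
    and "W'' \<equiv> poly (pderiv (pderiv (W_poly \<gamma> \<beta> n))) s"
  shows "phi2 \<gamma> \<beta> n s = kernel_A \<gamma> s * (V'' - \<gamma>\<^sup>2 * W' + \<gamma>\<^sup>2 * V / (4 * s))
     + kernel_B \<gamma> s * (W'' - V' / s + V / (2 * s\<^sup>2) + \<gamma>\<^sup>2 * W / (4 * s))"
proof -
  have "poly (\<Sum>m<n. smult (\<beta> (n - m)) (V_poly \<gamma> \<beta> m)) s = 4 * s * V'' + 4 * V' - 4 * \<gamma>\<^sup>2 * s * W' - 2 * \<gamma>\<^sup>2 * W"
    using assms(1) unfolding V''_def V'_def W'_def W_def by (subst V_poly_ode[symmetric]) auto
  then have SV: "(\<Sum>m<n. \<beta> (n - m) * poly (V_poly \<gamma> \<beta> m) s) = 4 * s * V'' + 4 * V' - 4 * \<gamma>\<^sup>2 * s * W' - 2 * \<gamma>\<^sup>2 * W"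
    by (simp add: poly_sum)
  have "poly (\<Sum>m<n. smult (\<beta> (n - m)) (W_poly \<gamma> \<beta> m)) s = 4 * s * W'' + 4 * W' - 4 * V'"
    using assms(1) unfolding W''_def V'_def W'_def by (subst W_poly_ode[symmetric]) auto
  then have SW: "(\<Sum>m<n. \<beta> (n - m) * poly (W_poly \<gamma> \<beta> m) s) = 4 * s * W'' + 4 * W' - 4 * V'"
    by (simp add: poly_sum)
  have "(\<Sum>m<n. \<beta> (n - m) * phi0 \<gamma> \<beta> m s) =
    kernel_A \<gamma> s * (\<Sum>m<n. \<beta> (n - m) * poly (V_poly \<gamma> \<beta> m) s)
    + kernel_B \<gamma> s * (\<Sum>m<n. \<beta> (n - m) * poly (W_poly \<gamma> \<beta> m) s)"
    by (simp add: phi0_def sum_distrib_left distrib_left sum.distrib mult_ac)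
  then have S: "(\<Sum>m<n. \<beta> (n - m) * phi0 \<gamma> \<beta> m s) =
    kernel_A \<gamma> s * (4 * s * V'' + 4 * V' - 4 * \<gamma>\<^sup>2 * s * W' - 2 * \<gamma>\<^sup>2 * W)
    + kernel_B \<gamma> s * (4 * s * W'' + 4 * W' - 4 * V')" unfolding SV SW .
  have q: "(a * (4 * s * V'' + 4 * V' - 4 * g * s * W' - 2 * g * W) + b * (4 * s * W'' + 4 * W' - 4 * V')
     + g * (a * V + b * W) - 4 * (a * (V' - g / 2 * W) + b * (W' - V / (2 * s)))) / (4 * s)
     = a * (V'' - g * W' + g * V / (4 * s)) + b * (W'' - V' / s + V / (2 * s\<^sup>2) + g * W / (4 * s))" for a b g
    using assms(2) by (simp add: field_simps power2_eq_square)
  show ?thesis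
    unfolding phi2_def S
    unfolding phi1_def phi0_def
    using q[of "kernel_A \<gamma> s" "\<gamma>\<^sup>2" "kernel_B \<gamma> s"]
    unfolding V_def V'_def V''_def W_def W'_def W''_def by simp
qed

lemma phi1_deriv:
  assumes "\<gamma> > 0" "s > 0"
  shows "(phi1 \<gamma> \<beta> n has_real_derivative phi2 \<gamma> \<beta> n s) (at s)"
proof -
  let ?V = "V_poly \<gamma> \<beta> n" and ?W = "W_poly \<gamma> \<beta> n"
  have 1: "((\<lambda>s. poly (pderiv ?V) s - \<gamma>\<^sup>2 / 2 * poly ?W s) has_real_derivative
      poly (pderiv (pderiv ?V)) s - \<gamma>\<^sup>2 / 2 * poly (pderiv ?W) s) (at s)"
    by (intro DERIV_diff DERIV_cmult poly_DERIV)
  have 2: "((\<lambda>s. poly (pderiv ?W) s - poly ?V s / (2 * s)) has_real_derivative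
      poly (pderiv (pderiv ?W)) s - (poly (pderiv ?V) s * (2 * s) - poly ?V s * 2) / ((2 * s) * (2 * s))) (at s)"
    using assms by (intro DERIV_diff DERIV_divide poly_DERIV) (auto intro!: derivative_eq_intros)
  have "(phi1 \<gamma> \<beta> n has_real_derivative
     (- kernel_B \<gamma> s / (2 * s) * (poly (pderiv ?V) s - \<gamma>\<^sup>2 / 2 * poly ?W s)
        + (poly (pderiv (pderiv ?V)) s - \<gamma>\<^sup>2 / 2 * poly (pderiv ?W) s) * kernel_A \<gamma> s)
     + (- (\<gamma>\<^sup>2 / 2) * kernel_A \<gamma> s * (poly (pderiv ?W) s - poly ?V s / (2 * s))
        + (poly (pderiv (pderiv ?W)) s - (poly (pderiv ?V) s * (2 * s) - poly ?V s * 2) / ((2 * s) * (2 * s))) * kernel_B \<gamma> s)) (at s)"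
    unfolding phi1_def[abs_def]
    by (intro DERIV_add[OF DERIV_mult DERIV_mult] kernel_A_deriv kernel_B_deriv assms 1 2)
  moreover have "(- b / (2 * s) * (V' - g / 2 * W) + (V'' - g / 2 * W') * a)
     + (- (g / 2) * a * (W' - V / (2 * s)) + (W'' - (V' * (2 * s) - V * 2) / ((2 * s) * (2 * s))) * b)
     = a * (V'' - g * W' + g * V / (4 * s)) + b * (W'' - V' / s + V / (2 * s\<^sup>2) + g * W / (4 * s))"
    for a b g V V' V'' W W' W''
    using assms(2) by (simp add: field_simps power2_eq_square)
  ultimately show ?thesis unfolding phi2_eq[OF assms] by (simp only:)
qed

lemma phi2_deriv:
  assumes "\<gamma> > 0" "s > 0"
  shows "(phi2 \<gamma> \<beta> n has_real_derivative phi3 \<gamma> \<beta> n s) (at s)"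
proof -
  let ?S0 = "\<lambda>s. (\<Sum>m<n. \<beta> (n - m) * phi0 \<gamma> \<beta> m s) + \<gamma>\<^sup>2 * phi0 \<gamma> \<beta> n s - 4 * phi1 \<gamma> \<beta> n s"
  let ?S1 = "(\<Sum>m<n. \<beta> (n - m) * phi1 \<gamma> \<beta> m s) + \<gamma>\<^sup>2 * phi1 \<gamma> \<beta> n s - 4 * phi2 \<gamma> \<beta> n s"
  have "(?S0 has_real_derivative ?S1) (at s)"
    by (intro DERIV_diff DERIV_add DERIV_sum DERIV_cmult phi0_deriv phi1_deriv assms)
  then have "(phi2 \<gamma> \<beta> n has_real_derivative (?S1 * (4 * s) - ?S0 s * 4) / ((4 * s) * (4 * s))) (at s)"
    unfolding phi2_def[abs_def] using assms
    by (intro DERIV_divide) (auto intro!: derivative_eq_intros)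
  moreover have "?S0 s = 4 * s * phi2 \<gamma> \<beta> n s" using assms by (simp add: phi2_def)
  moreover have "(?S1 * (4 * s) - 4 * s * phi2 \<gamma> \<beta> n s * 4) / ((4 * s) * (4 * s)) = phi3 \<gamma> \<beta> n s"
    using assms by (simp add: phi3_def field_simps)
  ultimately show ?thesis by simp
qed

lemma phi3_ode:
  "s > 0 \<Longrightarrow> 4 * s * phi3 \<gamma> \<beta> n s + 8 * phi2 \<gamma> \<beta> n s - \<gamma>\<^sup>2 * phi1 \<gamma> \<beta> n s = (\<Sum>m<n. \<beta> (n - m) * phi1 \<gamma> \<beta> m s)"
  by (simp add: phi3_def)

lemma phi3_continuous: "\<gamma> > 0 \<Longrightarrow> continuous_on {0<..} (phi3 \<gamma> \<beta> n)"
proof -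
  assume g: "\<gamma> > 0"
  have "continuous_on {0<..} (phi1 \<gamma> \<beta> m)" "continuous_on {0<..} (phi2 \<gamma> \<beta> m)" for m
    by (intro DERIV_continuous_on[where D = "phi2 \<gamma> \<beta> m"] has_field_derivative_at_within[OF phi1_deriv[OF g]],
        simp, intro DERIV_continuous_on[where D = "phi3 \<gamma> \<beta> m"] has_field_derivative_at_within[OF phi2_deriv[OF g]],
        simp)
  then show ?thesis unfolding phi3_def[abs_def]
    by (intro continuous_intros) auto
qed

section \<open>The singularity at the source point\<close>

text \<open>
  The bound is demanded on all of \<open>(0, R]\<close> and not only near \<open>0\<close>, because it is used
  along a whole period of a boundary curve.
\<close>
definition order_at_0 :: "real \<Rightarrow> real \<Rightarrow> (real \<Rightarrow> real) \<Rightarrow> bool" where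
  "order_at_0 R e f \<longleftrightarrow> (\<exists>C. \<forall>s\<in>{0<..R}. \<bar>f s\<bar> \<le> C * s powr e)"

lemma order_at_0_add:
  assumes "order_at_0 R e f" "order_at_0 R e g"
  shows "order_at_0 R e (\<lambda>s. f s + g s)"
proof -
  obtain C D where "\<forall>s\<in>{0<..R}. \<bar>f s\<bar> \<le> C * s powr e" "\<forall>s\<in>{0<..R}. \<bar>g s\<bar> \<le> D * s powr e"
    using assms unfolding order_at_0_def by blast
  then have "\<forall>s\<in>{0<..R}. \<bar>f s + g s\<bar> \<le> (C + D) * s powr e"
    by (force simp: distrib_right intro: order_trans[OF abs_triangle_ineq add_mono])
  then show ?thesis unfolding order_at_0_def by blast
qed

lemma order_at_0_mono:
  assumes "order_at_0 R e f" "e' \<le> e"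
  shows "order_at_0 R e' f"
proof -
  obtain C where C: "\<forall>s\<in>{0<..R}. \<bar>f s\<bar> \<le> C * s powr e"
    using assms unfolding order_at_0_def by blast
  have "\<bar>f s\<bar> \<le> \<bar>C\<bar> * R powr (e - e') * s powr e'" if s: "s \<in> {0<..R}" for s
  proof -
    have "\<bar>f s\<bar> \<le> \<bar>C\<bar> * s powr e"
      using C s by (intro order_trans[OF bspec[OF C s]] mult_right_mono) auto
    also have "s powr e = s powr (e - e') * s powr e'" by (simp flip: powr_add)
    also have "\<bar>C\<bar> * (s powr (e - e') * s powr e') \<le> \<bar>C\<bar> * (R powr (e - e') * s powr e')"
      using s assms(2) by (intro mult_left_mono mult_right_mono powr_mono2) auto
    finally show ?thesis by (simp add: mult.assoc)
  qed
  then show ?thesis unfolding order_at_0_def by blast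
qed

lemma order_at_0_mult:
  assumes "order_at_0 R e f" "order_at_0 R e' g"
  shows "order_at_0 R (e + e') (\<lambda>s. f s * g s)"
proof -
  obtain C D where CD: "\<forall>s\<in>{0<..R}. \<bar>f s\<bar> \<le> C * s powr e" "\<forall>s\<in>{0<..R}. \<bar>g s\<bar> \<le> D * s powr e'"
    using assms unfolding order_at_0_def by blast
  have "\<bar>f s * g s\<bar> \<le> (C * D) * s powr (e + e')" if "s \<in> {0<..R}" for s
  proof -
    have "\<bar>f s\<bar> * \<bar>g s\<bar> \<le> (C * s powr e) * (D * s powr e')"
      using CD that by (intro mult_mono) (auto intro: order_trans[OF abs_ge_zero])
    then show ?thesis by (simp add: abs_mult powr_add mult_ac)
  qed
  then show ?thesis unfolding order_at_0_def by blast
qed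

lemma order_at_0_poly: "order_at_0 R 0 (poly p)"
proof -
  have "compact (poly p ` {0..R})" by (intro compact_continuous_image continuous_intros compact_Icc)
  then obtain C where "\<forall>x\<in>poly p ` {0..R}. norm x \<le> C" using compact_imp_bounded bounded_iff by metis
  then have "\<forall>s\<in>{0<..R}. \<bar>poly p s\<bar> \<le> C * s powr 0" by auto
  then show ?thesis unfolding order_at_0_def by blast
qed

lemma order_at_0_powr: "order_at_0 R e (\<lambda>s. s powr e)"
  unfolding order_at_0_def by (rule exI[of _ 1]) simp

lemma order_at_0_cong:
  assumes "order_at_0 R e f" "\<And>s. s > 0 \<Longrightarrow> f s = g s"
  shows "order_at_0 R e g"
  using assms unfolding order_at_0_def by auto

lemma order_at_0_const: "order_at_0 R 0 (\<lambda>s. a)"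
  unfolding order_at_0_def by (rule exI[of _ "\<bar>a\<bar>"]) simp

lemma kernel_A_order:
  assumes g: "\<gamma> > 0"
  shows "order_at_0 R (-1/4) (kernel_A \<gamma>)"
proof -
  obtain C where C: "C > 0" "\<And>z. z > 0 \<Longrightarrow> cosh_moment 0 z \<le> C * z powr (-1/2)"
    using cosh_moment_0_bound by blast
  have "\<bar>kernel_A \<gamma> s\<bar> \<le> C * \<gamma> powr (-1/2) * s powr (-1/4)" if "s \<in> {0<..R}" for s
  proof -
    have z: "\<gamma> * sqrt s > 0" using g that by simp
    have "\<bar>kernel_A \<gamma> s\<bar> = cosh_moment 0 (\<gamma> * sqrt s)"
      using cosh_moment_nonneg[OF z] by (simp add: kernel_A_def bessel_K_eq_cosh_moment)
    also have "\<dots> \<le> C * (\<gamma> * sqrt s) powr (-1/2)" by (rule C(2)[OF z])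
    also have "(\<gamma> * sqrt s) powr (-1/2) = \<gamma> powr (-1/2) * s powr (-1/4)"
      using g that by (simp add: powr_mult powr_powr flip: powr_half_sqrt)
    finally show ?thesis by (simp add: mult.assoc)
  qed
  then show ?thesis unfolding order_at_0_def by blast
qed

lemma kernel_B_order:
  assumes g: "\<gamma> > 0"
  obtains c where "\<And>R. order_at_0 R (3/4) (\<lambda>s. kernel_B \<gamma> s - c)"
proof -
  obtain c C where C: "C > 0" "\<And>z. z > 0 \<Longrightarrow> \<bar>z * bessel_K 1 z - c\<bar> \<le> C * z powr (3/2)"
    using z_bessel_K1_near_0 by blast
  have "\<bar>kernel_B \<gamma> s - c\<bar> \<le> C * \<gamma> powr (3/2) * s powr (3/4)" if "s > 0" for s
  proof -
    have z: "\<gamma> * sqrt s > 0" using g that by simp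
    have "\<bar>kernel_B \<gamma> s - c\<bar> \<le> C * (\<gamma> * sqrt s) powr (3/2)"
      using C(2)[OF z] by (simp add: kernel_B_def)
    also have "(\<gamma> * sqrt s) powr (3/2) = \<gamma> powr (3/2) * s powr (3/4)"
      using g that by (simp add: powr_mult powr_powr flip: powr_half_sqrt)
    finally show ?thesis by (simp add: mult.assoc)
  qed
  then have "order_at_0 R (3/4) (\<lambda>s. kernel_B \<gamma> s - c)" for R
    unfolding order_at_0_def by (intro exI[of _ "C * \<gamma> powr (3/2)"]) auto
  then show thesis by (rule that)
qed

text \<open>
  Since \<open>V_poly\<close> has constant term \<open>1\<close>, the only term of order \<open>1 / s\<close> in \<open>phi1\<close> is \<open>- kernel_B / (2 s)\<close>,
  and \<open>kernel_B\<close> tends to a constant. So the leading singularity is the same for every \<open>n\<close>.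
\<close>
lemma phi_singularity:
  assumes g: "\<gamma> > 0"
  obtains c where "\<And>n R. order_at_0 R (-1/4) (\<lambda>s. phi1 \<gamma> \<beta> n s + c / (2 * s))"
    "\<And>n R. order_at_0 R (-5/4) (\<lambda>s. phi2 \<gamma> \<beta> n s - c / (2 * s\<^sup>2))"
proof -
  obtain c where c: "\<And>R. order_at_0 R (3/4) (\<lambda>s. kernel_B \<gamma> s - c)" using kernel_B_order[OF g] by blast
  have B0: "order_at_0 R 0 (kernel_B \<gamma>)" for R
    by (rule order_at_0_cong[OF order_at_0_add[OF order_at_0_mono[OF c[of R], of 0] order_at_0_const[of R c]]]) auto
  note A = kernel_A_order[OF g]
  \<comment> \<open>\<open>U n\<close> is \<open>(V_poly n - 1) / s\<close>, so splitting off the constant term exposes the pole.\<close>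
  have "\<exists>p. V_poly \<gamma> \<beta> n = pCons 1 p" for n
    using coeff_V_poly[of \<gamma> \<beta> n 0] by (metis coeff_a_0 coeff_pCons_0 mult_0_right pCons_cases)
  then obtain U where VU: "\<And>n. V_poly \<gamma> \<beta> n = pCons 1 (U n)" by metis
  have Vs: "poly (V_poly \<gamma> \<beta> n) s = 1 + s * poly (U n) s" for n s by (simp add: VU)
  let ?P = "\<lambda>n. pderiv (V_poly \<gamma> \<beta> n)" and ?W = "W_poly \<gamma> \<beta>"
  have "order_at_0 R (-1/4) (\<lambda>s. phi1 \<gamma> \<beta> n s + c / (2 * s))" for n R
  proof (rule order_at_0_cong)
    show "order_at_0 R (-1/4) (\<lambda>s. kernel_A \<gamma> s * poly (?P n - smult (\<gamma>\<^sup>2/2) (?W n)) s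
       + kernel_B \<gamma> s * poly (pderiv (?W n) - smult (1/2) (U n)) s
       + (kernel_B \<gamma> s - c) * (s powr -1 * (-1/2)))"
      by (intro order_at_0_add; (rule order_at_0_mono, rule order_at_0_mult[OF A order_at_0_poly] order_at_0_mult[OF B0 order_at_0_poly]
           order_at_0_mult[OF c order_at_0_mult[OF order_at_0_powr order_at_0_const]], simp))
    fix s :: real assume s: "s > 0"
    show "kernel_A \<gamma> s * poly (?P n - smult (\<gamma>\<^sup>2/2) (?W n)) s
       + kernel_B \<gamma> s * poly (pderiv (?W n) - smult (1/2) (U n)) s
       + (kernel_B \<gamma> s - c) * (s powr -1 * (-1/2)) = phi1 \<gamma> \<beta> n s + c / (2 * s)"
      using s unfolding phi1_def Vs by (simp add: powr_minus field_simps)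
  qed
  moreover have "order_at_0 R (-5/4) (\<lambda>s. phi2 \<gamma> \<beta> n s - c / (2 * s\<^sup>2))" for n R
  proof (rule order_at_0_cong)
    let ?p1 = "pderiv (?P n) - smult (\<gamma>\<^sup>2) (pderiv (?W n))" and ?p2 = "smult (\<gamma>\<^sup>2/4) (V_poly \<gamma> \<beta> n)"
      and ?q1 = "pderiv (pderiv (?W n))" and ?q2 = "smult (-1) (?P n) + smult (1/2) (U n) + smult (\<gamma>\<^sup>2/4) (?W n)"
    show "order_at_0 R (-5/4) (\<lambda>s. kernel_A \<gamma> s * poly ?p1 s + kernel_A \<gamma> s * (poly ?p2 s * s powr -1)
       + kernel_B \<gamma> s * poly ?q1 s + kernel_B \<gamma> s * (poly ?q2 s * s powr -1)
       + (kernel_B \<gamma> s - c) * (s powr -2 * (1/2)))"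
      by (intro order_at_0_add; (rule order_at_0_mono, rule order_at_0_mult[OF A order_at_0_poly] order_at_0_mult[OF B0 order_at_0_poly]
           order_at_0_mult[OF A order_at_0_mult[OF order_at_0_poly order_at_0_powr]]
           order_at_0_mult[OF B0 order_at_0_mult[OF order_at_0_poly order_at_0_powr]]
           order_at_0_mult[OF c order_at_0_mult[OF order_at_0_powr order_at_0_const]], simp))
    fix s :: real assume s: "s > 0"
    have p: "s powr -2 = 1 / s\<^sup>2" "s powr -1 = 1 / s" using s by (simp_all add: powr_minus_divide)
    have q: "a * (V'' - g * W') + a * (g / 4 * (1 + s * u) * (1 / s))
       + b * W'' + b * ((-1 * V' + 1 / 2 * u + g / 4 * W) * (1 / s)) + (b - c) * (1 / s\<^sup>2 * (1/2))
       = a * (V'' - g * W' + g * (1 + s * u) / (4 * s)) + b * (W'' - V' / s + (1 + s * u) / (2 * s\<^sup>2) + g * W / (4 * s))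
         - c / (2 * s\<^sup>2)" for a b g u V' V'' W W' W''
      using s by (simp add: field_simps power2_eq_square)
    show "kernel_A \<gamma> s * poly ?p1 s + kernel_A \<gamma> s * (poly ?p2 s * s powr -1)
       + kernel_B \<gamma> s * poly ?q1 s + kernel_B \<gamma> s * (poly ?q2 s * s powr -1)
       + (kernel_B \<gamma> s - c) * (s powr -2 * (1/2)) = phi2 \<gamma> \<beta> n s - c / (2 * s\<^sup>2)"
      unfolding phi2_eq[OF g s] p poly_diff poly_add poly_smult Vs by (rule q)
  qed
  ultimately show thesis using that by blast
qed

section \<open>The plane and its quarter turn\<close>

text \<open>
  The quarter turn, which takes the tangent of a curve to a normal.
\<close>
definition rot :: "real^2 \<Rightarrow> real^2" where
  "rot v = vector [- v $ 2, v $ 1]"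

lemma rot_components [simp]: "rot v $ 1 = - v $ 2" "rot v $ 2 = v $ 1"
  by (simp_all add: rot_def)

lemma inner_2: "(v::real^2) \<bullet> w = v $ 1 * w $ 1 + v $ 2 * w $ 2"
  by (simp add: inner_vec_def sum_2)

lemma rot_inner_rot: "rot v \<bullet> rot w = v \<bullet> w"
  by (simp add: inner_2)

lemma norm_rot [simp]: "norm (rot v) = norm v"
  by (simp add: norm_eq_sqrt_inner rot_inner_rot)

lemma rot_inner_self [simp]: "rot v \<bullet> v = 0" "v \<bullet> rot v = 0"
  by (simp_all add: inner_2)

text \<open>
  Pythagoras in polarized form. It converts a product of two normal components into tangential
  ones, and is the reason that second normal derivatives of the logarithm are derivatives along the
  curve.
\<close>
lemma inner_rot_product:
  "(d \<bullet> rot a) * (d \<bullet> rot b) = (d \<bullet> d) * (a \<bullet> b) - (d \<bullet> a) * (d \<bullet> b)"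
  by (simp add: inner_2 algebra_simps)

lemma rot_scaleR: "rot (a *\<^sub>R v) = a *\<^sub>R rot v"
  by (simp add: vec_eq_iff forall_2)

lemma bounded_linear_rot: "bounded_linear rot"
  by (rule bounded_linear_intro[of _ 1]) (auto simp: vec_eq_iff forall_2)

lemmas continuous_on_rot [continuous_intros] = bounded_linear.continuous_on[OF bounded_linear_rot]

text \<open>
  In the plane a unit vector orthogonal to \<open>v\<close> is determined up to sign; the scaling by \<open>norm v\<close> keeps the
  statement true for \<open>v = 0\<close>.
\<close>
lemma unit_orthogonal_cases:
  assumes "norm u = 1" "u \<bullet> v = 0"
  shows "norm v *\<^sub>R u = rot v \<or> norm v *\<^sub>R u = - rot v"
proof -
  have e: "(v \<bullet> v) *\<^sub>R u = (u \<bullet> rot v) *\<^sub>R rot v"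
  proof -
    have "u $ 1 * v $ 1 = - (u $ 2 * v $ 2)" using assms(2) by (simp add: inner_2)
    then have "(v $ 1 * v $ 1 + v $ 2 * v $ 2) * u $ 1 = (- u $ 1 * v $ 2 + u $ 2 * v $ 1) * - v $ 2"
      "(v $ 1 * v $ 1 + v $ 2 * v $ 2) * u $ 2 = (- u $ 1 * v $ 2 + u $ 2 * v $ 1) * v $ 1"
      by algebra+
    then show ?thesis by (simp add: vec_eq_iff forall_2 inner_2)
  qed
  have "(u \<bullet> rot v)\<^sup>2 = (norm v)\<^sup>2"
    using inner_rot_product[of u v v] assms
    by (simp add: power2_eq_square inner_commute flip: power2_norm_eq_inner)
  then have a: "u \<bullet> rot v = norm v \<or> u \<bullet> rot v = - norm v" by (simp add: power2_eq_iff)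
  have "(norm v * norm v) *\<^sub>R u = (u \<bullet> rot v) *\<^sub>R rot v"
    using e by (simp add: power2_eq_square flip: power2_norm_eq_inner)
  then have "norm v *\<^sub>R norm v *\<^sub>R u = (u \<bullet> rot v) *\<^sub>R rot v" by simp
  note b = this
  show ?thesis
  proof (cases "v = 0")
    case False
    from a show ?thesis
    proof
      assume "u \<bullet> rot v = norm v"
      then have "norm v *\<^sub>R norm v *\<^sub>R u = norm v *\<^sub>R rot v" using b by simp
      then show ?thesis using False by (simp only: scaleR_cancel_left) simp
    next
      assume "u \<bullet> rot v = - norm v"
      then have "norm v *\<^sub>R norm v *\<^sub>R u = norm v *\<^sub>R (- rot v)" using b by simp
      then show ?thesis using False by (simp only: scaleR_cancel_left) simp
    qed
  qed (simp add: vec_eq_iff forall_2)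
qed

section \<open>The dipole kernel of a radial function\<close>

text \<open>
  For a radial function \<open>G (\<bar>x - y\<bar>\<^sup>2)\<close> with derivative \<open>G1\<close> of its profile, this is the derivative at \<open>y\<close> in the
  direction \<open>N\<close>. In the next two definitions, \<open>dl_grad\<close> is its gradient in \<open>x\<close>, and \<open>dl_hess\<close> is the
  gradient in \<open>x\<close> of the component of \<open>dl_grad\<close> along \<open>e\<close>.
\<close>
definition dl_kernel :: "(real \<Rightarrow> real) \<Rightarrow> real^2 \<Rightarrow> real^2 \<Rightarrow> real^2 \<Rightarrow> real" where
  "dl_kernel G1 y N x = 2 * G1 ((y - x) \<bullet> (y - x)) * ((y - x) \<bullet> N)"

definition dl_grad :: "(real \<Rightarrow> real) \<Rightarrow> (real \<Rightarrow> real) \<Rightarrow> real^2 \<Rightarrow> real^2 \<Rightarrow> real^2 \<Rightarrow> real^2" where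
  "dl_grad G1 G2 y N x = - (4 * G2 ((y - x) \<bullet> (y - x)) * ((y - x) \<bullet> N)) *\<^sub>R (y - x)
     - (2 * G1 ((y - x) \<bullet> (y - x))) *\<^sub>R N"

definition dl_hess ::
  "(real \<Rightarrow> real) \<Rightarrow> (real \<Rightarrow> real) \<Rightarrow> real^2 \<Rightarrow> real^2 \<Rightarrow> real^2 \<Rightarrow> real^2 \<Rightarrow> real^2" where
  "dl_hess G2 G3 y N e x =
     (8 * G3 ((y - x) \<bullet> (y - x)) * ((y - x) \<bullet> N) * ((y - x) \<bullet> e)) *\<^sub>R (y - x)
     + (4 * G2 ((y - x) \<bullet> (y - x))) *\<^sub>R (((y - x) \<bullet> e) *\<^sub>R N + ((y - x) \<bullet> N) *\<^sub>R e + (N \<bullet> e) *\<^sub>R (y - x))"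

locale radial_kernel =
  fixes G1 G2 G3 :: "real \<Rightarrow> real"
  assumes G1_deriv: "\<And>s. s > 0 \<Longrightarrow> (G1 has_real_derivative G2 s) (at s)"
    and G2_deriv: "\<And>s. s > 0 \<Longrightarrow> (G2 has_real_derivative G3 s) (at s)"
    and G3_cont: "continuous_on {0<..} G3"
begin

lemma G1_cont: "continuous_on {0<..} G1"
  by (rule DERIV_continuous_on[where D = G2]) (auto intro: has_field_derivative_at_within G1_deriv)

lemma G2_cont: "continuous_on {0<..} G2"
  by (rule DERIV_continuous_on[where D = G3]) (auto intro: has_field_derivative_at_within G2_deriv)

lemma dl_kernel_deriv:
  assumes "x \<noteq> y"
  shows "(dl_kernel G1 y N has_derivative (\<lambda>h. dl_grad G1 G2 y N x \<bullet> h)) (at x)"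
proof -
  have s: "(y - x) \<bullet> (y - x) > 0" using assms by simp
  have D: "((\<lambda>x. (y - x) \<bullet> (y - x)) has_derivative (\<lambda>h. - 2 * ((y - x) \<bullet> h))) (at x)"
    by (auto intro!: derivative_eq_intros simp: inner_commute)
  show ?thesis
    unfolding dl_kernel_def[abs_def] dl_grad_def
    by (rule has_derivative_eq_rhs,
        (rule derivative_intros DERIV_compose_FDERIV[OF G1_deriv[OF s] D])+)
      (simp add: fun_eq_iff inner_diff_left inner_scaleR_left inner_commute algebra_simps)
qed

lemma dl_grad_deriv:
  assumes "x \<noteq> y"
  shows "((\<lambda>x. dl_grad G1 G2 y N x \<bullet> e) has_derivative (\<lambda>h. dl_hess G2 G3 y N e x \<bullet> h)) (at x)"
proof -
  have s: "(y - x) \<bullet> (y - x) > 0" using assms by simp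
  have D: "((\<lambda>x. (y - x) \<bullet> (y - x)) has_derivative (\<lambda>h. - 2 * ((y - x) \<bullet> h))) (at x)"
    by (auto intro!: derivative_eq_intros simp: inner_commute)
  have eq: "(\<lambda>x. dl_grad G1 G2 y N x \<bullet> e) = (\<lambda>x. - (4 * G2 ((y - x) \<bullet> (y - x)) * ((y - x) \<bullet> N) * ((y - x) \<bullet> e))
     - 2 * G1 ((y - x) \<bullet> (y - x)) * (N \<bullet> e))"
    by (simp add: dl_grad_def inner_diff_left fun_eq_iff)
  show ?thesis
    unfolding eq dl_hess_def
    by (rule has_derivative_eq_rhs,
        (rule derivative_intros DERIV_compose_FDERIV[OF G1_deriv[OF s] D] DERIV_compose_FDERIV[OF G2_deriv[OF s] D])+)
      (simp add: fun_eq_iff inner_left_distrib inner_scaleR_left inner_commute algebra_simps)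
qed

text \<open>
  The Laplacian of the dipole kernel. The right-hand side is \<open>2 (d \<bullet> N)\<close> times \<open>4 s G3 + 8 G2\<close>, which is
  the derivative of \<open>4 s G2 + 4 G1\<close>, the planar Laplacian of the radial function itself.
\<close>
lemma sum_dl_hess:
  "(\<Sum>b\<in>Basis. dl_hess G2 G3 y N b x \<bullet> b) =
     ((y - x) \<bullet> N) * (8 * ((y - x) \<bullet> (y - x)) * G3 ((y - x) \<bullet> (y - x)) + 16 * G2 ((y - x) \<bullet> (y - x)))"
proof -
  have E: "(\<Sum>b\<in>Basis. F b) = F (axis 1 1) + F (axis 2 1)" for F :: "real^2 \<Rightarrow> real"
    by (simp add: Basis_vec_def UNIV_2 axis_eq_axis)
  show ?thesis
    unfolding E dl_hess_def
    by (simp add: inner_2 axis_def algebra_simps)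
qed

end

section \<open>Gradients of parameter integrals\<close>

text \<open>
  Differentiation under the integral sign, with derivatives represented by gradient vectors so that
  the gradient of the integral is again an integral of vectors.
\<close>
lemma integral_param_gradient:
  fixes \<phi> :: "real^2 \<Rightarrow> real \<Rightarrow> real" and g :: "real^2 \<Rightarrow> real \<Rightarrow> real^2"
  assumes U: "open U" "x \<in> U"
    and \<phi>: "\<And>x t. x \<in> U \<Longrightarrow> ((\<lambda>x. \<phi> x t) has_derivative (\<lambda>h. g x t \<bullet> h)) (at x)"
    and int: "\<And>x. x \<in> U \<Longrightarrow> \<phi> x integrable_on {a..b::real}"
    and cont: "continuous_on (U \<times> {a..b}) (\<lambda>(x, t). g x t)"
  shows "((\<lambda>x. integral {a..b} (\<phi> x)) has_derivative (\<lambda>h. integral {a..b} (g x) \<bullet> h)) (at x)"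
proof -
  obtain r where r: "r > 0" "ball x r \<subseteq> U" using openE[OF U] by metis
  let ?B = "\<lambda>x t. blinfun_inner_right (g x t)"
  have cB: "continuous_on (ball x r \<times> {a..b}) (\<lambda>(x, t). g x t)"
    by (rule continuous_on_subset[OF cont Sigma_mono[OF r(2)]]) simp
  have "((\<lambda>x. integral (cbox a b) (\<phi> x)) has_derivative integral (cbox a b) (?B x)) (at x within ball x r)"
  proof (rule leibniz_rule[where U = "ball x r" and f = \<phi> and fx = ?B])
    fix y t assume y: "y \<in> ball x r"
    show "((\<lambda>x. \<phi> x t) has_derivative ?B y t) (at y within ball x r)"
    proof -
      have "y \<in> U" using y r by blast
      from has_derivative_at_withinI[OF \<phi>[OF this]] show ?thesis by simp
    qed
  next
    show "continuous_on (ball x r \<times> cbox a b) (\<lambda>(x, t). ?B x t)"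
      using bounded_linear.continuous_on[OF bounded_linear_blinfun_inner_right cB]
      by (simp add: case_prod_unfold)
  next
    show "\<And>x'. x' \<in> ball x r \<Longrightarrow> \<phi> x' integrable_on cbox a b" using r int by auto
  next
    show "x \<in> ball x r" using r by simp
  next
    show "convex (ball x r)" by (rule convex_ball)
  qed
  moreover have "at x within ball x r = at x" by (rule at_within_open) (use r in simp_all)
  moreover have "(\<lambda>h. integral {a..b} (g x) \<bullet> h) = integral (cbox a b) (?B x)"
  proof -
    have "continuous_on {a..b} (g x)"
    proof -
      have "(\<lambda>t. (x, t)) ` {a..b} \<subseteq> U \<times> {a..b}" using U(2) by blast
      from continuous_on_compose2[OF cont _ this] show ?thesis by (simp add: continuous_on_Pair)
    qed
    then have "g x integrable_on {a..b}" by (rule integrable_continuous_real)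
    from integral_linear[OF this bounded_linear_blinfun_inner_right]
    have "integral {a..b} (?B x) = blinfun_inner_right (integral {a..b} (g x))"
      unfolding o_def .
    then show ?thesis by (simp add: fun_eq_iff)
  qed
  ultimately show ?thesis by simp
qed

section \<open>Regular closed curves\<close>

lemma periodic_shift_int:
  fixes f :: "real \<Rightarrow> 'a"
  assumes per: "\<And>t. f (t + 1) = f t"
  shows "f (t + of_int k) = f t"
proof -
  have n: "f (t + real n) = f t" for n t
  proof (induction n)
    case (Suc n)
    have "f (t + real (Suc n)) = f ((t + real n) + 1)" by (simp add: algebra_simps)
    then show ?case using Suc per by simp
  qed simp
  show ?thesis
  proof (cases k rule: int_cases2)
    case (nonneg m) then show ?thesis using n by simp
  next
    case (nonpos m) then show ?thesis using n[of "t - real m" m] by simp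
  qed
qed

text \<open>
  The continuous second derivative makes the tangent Lipschitz continuous, which the subtraction of a tangential
  term at the boundary point relies on.
\<close>
locale closed_curve =
  fixes p p' p'' :: "real \<Rightarrow> real^2"
  assumes p_deriv: "\<And>t. (p has_vector_derivative p' t) (at t)"
    and p'_deriv: "\<And>t. (p' has_vector_derivative p'' t) (at t)"
    and p''_cont: "continuous_on UNIV p''"
    and p_periodic: "\<And>t. p (t + 1) = p t"
    and p_inj: "inj_on p {0..<1}"
    and p'_nonzero: "\<And>t. p' t \<noteq> 0"
begin

lemma p_cont [continuous_intros]: "continuous_on A f \<Longrightarrow> continuous_on A (\<lambda>x. p (f x))"
  using continuous_on_compose2[of UNIV p A f] p_deriv
  by (auto intro: continuous_at_imp_continuous_on has_vector_derivative_continuous)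

lemma p'_cont [continuous_intros]: "continuous_on A f \<Longrightarrow> continuous_on A (\<lambda>x. p' (f x))"
  using continuous_on_compose2[of UNIV p' A f] p'_deriv
  by (auto intro: continuous_at_imp_continuous_on has_vector_derivative_continuous)

lemma p'_periodic: "p' (t + 1) = p' t"
proof -
  have "((p \<circ> (\<lambda>t. t + 1)) has_vector_derivative 1 *\<^sub>R p' (t + 1)) (at t)"
    by (rule vector_diff_chain_at) (auto intro!: derivative_eq_intros p_deriv)
  then have "(p has_vector_derivative p' (t + 1)) (at t)"
    by (simp add: o_def p_periodic)
  then show ?thesis using p_deriv vector_derivative_unique_at by blast
qed

lemma p_periodic_int: "p (t + of_int k) = p t"
  by (rule periodic_shift_int[of p, OF p_periodic])

lemma p_eq_iff: "p s = p t \<longleftrightarrow> (\<exists>k::int. s = t + of_int k)"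
proof
  assume e: "p s = p t"
  have "p (frac s) = p s" "p (frac t) = p t"
    using p_periodic_int[of "frac s" "\<lfloor>s\<rfloor>"] p_periodic_int[of "frac t" "\<lfloor>t\<rfloor>"] by (simp_all add: frac_def)
  with e have "frac s = frac t"
    using p_inj frac_ge_0 frac_lt_1 unfolding inj_on_def by (metis atLeastLessThan_iff)
  then have "s = t + of_int (\<lfloor>s\<rfloor> - \<lfloor>t\<rfloor>)" by (simp add: frac_def)
  then show "\<exists>k::int. s = t + of_int k" by blast
qed (auto simp: p_periodic_int)

text \<open>
  Since a period has length \<open>1\<close>, distances of parameters below \<open>1\<close> never wrap around.
\<close>
lemma p_neq: "p s \<noteq> p t" if "s \<noteq> t" "\<bar>s - t\<bar> < 1"
proof
  assume "p s = p t"
  then obtain k :: int where "s = t + of_int k" using p_eq_iff by blast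
  with that have "k \<noteq> 0" "\<bar>real_of_int k\<bar> < 1" by auto
  then show False by linarith
qed

lemma range_p: "range p = p ` {a..a + 1}"
proof -
  have "p t \<in> p ` {a..a + 1}" for t
  proof -
    have "p t = p (t + of_int (- \<lfloor>t - a\<rfloor>))" by (rule p_periodic_int[symmetric])
    moreover have "t + of_int (- \<lfloor>t - a\<rfloor>) \<in> {a..a + 1}" by simp linarith
    ultimately show ?thesis by blast
  qed
  then show ?thesis by auto
qed

lemma compact_range_p: "compact (range p)"
  unfolding range_p[of 0] by (intro compact_continuous_image continuous_intros compact_Icc)

lemma open_complement_p: "open (- range p)"
  using compact_imp_closed[OF compact_range_p] by (simp add: open_Compl)

end

section \<open>The layer potential of a closed curve\<close>

text \<open>
  Here \<open>q\<close> is the density as a function of the parameter, and \<open>\<sigma>\<close> a sign that selects the side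
  of the normal. The factor \<open>\<bar>p'\<bar>\<close> of the arc length is absorbed into \<open>normal_weight\<close>, which is the normal
  times that factor.
\<close>
locale layer_potential = radial_kernel + closed_curve +
  fixes q :: "real \<Rightarrow> real" and \<sigma> :: real
  assumes q_cont: "continuous_on UNIV q"
begin

definition "normal_weight t = \<sigma> *\<^sub>R rot (p' t)"

definition "pot x = integral {0..1} (\<lambda>t. q t * dl_kernel G1 (p t) (normal_weight t) x)"
definition "pot_grad x = integral {0..1} (\<lambda>t. q t *\<^sub>R dl_grad G1 G2 (p t) (normal_weight t) x)"
definition "pot_hess e x = integral {0..1} (\<lambda>t. q t *\<^sub>R dl_hess G2 G3 (p t) (normal_weight t) e x)"

lemma normal_weight_cont [continuous_intros]:
  "continuous_on A f \<Longrightarrow> continuous_on A (\<lambda>x. normal_weight (f x))"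
  unfolding normal_weight_def by (intro continuous_intros)

lemma q_cont' [continuous_intros]: "continuous_on A f \<Longrightarrow> continuous_on A (\<lambda>x. q (f x))"
  using continuous_on_compose2[OF q_cont] by auto

text \<open>
  Joint continuity in point and parameter; taking both as functions of an auxiliary variable
  covers the uses with one of them fixed.
\<close>
lemma kernel_continuity:
  assumes f: "continuous_on A f" and h: "continuous_on A h" and ne: "\<And>z. z \<in> A \<Longrightarrow> f z \<noteq> p (h z)"
  shows "continuous_on A (\<lambda>z. q (h z) * dl_kernel G1 (p (h z)) (normal_weight (h z)) (f z))"
    "continuous_on A (\<lambda>z. q (h z) *\<^sub>R dl_grad G1 G2 (p (h z)) (normal_weight (h z)) (f z))"
    "continuous_on A (\<lambda>z. q (h z) *\<^sub>R dl_hess G2 G3 (p (h z)) (normal_weight (h z)) e (f z))"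
proof -
  have pos: "(\<lambda>z. (p (h z) - f z) \<bullet> (p (h z) - f z)) ` A \<subseteq> {0<..}"
  proof clarsimp
    fix z assume "z \<in> A" "p (h z) = f z"
    with ne[of z] show False by simp
  qed
  have s: "continuous_on A (\<lambda>z. (p (h z) - f z) \<bullet> (p (h z) - f z))"
    by (intro continuous_intros f h)
  note G = continuous_on_compose2[OF G1_cont s pos] continuous_on_compose2[OF G2_cont s pos]
    continuous_on_compose2[OF G3_cont s pos]
  show "continuous_on A (\<lambda>z. q (h z) * dl_kernel G1 (p (h z)) (normal_weight (h z)) (f z))"
    "continuous_on A (\<lambda>z. q (h z) *\<^sub>R dl_grad G1 G2 (p (h z)) (normal_weight (h z)) (f z))"
    "continuous_on A (\<lambda>z. q (h z) *\<^sub>R dl_hess G2 G3 (p (h z)) (normal_weight (h z)) e (f z))"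
    unfolding dl_kernel_def dl_grad_def dl_hess_def
    by (intro continuous_intros f h G)+
qed

lemma pot_deriv:
  assumes "x \<notin> range p"
  shows "(pot has_derivative (\<lambda>h. pot_grad x \<bullet> h)) (at x)"
  unfolding pot_def[abs_def] pot_grad_def
proof (rule integral_param_gradient[where U = "- range p"])
  fix x t assume "x \<in> - range p"
  then have "x \<noteq> p t" by auto
  from has_derivative_mult_right[OF dl_kernel_deriv[OF this, of "normal_weight t"], of "q t"]
  show "((\<lambda>x. q t * dl_kernel G1 (p t) (normal_weight t) x) has_derivative
     (\<lambda>h. q t *\<^sub>R dl_grad G1 G2 (p t) (normal_weight t) x \<bullet> h)) (at x)" by simp
next
  fix x assume "x \<in> - range p"
  then show "(\<lambda>t. q t * dl_kernel G1 (p t) (normal_weight t) x) integrable_on {0..1}"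
    by (intro integrable_continuous_real kernel_continuity(1) continuous_intros) auto
next
  show "continuous_on ((- range p) \<times> {0..1}) (\<lambda>(x, t). q t *\<^sub>R dl_grad G1 G2 (p t) (normal_weight t) x)"
    unfolding case_prod_unfold by (intro kernel_continuity(2) continuous_intros) auto
qed (use assms open_complement_p in auto)

lemma pot_grad_deriv:
  assumes "x \<notin> range p"
  shows "((\<lambda>x. pot_grad x \<bullet> e) has_derivative (\<lambda>h. pot_hess e x \<bullet> h)) (at x)"
proof -
  have i: "(\<lambda>t. q t *\<^sub>R dl_grad G1 G2 (p t) (normal_weight t) x) integrable_on {0..1}" if "x \<in> - range p" for x
    using that by (intro integrable_continuous_real kernel_continuity(2) continuous_intros) auto
  have D: "((\<lambda>x. integral {0..1} (\<lambda>t. q t * (dl_grad G1 G2 (p t) (normal_weight t) x \<bullet> e))) has_derivative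
      (\<lambda>h. integral {0..1} (\<lambda>t. q t *\<^sub>R dl_hess G2 G3 (p t) (normal_weight t) e x) \<bullet> h)) (at x)"
  proof (rule integral_param_gradient[where U = "- range p"])
    fix x t assume "x \<in> - range p"
    then have "x \<noteq> p t" by auto
    from has_derivative_mult_right[OF dl_grad_deriv[OF this, of "normal_weight t" e], of "q t"]
    show "((\<lambda>x. q t * (dl_grad G1 G2 (p t) (normal_weight t) x \<bullet> e)) has_derivative
       (\<lambda>h. q t *\<^sub>R dl_hess G2 G3 (p t) (normal_weight t) e x \<bullet> h)) (at x)" by simp
  next
    fix x assume "x \<in> - range p"
    from integrable_linear[OF i[OF this] bounded_linear_inner_left[of e]]
    show "(\<lambda>t. q t * (dl_grad G1 G2 (p t) (normal_weight t) x \<bullet> e)) integrable_on {0..1}"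
      by (simp add: o_def)
  next
    show "continuous_on ((- range p) \<times> {0..1}) (\<lambda>(x, t). q t *\<^sub>R dl_hess G2 G3 (p t) (normal_weight t) e x)"
      unfolding case_prod_unfold by (intro kernel_continuity(3) continuous_intros) auto
  qed (use assms open_complement_p in auto)
  have E: "integral {0..1} (\<lambda>t. q t * (dl_grad G1 G2 (p t) (normal_weight t) x \<bullet> e)) = pot_grad x \<bullet> e"
    if "x \<in> - range p" for x
    using integral_linear[OF i[OF that] bounded_linear_inner_left[of e]]
    unfolding o_def pot_grad_def by simp
  have "x \<in> - range p" using assms by simp
  from has_derivative_transform_within_open[OF D open_complement_p this E]
  show ?thesis unfolding pot_hess_def .
qed

lemma pot_hess_cont: "continuous_on (- range p) (pot_hess e)"
proof -
  have "continuous_on (- range p) (\<lambda>x. integral (cbox 0 1) (\<lambda>t. q t *\<^sub>R dl_hess G2 G3 (p t) (normal_weight t) e x))"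
    by (rule integral_continuous_on_param)
      (unfold case_prod_unfold, intro kernel_continuity(3) continuous_intros, auto)
  then show ?thesis by (simp add: pot_hess_def[abs_def])
qed

lemma pot_laplacian:
  assumes "x \<notin> range p"
  shows "(\<Sum>b\<in>Basis. pot_hess b x \<bullet> b) =
    integral {0..1} (\<lambda>t. q t * (((p t - x) \<bullet> normal_weight t) *
       (8 * ((p t - x) \<bullet> (p t - x)) * G3 ((p t - x) \<bullet> (p t - x)) + 16 * G2 ((p t - x) \<bullet> (p t - x)))))"
proof -
  have i: "(\<lambda>t. q t *\<^sub>R dl_hess G2 G3 (p t) (normal_weight t) e x) integrable_on {0..1}" for e
    using assms by (intro integrable_continuous_real kernel_continuity(3) continuous_intros) auto
  have ie: "(\<lambda>t. q t * (dl_hess G2 G3 (p t) (normal_weight t) e x \<bullet> e)) integrable_on {0..1}" for e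
    using integrable_linear[OF i bounded_linear_inner_left[of e], of e] by (simp add: o_def)
  have "pot_hess e x \<bullet> e = integral {0..1} (\<lambda>t. q t * (dl_hess G2 G3 (p t) (normal_weight t) e x \<bullet> e))" for e
    using integral_linear[OF i bounded_linear_inner_left[of e], of e] by (simp add: o_def pot_hess_def)
  then have "(\<Sum>b\<in>Basis. pot_hess b x \<bullet> b) =
      integral {0..1} (\<lambda>t. \<Sum>b\<in>Basis. q t * (dl_hess G2 G3 (p t) (normal_weight t) b x \<bullet> b))"
    by (simp add: integral_sum ie)
  then show ?thesis by (simp only: sum_dl_hess flip: sum_distrib_left)
qed

end

section \<open>The side of the outward normal\<close>

lemma closed_curve_of_C3:
  assumes "C3_closed_curve p"
  shows "\<exists>p''. closed_curve p (\<lambda>t. vector_derivative p (at t)) p''"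
proof -
  have "C_times (Suc (Suc (Suc 0))) p" using assms unfolding C3_closed_curve_def by (simp only: numeral_3_eq_3)
  then obtain p' p'' p''' where d: "\<And>t. (p has_vector_derivative p' t) (at t)"
     "\<And>t. (p' has_vector_derivative p'' t) (at t)" "\<And>t. (p'' has_vector_derivative p''' t) (at t)"
    by (simp only: C_times.simps) blast
  have "p' = (\<lambda>t. vector_derivative p (at t))" using d(1) vector_derivative_at by (metis)
  moreover have "continuous_on UNIV p''"
    using d(3) by (auto intro: continuous_at_imp_continuous_on has_vector_derivative_continuous)
  ultimately show ?thesis
    using assms d(1,2) unfolding C3_closed_curve_def by (intro exI[of _ p''] closed_curve.intro) auto
qed

context closed_curve
begin

definition "unit_normal t = (1 / norm (p' t)) *\<^sub>R rot (p' t)"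

lemma norm_unit_normal [simp]: "norm (unit_normal t) = 1"
  using p'_nonzero[of t] by (simp add: unit_normal_def)

lemma unit_normal_orthogonal: "unit_normal t \<bullet> p' t = 0"
  by (simp add: unit_normal_def)

lemma unit_normal_cont [continuous_intros]:
  "continuous_on A f \<Longrightarrow> continuous_on A (\<lambda>x. unit_normal (f x))"
  unfolding unit_normal_def by (intro continuous_intros) (auto simp: p'_nonzero)

lemma p'_locally_aligned:
  obtains \<delta> where "\<delta> > 0" "\<And>s t. \<bar>s - t0\<bar> < \<delta> \<Longrightarrow> \<bar>t - t0\<bar> < \<delta> \<Longrightarrow> p' s \<bullet> p' t > 0"
proof -
  let ?v = "p' t0"
  have v: "norm ?v > 0" using p'_nonzero by simp
  have "isCont p' t0" using p'_deriv has_vector_derivative_continuous by blast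
  then obtain \<delta> where \<delta>: "\<delta> > 0" "\<And>s. \<bar>s - t0\<bar> < \<delta> \<Longrightarrow> norm (p' s - ?v) < norm ?v / 3"
    unfolding continuous_at_eps_delta using v
    by (metis dist_norm divide_pos_pos zero_less_numeral real_norm_def)
  have "p' s \<bullet> p' t > 0" if "\<bar>s - t0\<bar> < \<delta>" "\<bar>t - t0\<bar> < \<delta>" for s t
  proof -
    let ?a = "p' s - ?v" and ?b = "p' t - ?v"
    have a: "norm ?a < norm ?v / 3" and b: "norm ?b < norm ?v / 3" using \<delta>(2) that by auto
    have "p' s \<bullet> p' t = ?v \<bullet> ?v + ?a \<bullet> ?v + ?v \<bullet> ?b + ?a \<bullet> ?b"
      by (simp add: inner_diff_left inner_diff_right)
    moreover have "\<bar>?a \<bullet> ?v\<bar> \<le> norm ?v / 3 * norm ?v"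
      using a by (intro order_trans[OF Cauchy_Schwarz_ineq2] mult_right_mono) auto
    moreover have "\<bar>?v \<bullet> ?b\<bar> \<le> norm ?v * (norm ?v / 3)"
      using b by (intro order_trans[OF Cauchy_Schwarz_ineq2] mult_left_mono) auto
    moreover have "\<bar>?a \<bullet> ?b\<bar> \<le> norm ?v / 3 * (norm ?v / 3)"
      using a b by (intro order_trans[OF Cauchy_Schwarz_ineq2] mult_mono) auto
    moreover have "?v \<bullet> ?v = norm ?v * norm ?v" by (simp add: norm_eq_sqrt_inner)
    moreover have "norm ?v * norm ?v > 0" using v by simp
    ultimately show ?thesis by (simp add: abs_le_iff)
  qed
  with \<delta>(1) show thesis by (rule that)
qed

text \<open>
  Along the segment from \<open>s\<close> to \<open>t\<close> the component of \<open>p\<close> in the direction \<open>w\<close> is strictly monotone.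
\<close>
lemma chord_not_orthogonal:
  assumes "s \<noteq> t" and pos: "\<And>r. r \<in> closed_segment s t \<Longrightarrow> p' r \<bullet> w > 0"
  shows "(p s - p t) \<bullet> w \<noteq> 0"
proof -
  have incr: "p a \<bullet> w < p b \<bullet> w" if "a < b" "{a..b} \<subseteq> closed_segment s t" for a b
  proof (rule DERIV_pos_imp_increasing[OF that(1)])
    fix r assume "a \<le> r" "r \<le> b"
    then have "p' r \<bullet> w > 0" using that pos by auto
    moreover have "((\<lambda>r. p r \<bullet> w) has_vector_derivative p' r \<bullet> w) (at r)"
      by (rule bounded_linear.has_vector_derivative[OF bounded_linear_inner_left p_deriv])
    ultimately show "\<exists>y. ((\<lambda>r. p r \<bullet> w) has_real_derivative y) (at r) \<and> 0 < y"
      by (auto simp: has_real_derivative_iff_has_vector_derivative)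
  qed
  show ?thesis
  proof (cases "s < t")
    case True
    then show ?thesis using incr[of s t] by (simp add: closed_segment_eq_real_ivl inner_diff_left)
  next
    case False
    then show ?thesis using incr[of t s] assms(1) by (simp add: closed_segment_eq_real_ivl inner_diff_left)
  qed
qed

text \<open>
  Near \<open>t0\<close>, two different points of the curve differ by a chord that is not orthogonal to the tangent
  at either, so the displacement along the normal does not lead back to the near part of the curve. The far
  part of the curve and \<open>F\<close> are closed sets that do not contain \<open>p t0\<close>, so they keep a
  positive distance.
\<close>
lemma normal_collar:
  assumes F: "closed F" "p t0 \<notin> F"
  obtains \<delta> \<epsilon> where "\<delta> > 0" "\<epsilon> > 0"
    "\<And>t h. \<bar>t - t0\<bar> < \<delta> \<Longrightarrow> 0 < \<bar>h\<bar> \<Longrightarrow> \<bar>h\<bar> < \<epsilon> \<Longrightarrow> p t + h *\<^sub>R unit_normal t \<notin> range p \<union> F"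
proof -
  obtain \<delta>0 where \<delta>0: "\<delta>0 > 0" "\<And>s t. \<bar>s - t0\<bar> < \<delta>0 \<Longrightarrow> \<bar>t - t0\<bar> < \<delta>0 \<Longrightarrow> p' s \<bullet> p' t > 0"
    using p'_locally_aligned[of t0] by blast
  define \<delta>1 where "\<delta>1 = min \<delta>0 (1/2)"
  have \<delta>1: "0 < \<delta>1" "\<delta>1 \<le> \<delta>0" "\<delta>1 \<le> 1/2" using \<delta>0(1) by (auto simp: \<delta>1_def)
  \<comment> \<open>The points with parameters \<open>t0 + \<delta>1\<close> and \<open>t0 - \<delta>1\<close> both belong to the far part, the second by periodicity
    as the point with parameter \<open>t0 + 1 - \<delta>1\<close>.\<close>
  let ?far = "p ` {t0 + \<delta>1..t0 + 1 - \<delta>1}"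
  have "closed ?far" by (intro compact_imp_closed compact_continuous_image continuous_intros compact_Icc)
  moreover have "p t0 \<notin> ?far"
  proof
    assume "p t0 \<in> ?far"
    then obtain t where "t0 + \<delta>1 \<le> t" "t \<le> t0 + 1 - \<delta>1" "p t = p t0" by auto
    then show False using p_neq[of t t0] \<delta>1 by simp
  qed
  ultimately have "open (- (?far \<union> F))" "p t0 \<in> - (?far \<union> F)" using F by (auto intro: open_Compl closed_Un)
  then obtain r where r: "r > 0" "ball (p t0) r \<subseteq> - (?far \<union> F)" by (meson openE)
  have "isCont p t0" using p_deriv has_vector_derivative_continuous by blast
  then obtain \<delta>2 where \<delta>2: "\<delta>2 > 0" "\<And>t. \<bar>t - t0\<bar> < \<delta>2 \<Longrightarrow> norm (p t - p t0) < r / 2"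
    unfolding continuous_at_eps_delta using r(1) by (metis dist_norm half_gt_zero real_norm_def)
  show thesis
  proof (rule that[of "min \<delta>1 \<delta>2" "r / 2"])
    fix t h assume t: "\<bar>t - t0\<bar> < min \<delta>1 \<delta>2" and h: "0 < \<bar>h\<bar>" "\<bar>h\<bar> < r / 2"
    let ?z = "p t + h *\<^sub>R unit_normal t"
    have "norm (?z - p t0) \<le> norm (p t - p t0) + norm (h *\<^sub>R unit_normal t)"
      using norm_triangle_ineq[of "p t - p t0" "h *\<^sub>R unit_normal t"] by (simp add: algebra_simps)
    also have "\<dots> < r" using \<delta>2(2)[of t] t h by simp
    finally have z: "?z \<notin> ?far \<union> F" using r(2) by (auto simp: dist_norm norm_minus_commute subset_iff)
    have "?z \<notin> range p"
    proof
      assume "?z \<in> range p"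
      then obtain s where s: "s \<in> {t0 - \<delta>1..t0 - \<delta>1 + 1}" "?z = p s" using range_p[of "t0 - \<delta>1"] by auto
      have "p (t0 - \<delta>1) = p (t0 + 1 - \<delta>1)" using p_periodic[of "t0 - \<delta>1"] by (simp add: algebra_simps)
      moreover have "p (t0 + 1 - \<delta>1) \<in> ?far" using \<delta>1 by auto
      ultimately have "s \<noteq> t0 - \<delta>1" using z s by auto
      moreover have "\<not> t0 + \<delta>1 \<le> s" using z s by auto
      ultimately have s': "\<bar>s - t0\<bar> < \<delta>1" using s by auto
      have orth: "(p s - p t) \<bullet> p' t = 0"
        using unit_normal_orthogonal[of t] by (simp add: s(2)[symmetric])
      have "s = t"
      proof (rule ccontr)
        assume "s \<noteq> t"
        then have "(p s - p t) \<bullet> p' t \<noteq> 0"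
          by (rule chord_not_orthogonal)
            (use s' t \<delta>1 in \<open>auto simp: closed_segment_eq_real_ivl split: if_splits intro!: \<delta>0(2)\<close>)
        with orth show False by simp
      qed
      with s(2) have "h *\<^sub>R unit_normal t = 0" by simp
      then show False using h norm_unit_normal[of t] by (metis abs_0 less_irrefl norm_zero scaleR_eq_0_iff zero_neq_one)
    qed
    with z show "?z \<notin> range p \<union> F" by simp
  qed (use \<delta>1 \<delta>2 r in auto)
qed

text \<open>
  Each side of the collar is connected and misses the frontier, so it lies entirely inside or entirely
  outside \<open>\<Omega>\<close>. If the sign of \<open>\<nu>\<close> relative to the rotated tangent changed near \<open>t0\<close>, one side would have to
  be both. So the sign is locally constant, hence constant.
\<close>
lemma outward_normal_sign:
  assumes normal: "\<And>t. norm (\<nu> (p t)) = 1" "\<And>t. \<nu> (p t) \<bullet> p' t = 0"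
    and outward: "\<And>t. \<forall>\<^sub>F h in at_right 0. p t - h *\<^sub>R \<nu> (p t) \<in> \<Omega> \<and> p t + h *\<^sub>R \<nu> (p t) \<notin> closure \<Omega>"
    and fr: "frontier \<Omega> = range p \<union> F" "closed F" "range p \<inter> F = {}"
  obtains \<sigma> where "\<sigma> = 1 \<or> \<sigma> = -1" "\<And>t. norm (p' t) *\<^sub>R \<nu> (p t) = \<sigma> *\<^sub>R rot (p' t)"
proof -
  have cases: "\<exists>k. (k = 1 \<or> k = - 1) \<and> \<nu> (p t) = k *\<^sub>R unit_normal t" for t
  proof -
    have "norm (p' t) *\<^sub>R \<nu> (p t) = norm (p' t) *\<^sub>R (unit_normal t)
      \<or> norm (p' t) *\<^sub>R \<nu> (p t) = norm (p' t) *\<^sub>R (- unit_normal t)"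
      using unit_orthogonal_cases[OF normal] p'_nonzero[of t] by (simp add: unit_normal_def)
    then have "\<nu> (p t) = unit_normal t \<or> \<nu> (p t) = - unit_normal t"
      using p'_nonzero[of t] by (simp only: scaleR_cancel_left norm_eq_zero) blast
    then show ?thesis by (metis scaleR_minus1_left scaleR_one)
  qed
  \<comment> \<open>The sign of \<open>\<nu>\<close> relative to the rotated tangent.\<close>
  define k where "k t = \<nu> (p t) \<bullet> unit_normal t" for t
  have k: "(k t = 1 \<or> k t = - 1) \<and> \<nu> (p t) = k t *\<^sub>R unit_normal t" for t
  proof -
    obtain j where j: "j = 1 \<or> j = - 1" "\<nu> (p t) = j *\<^sub>R unit_normal t" using cases by blast
    have "unit_normal t \<bullet> unit_normal t = 1" using norm_unit_normal[of t] by (simp only: norm_eq_1)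
    then have "k t = j" unfolding k_def j(2) by simp
    with j show ?thesis by simp
  qed
  have local: "\<forall>\<^sub>F t in at t0. k t0 = k t" for t0
  proof -
    have "p t0 \<notin> F" using fr(3) by blast
    from normal_collar[OF fr(2) this] obtain \<delta> \<epsilon> where \<delta>: "\<delta> > 0" "\<epsilon> > 0"
      and collar: "\<And>t h. \<bar>t - t0\<bar> < \<delta> \<Longrightarrow> 0 < \<bar>h\<bar> \<Longrightarrow> \<bar>h\<bar> < \<epsilon> \<Longrightarrow> p t + h *\<^sub>R unit_normal t \<notin> range p \<union> F"
      by metis
    \<comment> \<open>The inner side of the collar, as seen from \<open>t0\<close>.\<close>
    let ?P = "{t0 - \<delta><..<t0 + \<delta>} \<times> {0<..<\<epsilon>}"
    let ?\<psi> = "\<lambda>z. p (fst z) - snd z *\<^sub>R k t0 *\<^sub>R unit_normal (fst z)"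
    have conn: "connected (?\<psi> ` ?P)"
      by (intro connected_continuous_image continuous_intros connected_Times convex_connected) auto
    have disj: "?\<psi> ` ?P \<inter> frontier \<Omega> = {}"
    proof (clarsimp simp: fr(1) disjoint_iff)
      fix t h assume th: "t0 - \<delta> < t" "t < t0 + \<delta>" "0 < h" "h < \<epsilon>"
      have "p t - (h * k t0) *\<^sub>R unit_normal t = p t + (- h * k t0) *\<^sub>R unit_normal t" by simp
      moreover have "p t + (- h * k t0) *\<^sub>R unit_normal t \<notin> range p \<union> F"
        using th k[of t0] by (intro collar) (auto simp: abs_mult)
      ultimately show "p t - (h * k t0) *\<^sub>R unit_normal t \<notin> range p \<and> p t - (h * k t0) *\<^sub>R unit_normal t \<notin> F"
        by simp
    qed
    have small: "\<forall>\<^sub>F h in at_right 0. 0 < h \<and> h < \<epsilon>"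
      using \<delta>(2) eventually_at_right_less[of 0] by (auto simp: eventually_at_right_field)
    have "\<forall>\<^sub>F h in at_right 0. (0 < h \<and> h < \<epsilon>) \<and> p t0 - h *\<^sub>R \<nu> (p t0) \<in> \<Omega>"
      using outward[of t0] small by eventually_elim auto
    then obtain h where h: "0 < h" "h < \<epsilon>" "p t0 - h *\<^sub>R \<nu> (p t0) \<in> \<Omega>"
      using eventually_happens'[of "at_right (0::real)"] by auto
    then have "?\<psi> (t0, h) \<in> \<Omega>" using k[of t0] by simp
    moreover have "(t0, h) \<in> ?P" using h \<delta> by simp
    ultimately have "?\<psi> ` ?P \<inter> \<Omega> \<noteq> {}" by blast
    then have inside: "?\<psi> ` ?P \<subseteq> \<Omega>"
      using connected_Int_frontier[OF conn, of \<Omega>] disj by blast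
    have "k t0 = k t" if t: "\<bar>t - t0\<bar> < \<delta>" for t
    proof (rule ccontr)
      assume "k t0 \<noteq> k t"
      then have kt: "k t = - k t0" using k[of t] k[of t0] by auto
      have "\<forall>\<^sub>F h in at_right 0. (0 < h \<and> h < \<epsilon>) \<and> p t + h *\<^sub>R \<nu> (p t) \<notin> closure \<Omega>"
        using outward[of t] small by eventually_elim auto
      then obtain h where h: "0 < h" "h < \<epsilon>" "p t + h *\<^sub>R \<nu> (p t) \<notin> closure \<Omega>"
        using eventually_happens'[of "at_right (0::real)"] by auto
      have "\<nu> (p t) = - (k t0 *\<^sub>R unit_normal t)" using k[of t] kt by simp
      then have "p t + h *\<^sub>R \<nu> (p t) = ?\<psi> (t, h)" by simp
      moreover have "(t, h) \<in> ?P" using h t by (auto simp: abs_less_iff)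
      from subsetD[OF inside imageI[OF this]] have "?\<psi> (t, h) \<in> \<Omega>" .
      ultimately have "p t + h *\<^sub>R \<nu> (p t) \<in> \<Omega>" by (simp only:)
      then show False using h(3) closure_subset by blast
    qed
    then show ?thesis using \<delta>(1) by (auto simp: eventually_at dist_real_def)
  qed
  have "k t = k 0" for t
    by (rule connected_local_const[of UNIV]) (use local in \<open>auto simp: connected_UNIV\<close>)
  show thesis
  proof (rule that[of "k 0"])
    show "k 0 = 1 \<or> k 0 = - 1" using k by blast
    fix t
    have "\<nu> (p t) = k 0 *\<^sub>R unit_normal t" using k \<open>k t = k 0\<close> by metis
    then show "norm (p' t) *\<^sub>R \<nu> (p t) = k 0 *\<^sub>R rot (p' t)" using p'_nonzero[of t] by (simp add: unit_normal_def)
  qed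
qed

end

section \<open>Integrals along a closed curve\<close>

lemma has_integral_shift_real:
  fixes f :: "real \<Rightarrow> real"
  assumes "(f has_integral i) {c..d}"
  shows "((\<lambda>x. f (x + k)) has_integral i) {c - k..d - k}"
  using has_integral_affinity'[of f i c d 1 k] assms by simp

text \<open>
  Moves the fixed parameter interval of the arc length integral to a period centred at the boundary point
  under consideration.
\<close>
lemma integral_periodic:
  fixes f :: "real \<Rightarrow> real"
  assumes cont: "continuous_on UNIV f" and per: "\<And>t. f (t + 1) = f t"
  shows "integral {a..a + 1} f = integral {0..1} f"
proof -
  have int: "f integrable_on {c..d}" for c d
    by (rule integrable_continuous_real) (rule continuous_on_subset[OF cont], simp)
  have shift: "integral {c..d} (\<lambda>x. f (x + k)) = integral {c + k..d + k} f" for c d k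
    using has_integral_shift_real[OF integrable_integral[OF int[of "c + k" "d + k"]], of k]
    by (simp add: integral_unique)
  note k = periodic_shift_int[of f, OF per]
  let ?k = "\<lfloor>a\<rfloor>" let ?b = "a - of_int \<lfloor>a\<rfloor>"
  have b: "0 \<le> ?b" "?b \<le> 1" by linarith+
  have "integral {a..a + 1} f = integral {?b..?b + 1} (\<lambda>x. f (x + of_int ?k))"
    by (subst shift) (simp add: algebra_simps)
  also have "\<dots> = integral {?b..?b + 1} f" by (simp add: k)
  also have "\<dots> = integral {?b..1} f + integral {1..?b + 1} f"
    using Henstock_Kurzweil_Integration.integral_combine[of ?b 1 "?b + 1" f] b int by simp
  also have "integral {1..?b + 1} f = integral {0..?b} (\<lambda>x. f (x + 1))"
    by (subst shift) simp
  also have "\<dots> = integral {0..?b} f" by (simp add: per)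
  also have "integral {?b..1} f + integral {0..?b} f = integral {0..1} f"
    using Henstock_Kurzweil_Integration.integral_combine[of 0 ?b 1 f] b int by simp
  finally show ?thesis .
qed

text \<open>
  The antiderivative \<open>sgn (t - t0) \<bar>t - t0\<bar>\<^sup>e\<^sup>+\<^sup>1 / (e + 1)\<close> is continuous also at \<open>t0\<close>, which is the one
  point where it may fail to be differentiable.
\<close>
lemma integrable_abs_powr:
  fixes e t0 r :: real
  assumes e: "e > -1"
  shows "(\<lambda>t. \<bar>t - t0\<bar> powr e) integrable_on {t0 - r..t0 + r}"
proof (cases "r \<ge> 0")
  case True
  let ?F = "\<lambda>t. sgn (t - t0) * \<bar>t - t0\<bar> powr (e + 1) / (e + 1)"
  have "((\<lambda>t. \<bar>t - t0\<bar> powr e) has_integral ?F (t0 + r) - ?F (t0 - r)) {t0 - r..t0 + r}"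
  proof (rule fundamental_theorem_of_calculus_strong[of "{t0}"])
    fix t assume t: "t \<in> {t0 - r..t0 + r} - {t0}"
    have "(?F has_real_derivative \<bar>t - t0\<bar> powr e) (at t)"
    proof (cases "t > t0")
      case True
      have "((\<lambda>t. (t - t0) powr (e + 1) / (e + 1)) has_real_derivative (t - t0) powr e) (at t)"
        using True e by (auto intro!: derivative_eq_intros)
      then have "(?F has_real_derivative (t - t0) powr e) (at t)"
        by (rule has_field_derivative_transform_within_open[of _ _ _ "{t0<..}"]) (use True in auto)
      then show ?thesis using True by simp
    next
      case False
      then have lt: "t < t0" using t by simp
      have "((\<lambda>t. - ((t0 - t) powr (e + 1)) / (e + 1)) has_real_derivative (t0 - t) powr e) (at t)"
        using lt e by (auto intro!: derivative_eq_intros)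
      then have "(?F has_real_derivative (t0 - t) powr e) (at t)"
        by (rule has_field_derivative_transform_within_open[of _ _ _ "{..<t0}"]) (use lt in auto)
      then show ?thesis using lt by simp
    qed
    then show "(?F has_vector_derivative \<bar>t - t0\<bar> powr e) (at t)"
      by (simp add: has_real_derivative_iff_has_vector_derivative)
  next
    show "continuous_on {t0 - r..t0 + r} ?F"
    proof (intro continuous_at_imp_continuous_on ballI)
      fix t
      show "isCont ?F t"
      proof (cases "t = t0")
        case False
        then show ?thesis using e by (intro continuous_intros) (auto simp: sgn_zero_iff)
      next
        case True
        have "((\<lambda>t. \<bar>t - t0\<bar> powr (e + 1) / (e + 1)) \<longlongrightarrow> 0) (at t0)"
          using e by (intro tendsto_eq_intros tendsto_zero_powrI) (auto intro!: tendsto_eq_intros)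
        then have "(?F \<longlongrightarrow> 0) (at t0)"
          by (rule Lim_null_comparison[rotated]) (use e in \<open>auto simp: abs_mult abs_sgn_eq intro!: always_eventually\<close>)
        then show ?thesis using True by (simp add: isCont_def)
      qed
    qed
  qed (use True in auto)
  then show ?thesis by (auto simp: integrable_on_def)
qed auto

lemma continuous_on_Icc_bound:
  fixes f :: "real \<Rightarrow> 'b::real_normed_vector"
  assumes "continuous_on {a..b} f"
  obtains M where "M > 0" "\<And>t. t \<in> {a..b} \<Longrightarrow> norm (f t) \<le> M"
proof -
  have "bounded (f ` {a..b})"
    by (intro compact_imp_bounded compact_continuous_image assms compact_Icc)
  then show thesis using that unfolding bounded_pos by auto
qed

context closed_curve
begin

text \<open>
  The displacement \<open>h n0\<close> is orthogonal to the tangent at \<open>t0\<close>. Hence close to \<open>t0\<close> the tangential component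
  alone, which does not depend on \<open>h\<close>, gives a bound uniform in \<open>h\<close>. For the other parameters of the
  period the curve stays away from \<open>p t0\<close> by compactness, and small \<open>h\<close> do no harm.
\<close>
lemma chord_lower_bound:
  assumes n0: "n0 \<bullet> p' t0 = 0" "norm n0 = 1"
  obtains m h0 where "m > 0" "h0 > 0"
    "\<And>h t. 0 \<le> h \<Longrightarrow> h \<le> h0 \<Longrightarrow> \<bar>t - t0\<bar> \<le> 1/2 \<Longrightarrow> norm (p t - (p t0 - h *\<^sub>R n0)) \<ge> m * \<bar>t - t0\<bar>"
proof -
  let ?v = "p' t0"
  have v: "norm ?v > 0" using p'_nonzero by simp
  have vv: "?v \<bullet> ?v = norm ?v * norm ?v" by (simp add: norm_eq_sqrt_inner)
  have "continuous_on UNIV (\<lambda>r. p' r \<bullet> ?v)" by (intro continuous_intros)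
  then have "isCont (\<lambda>r. p' r \<bullet> ?v) t0" by (simp add: continuous_on_eq_continuous_at)
  moreover have "?v \<bullet> ?v / 2 > 0" using v vv by simp
  ultimately obtain \<delta> where \<delta>: "\<delta> > 0"
    "\<And>r. \<bar>r - t0\<bar> < \<delta> \<Longrightarrow> \<bar>p' r \<bullet> ?v - ?v \<bullet> ?v\<bar> < ?v \<bullet> ?v / 2"
    unfolding continuous_at_eps_delta by (metis dist_real_def)
  have lower: "p' r \<bullet> ?v \<ge> ?v \<bullet> ?v / 2" if "\<bar>r - t0\<bar> < \<delta>" for r
    using \<delta>(2)[OF that] by linarith
  have near: "norm (p t - (p t0 - h *\<^sub>R n0)) \<ge> norm ?v / 2 * \<bar>t - t0\<bar>" if t: "\<bar>t - t0\<bar> < \<delta>" for h t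
  proof -
    \<comment> \<open>Near \<open>t0\<close> the curve advances in the direction \<open>p' t0\<close> at no less than half the speed it has at \<open>t0\<close>.\<close>
    have mono: "p a \<bullet> ?v - ?v \<bullet> ?v / 2 * a \<le> p b \<bullet> ?v - ?v \<bullet> ?v / 2 * b"
      if "a \<le> b" "\<And>r. a \<le> r \<Longrightarrow> r \<le> b \<Longrightarrow> \<bar>r - t0\<bar> < \<delta>" for a b
    proof (rule DERIV_nonneg_imp_nondecreasing[OF that(1)])
      fix r assume "a \<le> r" "r \<le> b"
      with that(2) lower have l: "p' r \<bullet> ?v \<ge> ?v \<bullet> ?v / 2" by blast
      have "((\<lambda>r. p r \<bullet> ?v) has_vector_derivative p' r \<bullet> ?v) (at r)"
        by (rule bounded_linear.has_vector_derivative[OF bounded_linear_inner_left p_deriv])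
      then have "((\<lambda>r. p r \<bullet> ?v) has_real_derivative p' r \<bullet> ?v) (at r)"
        by (simp add: has_real_derivative_iff_has_vector_derivative)
      then have "((\<lambda>r. p r \<bullet> ?v - ?v \<bullet> ?v / 2 * r) has_real_derivative p' r \<bullet> ?v - ?v \<bullet> ?v / 2 * 1) (at r)"
        by (intro DERIV_diff DERIV_cmult DERIV_ident)
      with l show "\<exists>y. ((\<lambda>r. p r \<bullet> ?v - ?v \<bullet> ?v / 2 * r) has_real_derivative y) (at r) \<and> 0 \<le> y" by force
    qed
    have "(norm ?v / 2 * \<bar>t - t0\<bar>) * norm ?v = ?v \<bullet> ?v / 2 * \<bar>t - t0\<bar>" by (simp add: vv)
    also have "\<dots> \<le> \<bar>(p t - p t0) \<bullet> ?v\<bar>"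
    proof (cases "t0 \<le> t")
      case True
      have "p t0 \<bullet> ?v - ?v \<bullet> ?v / 2 * t0 \<le> p t \<bullet> ?v - ?v \<bullet> ?v / 2 * t"
        using True t by (intro mono) auto
      then have "?v \<bullet> ?v / 2 * (t - t0) \<le> (p t - p t0) \<bullet> ?v"
        unfolding inner_diff_left right_diff_distrib by linarith
      moreover have "\<bar>t - t0\<bar> = t - t0" using True by simp
      ultimately show ?thesis using abs_ge_self order_trans by metis
    next
      case False
      have "p t \<bullet> ?v - ?v \<bullet> ?v / 2 * t \<le> p t0 \<bullet> ?v - ?v \<bullet> ?v / 2 * t0"
        using False t by (intro mono) auto
      then have "?v \<bullet> ?v / 2 * (t0 - t) \<le> - ((p t - p t0) \<bullet> ?v)"
        unfolding inner_diff_left right_diff_distrib by linarith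
      moreover have "\<bar>t - t0\<bar> = t0 - t" using False by simp
      ultimately show ?thesis using abs_ge_minus_self order_trans by metis
    qed
    also have "(p t - p t0) \<bullet> ?v = (p t - (p t0 - h *\<^sub>R n0)) \<bullet> ?v"
      using n0(1) by (simp add: inner_diff_left inner_add_left)
    also have "\<bar>\<dots>\<bar> \<le> norm (p t - (p t0 - h *\<^sub>R n0)) * norm ?v"
      by (rule Cauchy_Schwarz_ineq2)
    finally have "(norm ?v / 2 * \<bar>t - t0\<bar>) * norm ?v \<le> norm (p t - (p t0 - h *\<^sub>R n0)) * norm ?v" .
    then show ?thesis using v by (simp only: mult_le_cancel_right_pos)
  qed
  let ?K = "{t0 - 1/2..t0 + 1/2} - ball t0 \<delta>"
  obtain \<mu> where \<mu>: "\<mu> > 0" "\<And>t. t \<in> ?K \<Longrightarrow> norm (p t - p t0) \<ge> \<mu>"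
  proof (cases "?K = {}")
    case False
    have "compact ?K" by (intro compact_diff compact_Icc open_ball)
    moreover have "continuous_on ?K (\<lambda>t. norm (p t - p t0))" by (intro continuous_intros)
    ultimately obtain t1 where t1: "t1 \<in> ?K" "\<And>t. t \<in> ?K \<Longrightarrow> norm (p t1 - p t0) \<le> norm (p t - p t0)"
      using continuous_attains_inf[OF _ False] by metis
    have "t1 \<noteq> t0" using t1(1) \<delta>(1) by auto
    moreover have "\<bar>t1 - t0\<bar> < 1" using t1(1) by auto
    ultimately have "p t1 \<noteq> p t0" by (rule p_neq)
    then show thesis using t1(2) that[of "norm (p t1 - p t0)"] by simp
  next
    case True
    show thesis
    proof (rule that[of 1])
      fix t assume "t \<in> ?K"
      with True have "t \<in> {}" by (simp only:)
      then show "1 \<le> norm (p t - p t0)" by simp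
    qed simp
  qed
  show thesis
  proof (rule that[of "min (norm ?v / 2) \<mu>" "\<mu> / 2"])
    fix h t assume h: "0 \<le> h" "h \<le> \<mu> / 2" and t: "\<bar>t - t0\<bar> \<le> 1/2"
    show "min (norm ?v / 2) \<mu> * \<bar>t - t0\<bar> \<le> norm (p t - (p t0 - h *\<^sub>R n0))"
    proof (cases "\<bar>t - t0\<bar> < \<delta>")
      case True
      then show ?thesis by (intro order_trans[OF mult_right_mono near]) auto
    next
      case False
      moreover have "t0 - 1/2 \<le> t" "t \<le> t0 + 1/2" using t by linarith+
      ultimately have "t \<in> ?K" by (simp add: dist_real_def abs_minus_commute)
      then have "\<mu> \<le> norm (p t - p t0)" by (rule \<mu>(2))
      also have "\<dots> \<le> norm (p t - (p t0 - h *\<^sub>R n0)) + norm (h *\<^sub>R n0)"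
        using norm_triangle_ineq4[of "p t - (p t0 - h *\<^sub>R n0)" "h *\<^sub>R n0"] by simp
      also have "norm (h *\<^sub>R n0) \<le> \<mu> / 2" using h n0(2) by simp
      finally have "\<mu> / 2 \<le> norm (p t - (p t0 - h *\<^sub>R n0))" by simp
      moreover have "min (norm ?v / 2) \<mu> * \<bar>t - t0\<bar> \<le> \<mu> * (1/2)"
        using \<mu>(1) t by (intro mult_mono) auto
      ultimately show ?thesis by simp
    qed
  qed (use v \<mu> in auto)
qed

lemma chord_deriv: "((\<lambda>t. p t - x) has_derivative (\<lambda>h. h *\<^sub>R p' t)) (at t)"
  using p_deriv[of t] by (auto simp: has_vector_derivative_def intro!: derivative_eq_intros)

lemma chord_inner_deriv: "((\<lambda>t. (p t - x) \<bullet> \<tau>) has_real_derivative p' t \<bullet> \<tau>) (at t)"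
  unfolding has_field_derivative_def
  by (rule has_derivative_eq_rhs[OF has_derivative_inner_left[OF chord_deriv]]) (simp add: fun_eq_iff)

lemma chord_square_deriv:
  "((\<lambda>t. (p t - x) \<bullet> (p t - x)) has_real_derivative 2 * ((p t - x) \<bullet> p' t)) (at t)"
  unfolding has_field_derivative_def
  by (rule has_derivative_eq_rhs[OF has_derivative_inner[OF chord_deriv chord_deriv]])
    (simp add: fun_eq_iff inner_commute)

text \<open>
  The integrand is half the derivative of \<open>ln (\<bar>p t - x\<bar>\<^sup>2)\<close>, and the curve is closed.
\<close>
lemma integral_log_derivative:
  assumes "x \<notin> range p"
  shows "integral {a..a + 1} (\<lambda>t. ((p t - x) \<bullet> p' t) / ((p t - x) \<bullet> (p t - x))) = 0"
proof (rule integral_unique)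
  let ?F = "\<lambda>t. ln ((p t - x) \<bullet> (p t - x)) / 2"
  have "((\<lambda>t. ((p t - x) \<bullet> p' t) / ((p t - x) \<bullet> (p t - x))) has_integral ?F (a + 1) - ?F a) {a..a + 1}"
  proof (rule fundamental_theorem_of_calculus)
    fix t
    have pos: "(p t - x) \<bullet> (p t - x) > 0" using assms by auto
    from DERIV_cdivide[OF DERIV_chain2[OF DERIV_ln_divide[OF pos] chord_square_deriv], of 2]
    have "(?F has_real_derivative ((p t - x) \<bullet> p' t) / ((p t - x) \<bullet> (p t - x))) (at t)"
      by simp
    then show "(?F has_vector_derivative ((p t - x) \<bullet> p' t) / ((p t - x) \<bullet> (p t - x))) (at t within {a..a + 1})"
      by (auto simp: has_real_derivative_iff_has_vector_derivative intro: has_vector_derivative_at_within)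
  qed simp
  then show "((\<lambda>t. ((p t - x) \<bullet> p' t) / ((p t - x) \<bullet> (p t - x))) has_integral 0) {a..a + 1}"
    by (simp add: p_periodic)
qed

text \<open>
  The factor of \<open>q\<close> on the left is the derivative of \<open>((p t - x) \<bullet> \<tau>) / \<bar>p t - x\<bar>\<^sup>2\<close>; the boundary
  terms cancel by periodicity.
\<close>
lemma integral_by_parts_conjugate:
  assumes x: "x \<notin> range p"
    and q: "\<And>t. (q has_real_derivative q' t) (at t)" "continuous_on UNIV q'" "\<And>t. q (t + 1) = q t"
  defines "s \<equiv> \<lambda>t. (p t - x) \<bullet> (p t - x)"
  shows "integral {a..a + 1} (\<lambda>t. q t * ((p' t \<bullet> \<tau>) / s t - 2 * ((p t - x) \<bullet> p' t) * ((p t - x) \<bullet> \<tau>) / (s t)\<^sup>2))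
    = - integral {a..a + 1} (\<lambda>t. q' t * (((p t - x) \<bullet> \<tau>) / s t))"
proof -
  let ?M = "\<lambda>t. ((p t - x) \<bullet> \<tau>) / s t"
  let ?M' = "\<lambda>t. (p' t \<bullet> \<tau>) / s t - 2 * ((p t - x) \<bullet> p' t) * ((p t - x) \<bullet> \<tau>) / (s t)\<^sup>2"
  have s: "s t \<noteq> 0" for t using x by (auto simp: s_def)
  have ds: "(s has_real_derivative 2 * ((p t - x) \<bullet> p' t)) (at t)" for t
    unfolding s_def by (rule chord_square_deriv)
  have dM: "(?M has_real_derivative ?M' t) (at t)" for t
  proof -
    have "((p' t \<bullet> \<tau>) * s t - ((p t - x) \<bullet> \<tau>) * (2 * ((p t - x) \<bullet> p' t))) / (s t * s t) = ?M' t"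
      using s[of t] by (simp add: diff_divide_distrib power2_eq_square mult_ac)
    then show ?thesis using DERIV_divide[OF chord_inner_deriv[of x \<tau> t] ds s] by simp
  qed
  have sc: "continuous_on A s" for A unfolding s_def by (intro continuous_intros)
  have cM: "continuous_on A ?M" for A by (intro continuous_intros sc) (use s in auto)
  have cM': "continuous_on A ?M'" for A by (intro continuous_intros sc) (use s in auto)
  have cq: "continuous_on A q" for A
    by (rule DERIV_continuous_on[where D = q']) (auto intro: has_field_derivative_at_within q)
  have cq': "continuous_on A q'" for A using continuous_on_subset[OF q(2)] by blast
  have "((\<lambda>t. q' t * ?M t + q t * ?M' t) has_integral q (a + 1) * ?M (a + 1) - q a * ?M a) {a..a + 1}"
  proof (rule fundamental_theorem_of_calculus)
    fix t
    have "((\<lambda>t. q t * ?M t) has_real_derivative q' t * ?M t + ?M' t * q t) (at t)"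
      by (rule DERIV_mult[OF q(1) dM])
    then show "((\<lambda>t. q t * ?M t) has_vector_derivative q' t * ?M t + q t * ?M' t) (at t within {a..a + 1})"
      by (auto simp: has_real_derivative_iff_has_vector_derivative mult.commute intro: has_vector_derivative_at_within)
  qed simp
  then have "integral {a..a + 1} (\<lambda>t. q' t * ?M t + q t * ?M' t) = 0"
    by (simp add: p_periodic q(3) s_def integral_unique)
  moreover have "integral {a..a + 1} (\<lambda>t. q' t * ?M t + q t * ?M' t)
      = integral {a..a + 1} (\<lambda>t. q' t * ?M t) + integral {a..a + 1} (\<lambda>t. q t * ?M' t)"
    by (intro Henstock_Kurzweil_Integration.integral_add integrable_continuous_real continuous_intros cq cq' cM cM')
  ultimately show ?thesis by simp
qed

end

section \<open>The normal derivative at the boundary\<close>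

text \<open>
  The two singularity assumptions say that the radial function is \<open>- (c / 2) ln s\<close> up to terms whose first
  two derivatives are of lower order.
\<close>
locale smooth_layer = layer_potential +
  fixes q' :: "real \<Rightarrow> real" and \<alpha> B c :: real
  assumes q_deriv: "\<And>t. (q has_real_derivative q' t) (at t)"
    and q'_holder: "\<And>s t. \<bar>q' s - q' t\<bar> \<le> B * \<bar>s - t\<bar> powr \<alpha>"
    and \<alpha>: "0 < \<alpha>" "\<alpha> < 1"
    and q_periodic: "\<And>t. q (t + 1) = q t"
    and \<sigma>_square: "\<sigma> * \<sigma> = 1"
    and G1_singularity: "\<And>R. order_at_0 R (-1/4) (\<lambda>s. G1 s + c / (2 * s))"
    and G2_singularity: "\<And>R. order_at_0 R (-5/4) (\<lambda>s. G2 s - c / (2 * s\<^sup>2))"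
begin

lemma q'_cont [continuous_intros]: "continuous_on A f \<Longrightarrow> continuous_on A (\<lambda>x. q' (f x))"
proof -
  have "isCont q' t" for t
  proof -
    have "((\<lambda>s. q' s - q' t) \<longlongrightarrow> 0) (at t)"
    proof (rule Lim_null_comparison)
      show "\<forall>\<^sub>F s in at t. norm (q' s - q' t) \<le> B * \<bar>s - t\<bar> powr \<alpha>"
        using q'_holder by (auto intro: always_eventually)
      show "((\<lambda>s. B * \<bar>s - t\<bar> powr \<alpha>) \<longlongrightarrow> 0) (at t)"
        using \<alpha> by (intro tendsto_mult_right_zero tendsto_zero_powrI) (auto intro!: tendsto_eq_intros)
    qed
    then show ?thesis unfolding isCont_def by (rule LIM_zero_cancel)
  qed
  then have "continuous_on UNIV q'" by (simp add: continuous_at_imp_continuous_on)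
  then show "continuous_on A f \<Longrightarrow> continuous_on A (\<lambda>x. q' (f x))"
    using continuous_on_compose2 by (metis subset_UNIV)
qed

lemma normal_weight_periodic: "normal_weight (t + 1) = normal_weight t"
  by (simp add: normal_weight_def p'_periodic)

text \<open>
  \<open>tangent\<close> and \<open>normal_at\<close> belong to the boundary point that is approached, in contrast to
  \<open>normal_weight\<close>, which varies with the point of integration.
\<close>
definition "tangent t = (1 / norm (p' t)) *\<^sub>R p' t"
definition "normal_at t = \<sigma> *\<^sub>R rot (tangent t)"

lemma norm_tangent: "norm (tangent t) = 1"
  using p'_nonzero[of t] by (simp add: tangent_def)

lemma norm_normal_at: "norm (normal_at t) = 1"
proof -
  have "\<bar>\<sigma>\<bar> = 1" using \<sigma>_square by (metis abs_mult_self_eq abs_one abs_square_eq_1 power2_eq_square)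
  then show ?thesis by (simp add: normal_at_def norm_tangent)
qed

lemma normal_at_orthogonal: "normal_at t \<bullet> p' t = 0"
  by (simp add: normal_at_def tangent_def rot_scaleR)

text \<open>
  The part of the second normal derivative of the kernel that remains after the contribution of the
  logarithm is removed.
\<close>
definition "remainder t0 x t =
   - 4 * (G2 ((p t - x) \<bullet> (p t - x)) - c / (2 * ((p t - x) \<bullet> (p t - x))\<^sup>2))
       * ((p t - x) \<bullet> normal_weight t) * ((p t - x) \<bullet> normal_at t0)
   - 2 * (G1 ((p t - x) \<bullet> (p t - x)) + c / (2 * ((p t - x) \<bullet> (p t - x)))) * (normal_weight t \<bullet> normal_at t0)"

text \<open>
  The vector \<open>q' t \<tau>\<close> comes from the integration by parts. The second term is tangent to the curve, so its
  contribution integrates to zero, and it is scaled such that the difference vanishes at \<open>t0\<close>.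
\<close>
definition "density_defect t0 t = q' t *\<^sub>R tangent t0 - (q' t0 / norm (p' t0)) *\<^sub>R p' t"

definition "integrand t0 x t = q t * remainder t0 x t
   + c * (((p t - x) \<bullet> density_defect t0 t) / ((p t - x) \<bullet> (p t - x)))"

text \<open>
  With \<open>c / (2 s)\<close> and \<open>c / (2 s\<^sup>2)\<close> separated from the profile derivatives, what they contribute is turned
  from normal into tangential components by \<open>inner_rot_product\<close>; this gives the derivative along the
  curve that \<open>integral_by_parts_conjugate\<close> treats.
\<close>
lemma dl_grad_split:
  assumes "x \<noteq> p t"
  defines "d \<equiv> p t - x"
  shows "dl_grad G1 G2 (p t) (normal_weight t) x \<bullet> normal_at t0 = remainder t0 x t
     + - c * ((p' t \<bullet> tangent t0) / (d \<bullet> d) - 2 * (d \<bullet> p' t) * (d \<bullet> tangent t0) / (d \<bullet> d)\<^sup>2)"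
proof -
  have s: "d \<bullet> d \<noteq> 0" using assms by simp
  let ?s = "d \<bullet> d" and ?\<tau> = "tangent t0" and ?N = "normal_weight t" and ?n = "normal_at t0"
  have "(d \<bullet> ?N) * (d \<bullet> ?n) = (\<sigma> * \<sigma>) * ((d \<bullet> rot (p' t)) * (d \<bullet> rot ?\<tau>))"
    by (simp add: normal_weight_def normal_at_def)
  then have 1: "(d \<bullet> ?N) * (d \<bullet> ?n) = ?s * (p' t \<bullet> ?\<tau>) - (d \<bullet> p' t) * (d \<bullet> ?\<tau>)"
    by (simp add: \<sigma>_square inner_rot_product)
  have "?N \<bullet> ?n = (\<sigma> * \<sigma>) * (p' t \<bullet> ?\<tau>)"
    by (simp add: normal_weight_def normal_at_def rot_inner_rot)
  then have 2: "?N \<bullet> ?n = p' t \<bullet> ?\<tau>" by (simp add: \<sigma>_square)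
  have A: "dl_grad G1 G2 (p t) ?N x \<bullet> ?n = - 4 * G2 ?s * ((d \<bullet> ?N) * (d \<bullet> ?n)) - 2 * G1 ?s * (?N \<bullet> ?n)"
    by (simp add: dl_grad_def d_def inner_diff_left)
  have B: "remainder t0 x t = - 4 * (G2 ?s - c / (2 * ?s\<^sup>2)) * ((d \<bullet> ?N) * (d \<bullet> ?n))
      - 2 * (G1 ?s + c / (2 * ?s)) * (?N \<bullet> ?n)"
    unfolding remainder_def d_def by (simp only: mult.assoc)
  have C: "- 4 * g2 * (s * a - b * e) - 2 * g1 * a =
     (- 4 * (g2 - c / (2 * s\<^sup>2)) * (s * a - b * e) - 2 * (g1 + c / (2 * s)) * a)
      + - c * (a / s - 2 * b * e / s\<^sup>2)" if "s \<noteq> 0" for g1 g2 s a b e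
    using that by (simp add: field_simps power2_eq_square)
  show ?thesis unfolding A B 1 2 by (rule C[OF s])
qed

lemma integrand_continuity:
  assumes f: "continuous_on A f" and h: "continuous_on A h" and ne: "\<And>z. z \<in> A \<Longrightarrow> f z \<noteq> p (h z)"
  shows "continuous_on A (\<lambda>z. remainder t0 (f z) (h z))"
    "continuous_on A (\<lambda>z. integrand t0 (f z) (h z))"
proof -
  have pos: "(\<lambda>z. (p (h z) - f z) \<bullet> (p (h z) - f z)) ` A \<subseteq> {0<..}"
  proof clarsimp
    fix z assume "z \<in> A" "p (h z) = f z"
    with ne[of z] show False by simp
  qed
  have nz: "z \<in> A \<Longrightarrow> (p (h z) - f z) \<bullet> (p (h z) - f z) \<noteq> 0" for z using ne[of z] by simp
  have s: "continuous_on A (\<lambda>z. (p (h z) - f z) \<bullet> (p (h z) - f z))"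
    by (intro continuous_intros f h)
  note G = continuous_on_compose2[OF G1_cont s pos] continuous_on_compose2[OF G2_cont s pos]
  show *: "continuous_on A (\<lambda>z. remainder t0 (f z) (h z))"
    unfolding remainder_def by (intro continuous_intros f h G s) (use nz in auto)
  show "continuous_on A (\<lambda>z. integrand t0 (f z) (h z))"
    unfolding integrand_def density_defect_def by (intro continuous_intros * f h s) (use nz in auto)
qed

text \<open>
  The regularization of the hypersingular integral, at points off the curve: the splitting of the kernel, an
  integration by parts, and the subtraction of a term with integral zero. All the equalities are exact, no
  limit is involved yet.
\<close>
lemma normal_component_of_gradient:
  assumes x: "x \<notin> range p"
  shows "pot_grad x \<bullet> normal_at t0 = integral {a..a + 1} (integrand t0 x)"
proof -
  let ?s = "\<lambda>t. (p t - x) \<bullet> (p t - x)" and ?\<tau> = "tangent t0" and ?k = "q' t0 / norm (p' t0)"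
  let ?M' = "\<lambda>t. (p' t \<bullet> ?\<tau>) / ?s t - 2 * ((p t - x) \<bullet> p' t) * ((p t - x) \<bullet> ?\<tau>) / (?s t)\<^sup>2"
  have xp: "x \<noteq> p t" for t using x by auto
  have s: "?s t \<noteq> 0" for t using xp[of t] by simp
  let ?D = "\<lambda>t. q t *\<^sub>R dl_grad G1 G2 (p t) (normal_weight t) x"
  have cD: "continuous_on A ?D" for A
    by (intro kernel_continuity(2) continuous_intros) (use xp in auto)
  have "pot_grad x \<bullet> normal_at t0 = integral {0..1} (\<lambda>t. ?D t \<bullet> normal_at t0)"
    using integral_linear[OF integrable_continuous_real[OF cD[of "{0..1}"]] bounded_linear_inner_left[of "normal_at t0"]]
    unfolding o_def pot_grad_def by simp
  also have "\<dots> = integral {a..a + 1} (\<lambda>t. ?D t \<bullet> normal_at t0)"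
    by (rule integral_periodic[symmetric])
      (intro continuous_intros cD, simp add: p_periodic q_periodic normal_weight_periodic)
  also have "\<dots> = integral {a..a + 1} (\<lambda>t. q t * remainder t0 x t + - c * (q t * ?M' t))"
  proof (rule Henstock_Kurzweil_Integration.integral_cong)
    fix t
    show "?D t \<bullet> normal_at t0 = q t * remainder t0 x t + - c * (q t * ?M' t)"
      unfolding inner_scaleR_left dl_grad_split[OF xp] by (simp only: distrib_left mult.left_commute)
  qed
  also have "\<dots> = integral {a..a + 1} (\<lambda>t. q t * remainder t0 x t) + - c * integral {a..a + 1} (\<lambda>t. q t * ?M' t)"
    unfolding integral_mult_right[symmetric]
    by (intro Henstock_Kurzweil_Integration.integral_add integrable_continuous_real continuous_intros integrand_continuity(1))
      (use s xp in auto)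
  also have "integral {a..a + 1} (\<lambda>t. q t * ?M' t) = - integral {a..a + 1} (\<lambda>t. q' t * (((p t - x) \<bullet> ?\<tau>) / ?s t))"
    by (rule integral_by_parts_conjugate[OF x q_deriv _ q_periodic]) (intro continuous_intros)
  \<comment> \<open>The subtracted integral is zero; it serves to make the density vanish at \<open>t0\<close>.\<close>
  also have "integral {a..a + 1} (\<lambda>t. q' t * (((p t - x) \<bullet> ?\<tau>) / ?s t)) =
      integral {a..a + 1} (\<lambda>t. q' t * (((p t - x) \<bullet> ?\<tau>) / ?s t))
      - ?k * integral {a..a + 1} (\<lambda>t. ((p t - x) \<bullet> p' t) / ?s t)"
    by (simp add: integral_log_derivative[OF x])
  also have "\<dots> = integral {a..a + 1} (\<lambda>t. q' t * (((p t - x) \<bullet> ?\<tau>) / ?s t) - ?k * (((p t - x) \<bullet> p' t) / ?s t))"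
    unfolding integral_mult_right[symmetric]
    by (intro Henstock_Kurzweil_Integration.integral_diff[symmetric] integrable_continuous_real continuous_intros)
      (use s in auto)
  also have "\<dots> = integral {a..a + 1} (\<lambda>t. ((p t - x) \<bullet> density_defect t0 t) / ?s t)"
    by (rule Henstock_Kurzweil_Integration.integral_cong)
      (simp add: density_defect_def inner_diff_right diff_divide_distrib)
  also have "integral {a..a + 1} (\<lambda>t. q t * remainder t0 x t)
      + - c * - integral {a..a + 1} (\<lambda>t. ((p t - x) \<bullet> density_defect t0 t) / ?s t)
    = integral {a..a + 1} (\<lambda>t. q t * remainder t0 x t)
      + integral {a..a + 1} (\<lambda>t. c * (((p t - x) \<bullet> density_defect t0 t) / ?s t))"
    by (simp only: integral_mult_right mult_minus_left mult_minus_right minus_minus)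
  also have "\<dots> = integral {a..a + 1} (integrand t0 x)"
    unfolding integrand_def[abs_def] density_defect_def
    by (intro Henstock_Kurzweil_Integration.integral_add[symmetric] integrable_continuous_real continuous_intros integrand_continuity(1))
      (use s xp in auto)
  finally show ?thesis .
qed

text \<open>
  The Hoelder condition bounds the part from \<open>q'\<close>; the part from the turning of the tangent is
  Lipschitz, and \<open>\<bar>t - t0\<bar> \<le> \<bar>t - t0\<bar>\<^sup>\<alpha>\<close> as long as the parameter distance is at most \<open>1\<close>.
\<close>
lemma density_defect_bound:
  obtains E where "E \<ge> 0" "\<And>t. \<bar>t - t0\<bar> \<le> 1/2 \<Longrightarrow> norm (density_defect t0 t) \<le> E * \<bar>t - t0\<bar> powr \<alpha>"
proof -
  let ?k = "q' t0 / norm (p' t0)"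
  obtain M where M: "M > 0" "\<And>t. t \<in> {t0 - 1/2..t0 + 1/2} \<Longrightarrow> norm (p'' t) \<le> M"
    using continuous_on_Icc_bound[OF continuous_on_subset[OF p''_cont]] by (metis subset_UNIV)
  have lip: "norm (p' t - p' t0) \<le> M * \<bar>t - t0\<bar>" if "\<bar>t - t0\<bar> \<le> 1/2" for t
  proof -
    have tI: "t0 - 1/2 \<le> t" "t \<le> t0 + 1/2" using that by linarith+
    have "norm (p' t - p' t0) \<le> M * norm (t - t0)"
    proof (rule differentiable_bound[of "{t0 - 1/2..t0 + 1/2}" p' "\<lambda>t h. h *\<^sub>R p'' t"])
      fix u assume u: "u \<in> {t0 - 1/2..t0 + 1/2}"
      show "(p' has_derivative (\<lambda>h. h *\<^sub>R p'' u)) (at u within {t0 - 1/2..t0 + 1/2})"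
        using p'_deriv[of u] by (auto simp: has_vector_derivative_def intro: has_derivative_at_withinI)
      show "onorm (\<lambda>h. h *\<^sub>R p'' u) \<le> M"
        using mult_right_mono[OF M(2)[OF u] abs_ge_zero] by (intro onorm_le) (simp add: mult.commute)
    qed (use tI in auto)
    then show ?thesis by simp
  qed
  have B: "B \<ge> 0" using q'_holder[of 1 0] by simp
  show thesis
  proof (rule that[of "B + \<bar>?k\<bar> * M"])
    fix t assume t: "\<bar>t - t0\<bar> \<le> 1/2"
    have "density_defect t0 t = (q' t - q' t0) *\<^sub>R tangent t0 - ?k *\<^sub>R (p' t - p' t0)"
      using p'_nonzero[of t0] by (simp add: density_defect_def tangent_def algebra_simps diff_divide_distrib)
    then have "norm (density_defect t0 t) \<le> norm ((q' t - q' t0) *\<^sub>R tangent t0) + norm (?k *\<^sub>R (p' t - p' t0))"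
      by (metis norm_triangle_ineq4)
    also have "\<dots> \<le> B * \<bar>t - t0\<bar> powr \<alpha> + \<bar>?k\<bar> * (M * \<bar>t - t0\<bar> powr \<alpha>)"
    proof (rule add_mono)
      show "norm ((q' t - q' t0) *\<^sub>R tangent t0) \<le> B * \<bar>t - t0\<bar> powr \<alpha>"
        using q'_holder by (simp add: norm_tangent)
      have "\<bar>t - t0\<bar> \<le> \<bar>t - t0\<bar> powr \<alpha>"
      proof (cases "t = t0")
        case False
        then show ?thesis using powr_mono'[of \<alpha> 1 "\<bar>t - t0\<bar>"] \<alpha> t by simp
      qed simp
      then have "norm (p' t - p' t0) \<le> M * \<bar>t - t0\<bar> powr \<alpha>"
        using lip[OF t] M(1) by (meson mult_left_mono less_imp_le order_trans)
      then have "\<bar>?k\<bar> * norm (p' t - p' t0) \<le> \<bar>?k\<bar> * (M * \<bar>t - t0\<bar> powr \<alpha>)"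
        by (rule mult_left_mono) simp
      then show "norm (?k *\<^sub>R (p' t - p' t0)) \<le> \<bar>?k\<bar> * (M * \<bar>t - t0\<bar> powr \<alpha>)"
        by (simp only: norm_scaleR)
    qed
    finally show "norm (density_defect t0 t) \<le> (B + \<bar>?k\<bar> * M) * \<bar>t - t0\<bar> powr \<alpha>"
      by (simp add: algebra_simps)
  qed (use B M in auto)
qed

text \<open>
  In the first term of \<open>remainder\<close> the two inner products supply a factor \<open>\<bar>d\<bar>\<^sup>2 = s\<close>, which lifts the order
  \<open>-5/4\<close> in \<open>s\<close> to \<open>-1/4\<close>, that is, \<open>-1/2\<close> in \<open>\<bar>d\<bar>\<close>.
\<close>
lemma remainder_bound:
  obtains C where "C \<ge> 0" "\<And>x t. x \<noteq> p t \<Longrightarrow> norm (p t - x) \<le> R \<Longrightarrow>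
    \<bar>remainder t0 x t\<bar> \<le> C * norm (p' t) * norm (p t - x) powr (-1/2)"
proof -
  obtain C1 where C1: "\<And>s. s \<in> {0<..R\<^sup>2} \<Longrightarrow> \<bar>G1 s + c / (2 * s)\<bar> \<le> C1 * s powr (-1/4)"
    using G1_singularity unfolding order_at_0_def by blast
  obtain C2 where C2: "\<And>s. s \<in> {0<..R\<^sup>2} \<Longrightarrow> \<bar>G2 s - c / (2 * s\<^sup>2)\<bar> \<le> C2 * s powr (-5/4)"
    using G2_singularity unfolding order_at_0_def by blast
  show thesis
  proof (rule that[of "4 * \<bar>C2\<bar> + 2 * \<bar>C1\<bar>"])
    fix x t assume x: "x \<noteq> p t" "norm (p t - x) \<le> R"
    let ?d = "p t - x" let ?s = "?d \<bullet> ?d" let ?N = "normal_weight t" and ?n = "normal_at t0"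
    have d: "norm ?d > 0" using x(1) by simp
    have s: "?s = (norm ?d)\<^sup>2" by (simp add: power2_norm_eq_inner)
    have sR: "?s \<in> {0<..R\<^sup>2}" unfolding s using d x(2) by (auto intro: power_mono)
    have p1: "?s powr (-1/4) = norm ?d powr (-1/2)"
      unfolding s using d by (simp add: powr_powr flip: powr_numeral)
    have p2: "?s powr (-5/4) * (norm ?d)\<^sup>2 = norm ?d powr (-1/2)"
      unfolding s using d by (simp add: powr_powr flip: powr_numeral powr_add)
    have "\<bar>\<sigma>\<bar> = 1" using \<sigma>_square by (metis abs_mult_self_eq abs_one abs_square_eq_1 power2_eq_square)
    then have N: "norm ?N = norm (p' t)" by (simp add: normal_weight_def)
    have g2: "\<bar>G2 ?s - c / (2 * ?s\<^sup>2)\<bar> \<le> \<bar>C2\<bar> * ?s powr (-5/4)"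
      using C2[OF sR] by (rule order_trans) (intro mult_right_mono, auto)
    have g1: "\<bar>G1 ?s + c / (2 * ?s)\<bar> \<le> \<bar>C1\<bar> * ?s powr (-1/4)"
      using C1[OF sR] by (rule order_trans) (intro mult_right_mono, auto)
    have dN: "\<bar>?d \<bullet> ?N\<bar> \<le> norm ?d * norm (p' t)" using Cauchy_Schwarz_ineq2[of ?d ?N] N by simp
    have dn: "\<bar>?d \<bullet> ?n\<bar> \<le> norm ?d" using Cauchy_Schwarz_ineq2[of ?d ?n] by (simp add: norm_normal_at)
    have Nn: "\<bar>?N \<bullet> ?n\<bar> \<le> norm (p' t)" using Cauchy_Schwarz_ineq2[of ?N ?n] N by (simp add: norm_normal_at)
    have "\<bar>(G2 ?s - c / (2 * ?s\<^sup>2)) * (?d \<bullet> ?N) * (?d \<bullet> ?n)\<bar>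
        \<le> (\<bar>C2\<bar> * ?s powr (-5/4)) * (norm ?d * norm (p' t)) * norm ?d"
      unfolding abs_mult by (intro mult_mono g2 dN dn mult_nonneg_nonneg) auto
    also have "\<dots> = \<bar>C2\<bar> * norm (p' t) * (?s powr (-5/4) * (norm ?d)\<^sup>2)" by (simp add: power2_eq_square)
    finally have 1: "\<bar>(G2 ?s - c / (2 * ?s\<^sup>2)) * (?d \<bullet> ?N) * (?d \<bullet> ?n)\<bar> \<le> \<bar>C2\<bar> * norm (p' t) * norm ?d powr (-1/2)"
      unfolding p2 .
    have "\<bar>(G1 ?s + c / (2 * ?s)) * (?N \<bullet> ?n)\<bar> \<le> (\<bar>C1\<bar> * ?s powr (-1/4)) * norm (p' t)"
      unfolding abs_mult by (intro mult_mono g1 Nn) auto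
    then have 2: "\<bar>(G1 ?s + c / (2 * ?s)) * (?N \<bullet> ?n)\<bar> \<le> \<bar>C1\<bar> * norm (p' t) * norm ?d powr (-1/2)"
      unfolding p1 by (simp add: mult_ac)
    have "\<bar>- 4 * a * b * e - 2 * f * g\<bar> \<le> 4 * \<bar>a * b * e\<bar> + 2 * \<bar>f * g\<bar>" for a b e f g :: real
      using abs_triangle_ineq4[of "- 4 * a * b * e" "2 * f * g"] by (simp add: abs_mult)
    then have "\<bar>remainder t0 x t\<bar> \<le> 4 * \<bar>(G2 ?s - c / (2 * ?s\<^sup>2)) * (?d \<bullet> ?N) * (?d \<bullet> ?n)\<bar>
        + 2 * \<bar>(G1 ?s + c / (2 * ?s)) * (?N \<bullet> ?n)\<bar>"
      unfolding remainder_def .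
    also have "\<dots> \<le> 4 * (\<bar>C2\<bar> * norm (p' t) * norm ?d powr (-1/2)) + 2 * (\<bar>C1\<bar> * norm (p' t) * norm ?d powr (-1/2))"
      by (intro add_mono mult_left_mono 1 2) auto
    also have "\<dots> = (4 * \<bar>C2\<bar> + 2 * \<bar>C1\<bar>) * norm (p' t) * norm ?d powr (-1/2)"
      by (simp add: algebra_simps)
    finally show "\<bar>remainder t0 x t\<bar> \<le> (4 * \<bar>C2\<bar> + 2 * \<bar>C1\<bar>) * norm (p' t) * norm ?d powr (-1/2)" .
  qed simp
qed

text \<open>
  A majorant independent of \<open>h\<close>, obtained from \<open>chord_lower_bound\<close>. The parameter \<open>t0\<close> has to be
  excluded: there the majorant is \<open>0\<close>, because \<open>powr\<close> takes the value \<open>0\<close> at base \<open>0\<close>.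
\<close>
lemma integrand_bound:
  obtains h0 K where "h0 > 0" "\<And>h t. 0 \<le> h \<Longrightarrow> h \<le> h0 \<Longrightarrow> \<bar>t - t0\<bar> \<le> 1/2 \<Longrightarrow> t \<noteq> t0 \<Longrightarrow>
      p t0 - h *\<^sub>R normal_at t0 \<noteq> p t \<and>
      \<bar>integrand t0 (p t0 - h *\<^sub>R normal_at t0) t\<bar> \<le> K * (\<bar>t - t0\<bar> powr (-1/2) + \<bar>t - t0\<bar> powr (\<alpha> - 1))"
proof -
  obtain m h0 where m: "m > 0" and h0: "h0 > 0" and lower: "\<And>h t. 0 \<le> h \<Longrightarrow> h \<le> h0 \<Longrightarrow> \<bar>t - t0\<bar> \<le> 1/2
      \<Longrightarrow> norm (p t - (p t0 - h *\<^sub>R normal_at t0)) \<ge> m * \<bar>t - t0\<bar>"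
    using chord_lower_bound[OF normal_at_orthogonal norm_normal_at] by metis
  let ?I = "{t0 - 1/2..t0 + 1/2}"
  obtain P where P: "P > 0" "\<And>t. t \<in> ?I \<Longrightarrow> norm (p t - p t0) \<le> P"
    by (rule continuous_on_Icc_bound[of "t0 - 1/2" "t0 + 1/2" "\<lambda>t. p t - p t0"]) (auto intro!: continuous_intros)
  obtain P' where P': "P' > 0" "\<And>t. t \<in> ?I \<Longrightarrow> norm (p' t) \<le> P'"
    by (rule continuous_on_Icc_bound[of "t0 - 1/2" "t0 + 1/2" "\<lambda>t. p' t"]) (auto intro!: continuous_intros)
  obtain Q where Q: "Q > 0" "\<And>t. t \<in> ?I \<Longrightarrow> norm (q t) \<le> Q"
    by (rule continuous_on_Icc_bound[of "t0 - 1/2" "t0 + 1/2" "\<lambda>t. q t"]) (auto intro!: continuous_intros)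
  obtain E where E: "E \<ge> 0" "\<And>t. \<bar>t - t0\<bar> \<le> 1/2 \<Longrightarrow> norm (density_defect t0 t) \<le> E * \<bar>t - t0\<bar> powr \<alpha>"
    using density_defect_bound by metis
  obtain C where C: "C \<ge> 0" "\<And>x t. x \<noteq> p t \<Longrightarrow> norm (p t - x) \<le> P + h0 \<Longrightarrow>
    \<bar>remainder t0 x t\<bar> \<le> C * norm (p' t) * norm (p t - x) powr (-1/2)"
    using remainder_bound by metis
  \<comment> \<open>\<open>K1\<close> collects the constants of the remainder, \<open>K2\<close> those of the Cauchy-type term.\<close>
  define K1 where "K1 = Q * (C * P' * m powr (-1/2))"
  define K2 where "K2 = \<bar>c\<bar> * (E / m)"
  have K: "K1 \<ge> 0" "K2 \<ge> 0" using Q C P' E m by (auto simp: K1_def K2_def)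
  show thesis
  proof (rule that[OF h0, of "K1 + K2"])
    fix h t assume h: "0 \<le> h" "h \<le> h0" and t: "\<bar>t - t0\<bar> \<le> 1/2" "t \<noteq> t0"
    let ?x = "p t0 - h *\<^sub>R normal_at t0" and ?r = "\<bar>t - t0\<bar>"
    let ?d = "p t - ?x"
    have "t0 - 1/2 \<le> t" "t \<le> t0 + 1/2" using t(1) by linarith+
    then have tI: "t \<in> ?I" by simp
    have r: "?r > 0" using t by simp
    have d: "norm ?d \<ge> m * ?r" using lower h t by blast
    have d0: "norm ?d > 0" using d m r by (meson mult_pos_pos less_le_trans)
    then have xp: "?x \<noteq> p t" by auto
    have "norm ?d \<le> norm (p t - p t0) + norm (h *\<^sub>R normal_at t0)"
      using norm_triangle_ineq[of "p t - p t0" "h *\<^sub>R normal_at t0"] by (simp add: algebra_simps)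
    also have "\<dots> \<le> P + h0" using P(2)[OF tI] h by (simp add: norm_normal_at)
    finally have "\<bar>remainder t0 ?x t\<bar> \<le> C * norm (p' t) * norm ?d powr (-1/2)" by (rule C(2)[OF xp])
    also have "\<dots> \<le> C * P' * (m * ?r) powr (-1/2)"
      using C(1) P'(1) P'(2)[OF tI] d m r by (intro mult_mono powr_mono2') auto
    also have "\<dots> = C * P' * m powr (-1/2) * ?r powr (-1/2)" using m r by (simp add: powr_mult)
    finally have "\<bar>q t * remainder t0 ?x t\<bar> \<le> Q * (C * P' * m powr (-1/2) * ?r powr (-1/2))"
      unfolding abs_mult using Q(1) Q(2)[OF tI] by (intro mult_mono) auto
    then have 1: "\<bar>q t * remainder t0 ?x t\<bar> \<le> K1 * ?r powr (-1/2)" by (simp add: K1_def mult_ac)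
    have "\<bar>(?d \<bullet> density_defect t0 t) / (?d \<bullet> ?d)\<bar> \<le> norm ?d * norm (density_defect t0 t) / (norm ?d * norm ?d)"
      unfolding abs_divide by (intro frac_le Cauchy_Schwarz_ineq2) (use d0 in \<open>auto simp: norm_eq_sqrt_inner\<close>)
    also have "\<dots> = norm (density_defect t0 t) / norm ?d" using d0 by simp
    also have "\<dots> \<le> (E * ?r powr \<alpha>) / (m * ?r)"
      by (intro frac_le E(2) d t) (use E(1) m r in auto)
    also have "\<dots> = E / m * ?r powr (\<alpha> - 1)" using r by (simp add: powr_diff)
    finally have "\<bar>c * ((?d \<bullet> density_defect t0 t) / (?d \<bullet> ?d))\<bar> \<le> \<bar>c\<bar> * (E / m * ?r powr (\<alpha> - 1))"
      unfolding abs_mult by (rule mult_left_mono) simp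
    then have 2: "\<bar>c * ((?d \<bullet> density_defect t0 t) / (?d \<bullet> ?d))\<bar> \<le> K2 * ?r powr (\<alpha> - 1)"
      by (simp add: K2_def mult_ac)
    have "\<bar>integrand t0 ?x t\<bar> \<le> K1 * ?r powr (-1/2) + K2 * ?r powr (\<alpha> - 1)"
      unfolding integrand_def by (rule order_trans[OF abs_triangle_ineq add_mono[OF 1 2]])
    also have "\<dots> \<le> (K1 + K2) * ?r powr (-1/2) + (K1 + K2) * ?r powr (\<alpha> - 1)"
      using K by (intro add_mono mult_right_mono) auto
    finally show "?x \<noteq> p t \<and> \<bar>integrand t0 ?x t\<bar> \<le> (K1 + K2) * (?r powr (-1/2) + ?r powr (\<alpha> - 1))"
      using xp by (simp add: distrib_left)
  qed
qed

text \<open>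
  Dominated convergence. The limit is the integral of the regularized integrand at the boundary point itself,
  and the single parameter \<open>t0\<close> does not affect the integrals.
\<close>
lemma normal_derivative_limit:
  assumes off: "\<forall>\<^sub>F h in at_right 0. p t0 - h *\<^sub>R normal_at t0 \<notin> range p"
  shows "((\<lambda>h. pot_grad (p t0 - h *\<^sub>R normal_at t0) \<bullet> normal_at t0) \<longlongrightarrow>
      integral ({t0 - 1/2..t0 + 1/2} - {t0}) (integrand t0 (p t0))) (at_right 0)"
proof -
  let ?x = "\<lambda>h. p t0 - h *\<^sub>R normal_at t0" and ?S = "{t0 - 1/2..t0 + 1/2} - {t0}"
  obtain h0 K where h0: "h0 > 0" and bound: "\<And>h t. 0 \<le> h \<Longrightarrow> h \<le> h0 \<Longrightarrow> \<bar>t - t0\<bar> \<le> 1/2 \<Longrightarrow> t \<noteq> t0 \<Longrightarrow>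
      ?x h \<noteq> p t \<and> \<bar>integrand t0 (?x h) t\<bar> \<le> K * (\<bar>t - t0\<bar> powr (-1/2) + \<bar>t - t0\<bar> powr (\<alpha> - 1))"
    using integrand_bound by metis
  let ?D = "\<lambda>t. K * (\<bar>t - t0\<bar> powr (-1/2) + \<bar>t - t0\<bar> powr (\<alpha> - 1))"
  obtain h1 where h1: "h1 > 0" "\<And>h. 0 < h \<Longrightarrow> h < h1 \<Longrightarrow> ?x h \<notin> range p"
    using off unfolding eventually_at_right_field by blast
  have spike: "negligible {t0}" by simp
  have S: "\<bar>t - t0\<bar> \<le> 1/2" "t \<noteq> t0" if "t \<in> ?S" for t
  proof -
    from that have "t0 - 1/2 \<le> t" "t \<le> t0 + 1/2" "t \<noteq> t0" by auto
    then show "\<bar>t - t0\<bar> \<le> 1/2" "t \<noteq> t0" by linarith+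
  qed
  have intS: "f integrable_on ?S \<longleftrightarrow> f integrable_on {t0 - 1/2..t0 + 1/2}" for f :: "real \<Rightarrow> real"
    by (rule integrable_spike_set_eq) (auto intro: negligible_subset[OF spike])
  have eqS: "integral ?S f = integral {t0 - 1/2..t0 + 1/2} f" for f :: "real \<Rightarrow> real"
    by (rule integral_spike_set) (auto intro: negligible_subset[OF spike])
  have normal: "pot_grad (?x h) \<bullet> normal_at t0 = integral ?S (integrand t0 (?x h))" if "?x h \<notin> range p" for h
  proof -
    have "t0 - 1/2 + 1 = t0 + 1/2" by simp
    with normal_component_of_gradient[OF that, of t0 "t0 - 1/2"] show ?thesis by (simp only: eqS)
  qed
  show ?thesis
  proof (rule tendsto_at_right_sequentially[of 0 "min h0 h1"])
    fix H :: "nat \<Rightarrow> real"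
    assume H: "\<And>n. 0 < H n" "\<And>n. H n < min h0 h1" "H \<longlonglongrightarrow> 0"
    have off: "?x (H n) \<notin> range p" for n using h1(2)[of "H n"] H(1,2)[of n] by simp
    have "(\<lambda>n. integral ?S (integrand t0 (?x (H n)))) \<longlonglongrightarrow> integral ?S (integrand t0 (p t0))"
    proof (rule dominated_convergence(2))
      fix n
      have "continuous_on {t0 - 1/2..t0 + 1/2} (integrand t0 (?x (H n)))"
        using off[of n] by (intro integrand_continuity(2) continuous_intros) auto
      then show "integrand t0 (?x (H n)) integrable_on ?S"
        unfolding intS by (rule integrable_continuous_real)
    next
      show "?D integrable_on ?S"
        unfolding intS by (intro integrable_on_mult_right integrable_add integrable_abs_powr) (use \<alpha> in auto)
    next
      fix n t assume "t \<in> ?S"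
      then show "norm (integrand t0 (?x (H n)) t) \<le> ?D t"
        using bound[of "H n" t] S[of t] H(1,2)[of n] by simp
    next
      fix t assume t: "t \<in> ?S"
      have "continuous_on {0..h0} (\<lambda>h. integrand t0 (?x h) t)"
        by (intro integrand_continuity(2) continuous_intros)
          (use bound[OF _ _ S[OF t]] in auto)
      then have "(\<lambda>n. integrand t0 (?x (H n)) t) \<longlonglongrightarrow> integrand t0 (?x 0) t"
        by (rule continuous_on_tendsto_compose[OF _ H(3)])
          (use h0 H in \<open>auto intro!: always_eventually less_imp_le\<close>)
      then show "(\<lambda>n. integrand t0 (?x (H n)) t) \<longlonglongrightarrow> integrand t0 (p t0) t" by simp
    qed
    then show "(\<lambda>n. pot_grad (?x (H n)) \<bullet> normal_at t0) \<longlonglongrightarrow> integral ?S (integrand t0 (p t0))"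
      by (simp add: normal[OF off])
  qed (use h0 h1 in auto)
qed

end

section \<open>Double-layer potentials on the boundary curves\<close>

lemma Phi_dir_deriv:
  assumes \<gamma>: "\<gamma> > 0" and "x \<noteq> y"
  shows "dir_deriv v (Phi \<gamma> \<beta> n x) y = 2 * phi1 \<gamma> \<beta> n ((y - x) \<bullet> (y - x)) * ((y - x) \<bullet> v)"
proof -
  have s: "(y - x) \<bullet> (y - x) > 0" using assms by simp
  have D: "((\<lambda>y. (y - x) \<bullet> (y - x)) has_derivative (\<lambda>h. 2 * ((y - x) \<bullet> h))) (at y)"
    by (auto intro!: derivative_eq_intros simp: inner_commute)
  have "Phi \<gamma> \<beta> n x = (\<lambda>y. phi0 \<gamma> \<beta> n ((y - x) \<bullet> (y - x)))"
    by (simp add: fun_eq_iff Phi_eq_phi0[OF \<gamma>] norm_minus_commute power2_norm_eq_inner)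
  then have "(Phi \<gamma> \<beta> n x has_derivative (\<lambda>h. 2 * ((y - x) \<bullet> h) * phi1 \<gamma> \<beta> n ((y - x) \<bullet> (y - x)))) (at y)"
    using DERIV_compose_FDERIV[OF phi0_deriv[OF \<gamma> s] D] by simp
  from frechet_derivative_at[OF this] show ?thesis
    unfolding dir_deriv_def by (simp add: fun_eq_iff mult_ac)
qed

definition curve_layer ::
  "real \<Rightarrow> (nat \<Rightarrow> real) \<Rightarrow> (real^2 \<Rightarrow> real^2) \<Rightarrow> (real \<Rightarrow> real^2) \<Rightarrow> nat \<Rightarrow> (real^2 \<Rightarrow> real) \<Rightarrow> real^2 \<Rightarrow> real" where
  "curve_layer \<gamma> \<beta> \<nu> p n g x =
     integral {0..1} (\<lambda>t. g (p t) * dir_deriv (\<nu> (p t)) (Phi \<gamma> \<beta> n x) (p t) * norm (vector_derivative p (at t)))"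

lemma double_layer_eq: "double_layer \<gamma> \<beta> C \<nu> n g x = (\<Sum>p\<in>C. curve_layer \<gamma> \<beta> \<nu> p n g x)"
  by (simp add: double_layer_def arc_integral_def curve_layer_def)

text \<open>
  Differentiability of second order is expressed through explicit fields: \<open>G\<close> is the gradient of \<open>u\<close>, and
  \<open>H e\<close> the gradient of the component of \<open>G\<close> along \<open>e\<close>. The trace of the Hessian matrix is
  then \<open>\<Sum>b\<in>Basis. H b x \<bullet> b\<close>.
\<close>
definition gradient_hessian ::
  "(real^2) set \<Rightarrow> (real^2 \<Rightarrow> real) \<Rightarrow> (real^2 \<Rightarrow> real^2) \<Rightarrow> (real^2 \<Rightarrow> real^2 \<Rightarrow> real^2) \<Rightarrow> bool" where
  "gradient_hessian U u G H \<longleftrightarrow>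
     (\<forall>x\<in>U. (u has_derivative (\<lambda>h. G x \<bullet> h)) (at x)) \<and>
     (\<forall>e. \<forall>x\<in>U. ((\<lambda>x. G x \<bullet> e) has_derivative (\<lambda>h. H e x \<bullet> h)) (at x)) \<and>
     (\<forall>e. continuous_on U (H e))"

text \<open>
  The application of the abstract layer potential to the profiles \<open>phi1\<close>, \<open>phi2\<close>, \<open>phi3\<close>. The coupling in the
  Laplacian comes from \<open>phi3_ode\<close>, and involves the potentials of lower index with the same density.
\<close>
lemma curve_layer_fields:
  assumes \<gamma>: "\<gamma> > 0" and curve: "closed_curve p (\<lambda>t. vector_derivative p (at t)) p''"
    and \<sigma>: "\<sigma> = 1 \<or> \<sigma> = - 1"
    and \<nu>: "\<And>t. norm (vector_derivative p (at t)) *\<^sub>R \<nu> (p t) = \<sigma> *\<^sub>R rot (vector_derivative p (at t))"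
    and g: "\<And>t. ((\<lambda>s. g (p s)) has_real_derivative g' t) (at t)" "\<And>s t. \<bar>g' s - g' t\<bar> \<le> B * \<bar>s - t\<bar> powr \<alpha>"
    and \<alpha>: "0 < \<alpha>" "\<alpha> < 1"
  shows "\<exists>Gr Hs. gradient_hessian (- range p) (curve_layer \<gamma> \<beta> \<nu> p n g) Gr Hs
    \<and> (\<forall>x. x \<notin> range p \<longrightarrow> (\<Sum>b\<in>Basis. Hs b x \<bullet> b) = \<gamma>\<^sup>2 * curve_layer \<gamma> \<beta> \<nu> p n g x
          + (\<Sum>m<n. \<beta> (n - m) * curve_layer \<gamma> \<beta> \<nu> p m g x))
    \<and> (\<forall>t0. (\<forall>\<^sub>F h in at_right 0. p t0 - h *\<^sub>R \<nu> (p t0) \<notin> range p) \<longrightarrow>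
          (\<exists>l. ((\<lambda>h. Gr (p t0 - h *\<^sub>R \<nu> (p t0)) \<bullet> \<nu> (p t0)) \<longlongrightarrow> l) (at_right 0)))"
proof -
  obtain c where c: "\<And>n R. order_at_0 R (-1/4) (\<lambda>s. phi1 \<gamma> \<beta> n s + c / (2 * s))"
    "\<And>n R. order_at_0 R (-5/4) (\<lambda>s. phi2 \<gamma> \<beta> n s - c / (2 * s\<^sup>2))"
    using phi_singularity[OF \<gamma>] by blast
  interpret C: closed_curve p "\<lambda>t. vector_derivative p (at t)" p'' by (rule curve)
  have gc: "continuous_on UNIV (\<lambda>t. g (p t))"
    by (rule DERIV_continuous_on[where D = g']) (auto intro: has_field_derivative_at_within g)
  interpret L: smooth_layer "phi1 \<gamma> \<beta> k" "phi2 \<gamma> \<beta> k" "phi3 \<gamma> \<beta> k" p "\<lambda>t. vector_derivative p (at t)" p''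
     "\<lambda>t. g (p t)" \<sigma> g' \<alpha> B c for k
    by unfold_locales
      (use \<gamma> \<sigma> g \<alpha> c gc in \<open>auto simp: C.p_periodic intro: phi1_deriv phi2_deriv phi3_continuous\<close>)
  \<comment> \<open>The arc length factor turns the unit normal into the rotated derivative of the parametrization.\<close>
  have weight: "norm (vector_derivative p (at t)) * (d \<bullet> \<nu> (p t)) = d \<bullet> L.normal_weight t" for d t
    by (simp only: L.normal_weight_def flip: \<nu> inner_scaleR_right)
  have pot: "curve_layer \<gamma> \<beta> \<nu> p n g x = L.pot n x" if "x \<notin> range p" for n x
    unfolding curve_layer_def L.pot_def
  proof (rule Henstock_Kurzweil_Integration.integral_cong)
    fix t
    have "x \<noteq> p t" using that by auto
    then show "g (p t) * dir_deriv (\<nu> (p t)) (Phi \<gamma> \<beta> n x) (p t) * norm (vector_derivative p (at t))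
       = g (p t) * dl_kernel (phi1 \<gamma> \<beta> n) (p t) (L.normal_weight t) x"
      by (simp add: Phi_dir_deriv[OF \<gamma>] dl_kernel_def mult_ac flip: weight)
  qed
  have int: "(\<lambda>t. g (p t) * dl_kernel (phi1 \<gamma> \<beta> n) (p t) (L.normal_weight t) x) integrable_on {0..1}"
    if "x \<notin> range p" for n x
    using that by (intro integrable_continuous_real L.kernel_continuity(1) continuous_intros) auto
  have normal_at: "L.normal_at t = \<nu> (p t)" for t
  proof -
    have "L.normal_at t = (1 / norm (vector_derivative p (at t))) *\<^sub>R (\<sigma> *\<^sub>R rot (vector_derivative p (at t)))"
      by (simp add: L.normal_at_def L.tangent_def rot_scaleR)
    then show ?thesis using C.p'_nonzero[of t] by (simp flip: \<nu>)
  qed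
  have A: "gradient_hessian (- range p) (curve_layer \<gamma> \<beta> \<nu> p n g) (L.pot_grad n) (L.pot_hess n)"
    unfolding gradient_hessian_def
  proof (intro conjI allI ballI)
    fix x assume "x \<in> - range p"
    then have x: "x \<notin> range p" by simp
    show "(curve_layer \<gamma> \<beta> \<nu> p n g has_derivative (\<lambda>h. L.pot_grad n x \<bullet> h)) (at x)"
      by (rule has_derivative_transform_within_open[OF L.pot_deriv[OF x] C.open_complement_p])
        (use x pot in auto)
    show "((\<lambda>x. L.pot_grad n x \<bullet> e) has_derivative (\<lambda>h. L.pot_hess n e x \<bullet> h)) (at x)" for e
      by (rule L.pot_grad_deriv[OF x])
  next
    fix e
    show "continuous_on (- range p) (L.pot_hess n e)" by (rule L.pot_hess_cont)
  qed
  have B: "(\<Sum>b\<in>Basis. L.pot_hess n b x \<bullet> b) = \<gamma>\<^sup>2 * curve_layer \<gamma> \<beta> \<nu> p n g x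
          + (\<Sum>m<n. \<beta> (n - m) * curve_layer \<gamma> \<beta> \<nu> p m g x)" if x: "x \<notin> range p" for x
  proof -
    let ?s = "\<lambda>t. (p t - x) \<bullet> (p t - x)" and ?k = "\<lambda>m t. g (p t) * dl_kernel (phi1 \<gamma> \<beta> m) (p t) (L.normal_weight t) x"
    have "(\<Sum>b\<in>Basis. L.pot_hess n b x \<bullet> b) = integral {0..1} (\<lambda>t. \<gamma>\<^sup>2 * ?k n t + (\<Sum>m<n. \<beta> (n - m) * ?k m t))"
      unfolding L.pot_laplacian[OF x]
    proof (rule Henstock_Kurzweil_Integration.integral_cong)
      fix t
      have "x \<noteq> p t" using x by auto
      then have s: "?s t > 0" by simp
      have "8 * ?s t * phi3 \<gamma> \<beta> n (?s t) + 16 * phi2 \<gamma> \<beta> n (?s t)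
        = 2 * (\<gamma>\<^sup>2 * phi1 \<gamma> \<beta> n (?s t) + (\<Sum>m<n. \<beta> (n - m) * phi1 \<gamma> \<beta> m (?s t)))"
        using phi3_ode[OF s, of \<gamma> \<beta> n] by simp
      then show "g (p t) * ((p t - x) \<bullet> L.normal_weight t *
          (8 * ?s t * phi3 \<gamma> \<beta> n (?s t) + 16 * phi2 \<gamma> \<beta> n (?s t)))
        = \<gamma>\<^sup>2 * ?k n t + (\<Sum>m<n. \<beta> (n - m) * ?k m t)"
        by (simp add: dl_kernel_def distrib_left sum_distrib_left mult_ac)
    qed
    also have "\<dots> = \<gamma>\<^sup>2 * integral {0..1} (?k n) + (\<Sum>m<n. \<beta> (n - m) * integral {0..1} (?k m))"
      by (intro integral_unique has_integral_add has_integral_mult_right has_integral_sum integrable_integral int x) auto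
    finally show ?thesis unfolding pot[OF x] L.pot_def .
  qed
  have D: "\<exists>l. ((\<lambda>h. L.pot_grad n (p t0 - h *\<^sub>R \<nu> (p t0)) \<bullet> \<nu> (p t0)) \<longlongrightarrow> l) (at_right 0)"
    if "\<forall>\<^sub>F h in at_right 0. p t0 - h *\<^sub>R \<nu> (p t0) \<notin> range p" for t0
    using that L.normal_derivative_limit[of t0 n] unfolding normal_at by blast
  show ?thesis
    by (rule exI[of _ "L.pot_grad n"], rule exI[of _ "L.pot_hess n"]) (intro conjI allI impI A B D)
qed

text \<open>
  At a boundary point, only the curve through that point is singular; the gradients of the other
  contributions are continuous there.
\<close>
lemma double_layer_fields:
  assumes domain: "C3_domain \<Omega> C" and normal: "outward_unit_normal \<Omega> C \<nu>"
    and \<gamma>: "\<gamma> > 0" and \<alpha>: "0 < \<alpha>" "\<alpha> < 1" and g: "C1_alpha \<alpha> C g"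
  shows "\<exists>Gr Hs. gradient_hessian \<Omega> (double_layer \<gamma> \<beta> C \<nu> n g) Gr Hs
    \<and> (\<forall>x\<in>\<Omega>. (\<Sum>b\<in>Basis. Hs b x \<bullet> b) = \<gamma>\<^sup>2 * double_layer \<gamma> \<beta> C \<nu> n g x
          + (\<Sum>m<n. \<beta> (n - m) * double_layer \<gamma> \<beta> C \<nu> m g x))
    \<and> (\<forall>x\<in>frontier \<Omega>. \<exists>l. ((\<lambda>h. Gr (x - h *\<^sub>R \<nu> x) \<bullet> \<nu> x) \<longlongrightarrow> l) (at_right 0))"
proof -
  note dom = domain[unfolded C3_domain_def]
  have op: "open \<Omega>" and fin: "finite C" and fr: "frontier \<Omega> = (\<Union>p\<in>C. range p)" using dom by auto
  have disj: "range p \<inter> range p' = {}" if "p \<in> C" "p' \<in> C" "p \<noteq> p'" for p p'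
    using dom that unfolding pairwise_def disjnt_def by blast
  have \<Omega>: "x \<notin> range p" if "x \<in> \<Omega>" "p \<in> C" for x p
    using op that fr by (auto simp: frontier_def interior_open)
  have outward: "\<forall>\<^sub>F h in at_right 0. x - h *\<^sub>R \<nu> x \<in> \<Omega> \<and> x + h *\<^sub>R \<nu> x \<notin> closure \<Omega>" if "x \<in> frontier \<Omega>" for x
    using normal that unfolding outward_unit_normal_def by blast
  have "\<exists>p''. closed_curve p (\<lambda>t. vector_derivative p (at t)) p''" if "p \<in> C" for p
    using dom that closed_curve_of_C3 by blast
  then obtain p'' where curve: "\<And>p. p \<in> C \<Longrightarrow> closed_curve p (\<lambda>t. vector_derivative p (at t)) (p'' p)" by metis
  define good where "good p Gr Hs \<longleftrightarrow> gradient_hessian (- range p) (curve_layer \<gamma> \<beta> \<nu> p n g) Gr Hs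
    \<and> (\<forall>x. x \<notin> range p \<longrightarrow> (\<Sum>b\<in>Basis. Hs b x \<bullet> b) = \<gamma>\<^sup>2 * curve_layer \<gamma> \<beta> \<nu> p n g x
          + (\<Sum>m<n. \<beta> (n - m) * curve_layer \<gamma> \<beta> \<nu> p m g x))
    \<and> (\<forall>t0. (\<forall>\<^sub>F h in at_right 0. p t0 - h *\<^sub>R \<nu> (p t0) \<notin> range p) \<longrightarrow>
          (\<exists>l. ((\<lambda>h. Gr (p t0 - h *\<^sub>R \<nu> (p t0)) \<bullet> \<nu> (p t0)) \<longlongrightarrow> l) (at_right 0)))" for p Gr Hs
  have "\<exists>Gr Hs. good p Gr Hs" if p: "p \<in> C" for p
  proof -
    interpret closed_curve p "\<lambda>t. vector_derivative p (at t)" "p'' p" by (rule curve[OF p])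
    let ?F = "\<Union>p'\<in>C - {p}. range p'"
    have "compact (range p')" if "p' \<in> C" for p'
      by (rule closed_curve.compact_range_p[OF curve[OF that]])
    then have F2: "closed ?F" using fin by (intro closed_UN) (auto intro: compact_imp_closed)
    have F1: "frontier \<Omega> = range p \<union> ?F" using fr p by blast
    have F3: "range p \<inter> ?F = {}" using disj[OF p] by blast
    have N: "norm (\<nu> (p t)) = 1" "\<nu> (p t) \<bullet> vector_derivative p (at t) = 0" for t
      using normal p unfolding outward_unit_normal_def by auto
    have O: "\<forall>\<^sub>F h in at_right 0. p t - h *\<^sub>R \<nu> (p t) \<in> \<Omega> \<and> p t + h *\<^sub>R \<nu> (p t) \<notin> closure \<Omega>" for t
      by (rule outward) (use fr p in blast)
    obtain \<sigma> where "\<sigma> = 1 \<or> \<sigma> = -1"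
      "\<And>t. norm (vector_derivative p (at t)) *\<^sub>R \<nu> (p t) = \<sigma> *\<^sub>R rot (vector_derivative p (at t))"
      by (rule outward_normal_sign[OF N O F1 F2 F3]) blast
    moreover obtain g' B where "\<And>t. ((\<lambda>s. g (p s)) has_real_derivative g' t) (at t)"
      "\<And>s t. \<bar>g' s - g' t\<bar> \<le> B * \<bar>s - t\<bar> powr \<alpha>"
      using g p unfolding C1_alpha_def by blast
    ultimately show ?thesis
      unfolding good_def using \<alpha> by (intro curve_layer_fields[OF \<gamma> curve[OF p]])
  qed
  then obtain Gr Hs where good: "\<And>p. p \<in> C \<Longrightarrow> good p (Gr p) (Hs p)" by metis
  note good = good[unfolded good_def gradient_hessian_def]
  have d1: "(curve_layer \<gamma> \<beta> \<nu> p n g has_derivative (\<lambda>h. Gr p x \<bullet> h)) (at x)"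
    and d2: "((\<lambda>x. Gr p x \<bullet> e) has_derivative (\<lambda>h. Hs p e x \<bullet> h)) (at x)"
    and pde: "(\<Sum>b\<in>Basis. Hs p b x \<bullet> b) = \<gamma>\<^sup>2 * curve_layer \<gamma> \<beta> \<nu> p n g x
          + (\<Sum>m<n. \<beta> (n - m) * curve_layer \<gamma> \<beta> \<nu> p m g x)" if "p \<in> C" "x \<notin> range p" for p x e
    using good[OF that(1)] that(2) by simp_all
  have c2: "continuous_on (- range p) (Hs p e)"
    and lim: "(\<forall>\<^sub>F h in at_right 0. p t0 - h *\<^sub>R \<nu> (p t0) \<notin> range p) \<Longrightarrow>
          \<exists>l. ((\<lambda>h. Gr p (p t0 - h *\<^sub>R \<nu> (p t0)) \<bullet> \<nu> (p t0)) \<longlongrightarrow> l) (at_right 0)" if "p \<in> C" for p e t0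
    using good[OF that] by blast+
  show ?thesis
  proof (intro exI[of _ "\<lambda>x. \<Sum>p\<in>C. Gr p x"] exI[of _ "\<lambda>e x. \<Sum>p\<in>C. Hs p e x"] conjI allI ballI;
      (unfold gradient_hessian_def, intro conjI allI ballI)?)
    fix x assume x: "x \<in> \<Omega>"
    have "double_layer \<gamma> \<beta> C \<nu> n g = (\<lambda>x. \<Sum>p\<in>C. curve_layer \<gamma> \<beta> \<nu> p n g x)"
      by (simp add: fun_eq_iff double_layer_eq)
    moreover have "((\<lambda>x. \<Sum>p\<in>C. curve_layer \<gamma> \<beta> \<nu> p n g x) has_derivative (\<lambda>h. \<Sum>p\<in>C. Gr p x \<bullet> h)) (at x)"
      by (intro has_derivative_sum d1 \<Omega> x)
    ultimately show "(double_layer \<gamma> \<beta> C \<nu> n g has_derivative (\<lambda>h. (\<Sum>p\<in>C. Gr p x) \<bullet> h)) (at x)"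
      by (simp only: inner_sum_left)
    show "((\<lambda>x. (\<Sum>p\<in>C. Gr p x) \<bullet> e) has_derivative (\<lambda>h. (\<Sum>p\<in>C. Hs p e x) \<bullet> h)) (at x)" for e
      unfolding inner_sum_left by (intro has_derivative_sum d2 \<Omega> x)
    have "(\<Sum>b\<in>Basis. (\<Sum>p\<in>C. Hs p b x) \<bullet> b) = (\<Sum>p\<in>C. \<Sum>b\<in>Basis. Hs p b x \<bullet> b)"
      unfolding inner_sum_left by (rule sum.swap)
    also have "\<dots> = (\<Sum>p\<in>C. \<gamma>\<^sup>2 * curve_layer \<gamma> \<beta> \<nu> p n g x + (\<Sum>m<n. \<beta> (n - m) * curve_layer \<gamma> \<beta> \<nu> p m g x))"
      by (intro sum.cong refl pde \<Omega> x)
    also have "\<dots> = \<gamma>\<^sup>2 * double_layer \<gamma> \<beta> C \<nu> n g x + (\<Sum>m<n. \<beta> (n - m) * double_layer \<gamma> \<beta> C \<nu> m g x)"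
      unfolding double_layer_eq sum.distrib sum_distrib_left
      by (subst sum.swap[of _ "{..<n}" C]) (rule refl)
    finally show "(\<Sum>b\<in>Basis. (\<Sum>p\<in>C. Hs p b x) \<bullet> b) = \<gamma>\<^sup>2 * double_layer \<gamma> \<beta> C \<nu> n g x
        + (\<Sum>m<n. \<beta> (n - m) * double_layer \<gamma> \<beta> C \<nu> m g x)" .
  next
    fix e
    show "continuous_on \<Omega> (\<lambda>x. \<Sum>p\<in>C. Hs p e x)"
      by (intro continuous_on_sum continuous_on_subset[OF c2]) (use \<Omega> in auto)
  next
    fix x assume x: "x \<in> frontier \<Omega>"
    have inside: "\<forall>\<^sub>F h in at_right 0. x - h *\<^sub>R \<nu> x \<in> \<Omega>"
      using outward[OF x] by eventually_elim auto
    have "\<exists>l. ((\<lambda>h. Gr p (x - h *\<^sub>R \<nu> x) \<bullet> \<nu> x) \<longlongrightarrow> l) (at_right 0)" if p: "p \<in> C" for p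
    proof (cases "x \<in> range p")
      case True
      then obtain t0 where t0: "x = p t0" by auto
      have "\<forall>\<^sub>F h in at_right 0. p t0 - h *\<^sub>R \<nu> (p t0) \<notin> range p"
        using inside unfolding t0 by eventually_elim (rule \<Omega>[OF _ p])
      from lim[OF p this] show ?thesis unfolding t0 .
    next
      case False
      have "isCont (\<lambda>y. Gr p y \<bullet> \<nu> x) x"
        by (rule has_derivative_continuous[OF d2[OF p False]])
      moreover have "((\<lambda>h. x - h *\<^sub>R \<nu> x) \<longlongrightarrow> x) (at_right 0)"
        by (auto intro!: tendsto_eq_intros)
      ultimately have "((\<lambda>h. Gr p (x - h *\<^sub>R \<nu> x) \<bullet> \<nu> x) \<longlongrightarrow> Gr p x \<bullet> \<nu> x) (at_right 0)"
        by (rule isCont_tendsto_compose)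
      then show ?thesis by blast
    qed
    then obtain l where "\<And>p. p \<in> C \<Longrightarrow> ((\<lambda>h. Gr p (x - h *\<^sub>R \<nu> x) \<bullet> \<nu> x) \<longlongrightarrow> l p) (at_right 0)" by metis
    then have "((\<lambda>h. \<Sum>p\<in>C. Gr p (x - h *\<^sub>R \<nu> x) \<bullet> \<nu> x) \<longlongrightarrow> (\<Sum>p\<in>C. l p)) (at_right 0)"
      by (rule tendsto_sum)
    then show "\<exists>l. ((\<lambda>h. (\<Sum>p\<in>C. Gr p (x - h *\<^sub>R \<nu> x)) \<bullet> \<nu> x) \<longlongrightarrow> l) (at_right 0)"
      unfolding inner_sum_left by blast
  qed
qed

section \<open>The boundary value problems\<close>

lemma dir_deriv_eq: "(u has_derivative (\<lambda>h. G \<bullet> h)) (at x) \<Longrightarrow> dir_deriv v u x = G \<bullet> v"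
  unfolding dir_deriv_def by (drule frechet_derivative_at) (simp add: fun_eq_iff)

lemma C2_on_of_fields:
  assumes op: "open U" and fields: "gradient_hessian U u G H"
  shows "C2_on U u" "\<And>x. x \<in> U \<Longrightarrow> laplacian u x = (\<Sum>b\<in>Basis. H b x \<bullet> b)"
proof -
  have d1: "\<And>x. x \<in> U \<Longrightarrow> (u has_derivative (\<lambda>h. G x \<bullet> h)) (at x)"
    and d2: "\<And>x e. x \<in> U \<Longrightarrow> ((\<lambda>x. G x \<bullet> e) has_derivative (\<lambda>h. H e x \<bullet> h)) (at x)"
    and c: "\<And>e. continuous_on U (H e)"
    using fields unfolding gradient_hessian_def by blast+
  have D1: "dir_deriv v u x = G x \<bullet> v" if "x \<in> U" for x v
    by (rule dir_deriv_eq[OF d1[OF that]])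
  have D2: "(dir_deriv e u has_derivative (\<lambda>h. H e x \<bullet> h)) (at x)" if "x \<in> U" for x e
    by (rule has_derivative_transform_within_open[OF d2[OF that] op that]) (simp add: D1)
  have D3: "dir_deriv v (dir_deriv e u) x = H e x \<bullet> v" if "x \<in> U" for x v e
    by (rule dir_deriv_eq[OF D2[OF that]])
  show "C2_on U u"
    unfolding C2_on_def
  proof (intro conjI ballI)
    show "u differentiable_on U" "dir_deriv b u differentiable_on U" for b
      using d1 D2 op by (auto simp: differentiable_on_eq_differentiable_at differentiable_def)
    show "continuous_on U (dir_deriv b' (dir_deriv b u))" for b b'
    proof -
      have "continuous_on U (\<lambda>x. H b x \<bullet> b')" by (intro continuous_intros c)
      then show ?thesis by (rule continuous_on_eq) (simp add: D3)
    qed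
  qed
  show "laplacian u x = (\<Sum>b\<in>Basis. H b x \<bullet> b)" if "x \<in> U" for x
    unfolding laplacian_def by (simp add: D3[OF that])
qed

text \<open>
  Existence of the limit is what gives the definite description in \<open>normal_derivative\<close> its meaning.
\<close>
lemma has_normal_derivative_unique:
  assumes "has_normal_derivative \<nu> u x l"
  shows "normal_derivative \<nu> u x = l"
  unfolding normal_derivative_def
proof (rule the_equality, rule assms)
  fix l' assume "has_normal_derivative \<nu> u x l'"
  then show "l' = l"
    using assms tendsto_unique[OF trivial_limit_at_right_real] unfolding has_normal_derivative_def by blast
qed

text \<open>
  Both sides sum over the same pairs, with \<open>i = m + j\<close>: the right-hand sides of the equations for the
  single potentials add up to the convolution of \<open>\<beta>\<close> with the sequence of sums.
\<close>
lemma sum_convolution_reindex: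
  fixes F :: "nat \<Rightarrow> nat \<Rightarrow> real"
  shows "(\<Sum>m\<le>n. \<Sum>j<n - m. b (n - m - j) * F j m) = (\<Sum>i<n. \<Sum>m\<le>i. b (n - i) * F (i - m) m)"
proof -
  have "(\<Sum>m\<le>n. \<Sum>j<n - m. b (n - m - j) * F j m)
      = (\<Sum>(m, j)\<in>(SIGMA m:{..n}. {..<n - m}). b (n - m - j) * F j m)"
    by (simp add: sum.Sigma)
  also have "\<dots> = (\<Sum>(i, m)\<in>(SIGMA i:{..<n}. {..i}). b (n - i) * F (i - m) m)"
    by (rule sum.reindex_bij_witness[where i = "\<lambda>(i, m). (m, i - m)" and j = "\<lambda>(m, j). (m + j, m)"]) auto
  also have "\<dots> = (\<Sum>i<n. \<Sum>m\<le>i. b (n - i) * F (i - m) m)" by (simp add: sum.Sigma)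
  finally show ?thesis .
qed

theorem theorem2p4:
  fixes \<Omega> :: "(real^2) set" and C :: "(real \<Rightarrow> real^2) set" and \<nu> :: "real^2 \<Rightarrow> real^2"
    and \<kappa> c \<gamma> \<alpha> :: real and \<beta> :: "nat \<Rightarrow> real"
    and f :: "real^2 \<Rightarrow> real \<Rightarrow> real"
    and f_coeff q u :: "nat \<Rightarrow> real^2 \<Rightarrow> real"
  assumes domain: "C3_domain \<Omega> C"
    and normal: "outward_unit_normal \<Omega> C \<nu>"
    and "\<kappa> > 0" and "c > 0"
    and beta: "\<And>n. \<beta> n = \<kappa>\<^sup>2 / c\<^sup>2 * (real n + 1)"
    and gamma: "\<gamma> = \<kappa> / c"
    and f_coeff: "\<And>n x. x \<in> frontier \<Omega> \<Longrightarrow>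
      ((\<lambda>t. exp (- \<kappa> * t) * laguerre n (\<kappa> * t) * f x t) has_integral f_coeff n x) {0..}"
    and "0 < \<alpha>" and "\<alpha> < 1"
    and q: "\<And>n. C1_alpha \<alpha> C (q n)"
    and integral_eqs: "\<And>n x. x \<in> frontier \<Omega> \<Longrightarrow>
      op_T \<gamma> \<beta> C \<nu> 0 (q n) x =
        f_coeff n x - (\<Sum>m<n. op_T \<gamma> \<beta> C \<nu> (n - m) (q m) x)"
    and u: "\<And>n x. x \<in> \<Omega> \<Longrightarrow>
      u n x = 1 / pi * (\<Sum>m\<le>n. double_layer \<gamma> \<beta> C \<nu> (n - m) (q m) x)"
  shows "\<forall>n. C2_on \<Omega> (u n) \<and>
    (\<forall>x\<in>\<Omega>. laplacian (u n) x - \<gamma>\<^sup>2 * u n x = (\<Sum>m<n. \<beta> (n - m) * u m x)) \<and>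
    (\<forall>x\<in>frontier \<Omega>. has_normal_derivative \<nu> (u n) x (f_coeff n x))"
proof -
  have \<gamma>: "\<gamma> > 0" using \<open>\<kappa> > 0\<close> \<open>c > 0\<close> gamma by simp
  have op: "open \<Omega>" using domain unfolding C3_domain_def by blast
  let ?D = "\<lambda>k m. double_layer \<gamma> \<beta> C \<nu> k (q m)"
  have "\<forall>k m. \<exists>Gr Hs. gradient_hessian \<Omega> (?D k m) Gr Hs
    \<and> (\<forall>x\<in>\<Omega>. (\<Sum>b\<in>Basis. Hs b x \<bullet> b) = \<gamma>\<^sup>2 * ?D k m x + (\<Sum>j<k. \<beta> (k - j) * ?D j m x))
    \<and> (\<forall>x\<in>frontier \<Omega>. \<exists>l. ((\<lambda>h. Gr (x - h *\<^sub>R \<nu> x) \<bullet> \<nu> x) \<longlongrightarrow> l) (at_right 0))"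
    using double_layer_fields[OF domain normal \<gamma> \<open>0 < \<alpha>\<close> \<open>\<alpha> < 1\<close> q] by blast
  then obtain Gr Hs where
    fields: "\<And>k m. gradient_hessian \<Omega> (?D k m) (Gr k m) (Hs k m)"
    and pde: "\<And>k m x. x \<in> \<Omega> \<Longrightarrow> (\<Sum>b\<in>Basis. Hs k m b x \<bullet> b) = \<gamma>\<^sup>2 * ?D k m x + (\<Sum>j<k. \<beta> (k - j) * ?D j m x)"
    and lim: "\<And>k m x. x \<in> frontier \<Omega> \<Longrightarrow> \<exists>l. ((\<lambda>h. Gr k m (x - h *\<^sub>R \<nu> x) \<bullet> \<nu> x) \<longlongrightarrow> l) (at_right 0)"
    unfolding choice_iff by blast
  have d1: "\<And>k m x. x \<in> \<Omega> \<Longrightarrow> (?D k m has_derivative (\<lambda>h. Gr k m x \<bullet> h)) (at x)"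
    and d2: "\<And>k m x e. x \<in> \<Omega> \<Longrightarrow> ((\<lambda>x. Gr k m x \<bullet> e) has_derivative (\<lambda>h. Hs k m e x \<bullet> h)) (at x)"
    and c2: "\<And>k m e. continuous_on \<Omega> (Hs k m e)"
    using fields unfolding gradient_hessian_def by blast+
  have inside: "\<forall>\<^sub>F h in at_right 0. x - h *\<^sub>R \<nu> x \<in> \<Omega>" if "x \<in> frontier \<Omega>" for x
    using normal that unfolding outward_unit_normal_def by (auto elim: eventually_mono)
  have T: "((\<lambda>h. Gr k m (x - h *\<^sub>R \<nu> x) \<bullet> \<nu> x) \<longlongrightarrow> pi * op_T \<gamma> \<beta> C \<nu> k (q m) x) (at_right 0)"
    if x: "x \<in> frontier \<Omega>" for k m x
  proof -
    obtain l where l: "((\<lambda>h. Gr k m (x - h *\<^sub>R \<nu> x) \<bullet> \<nu> x) \<longlongrightarrow> l) (at_right 0)" using lim[OF x] by blast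
    have "\<forall>\<^sub>F h in at_right 0. Gr k m (x - h *\<^sub>R \<nu> x) \<bullet> \<nu> x = dir_deriv (\<nu> x) (?D k m) (x - h *\<^sub>R \<nu> x)"
      using inside[OF x] by eventually_elim (rule dir_deriv_eq[OF d1, symmetric])
    from Lim_transform_eventually[OF l this]
    have "has_normal_derivative \<nu> (?D k m) x l" unfolding has_normal_derivative_def .
    then have "pi * op_T \<gamma> \<beta> C \<nu> k (q m) x = l" by (simp add: op_T_def has_normal_derivative_unique)
    with l show ?thesis by simp
  qed
  define G where "G n x = (\<Sum>m\<le>n. (1 / pi) *\<^sub>R Gr (n - m) m x)" for n x
  define H where "H n e x = (\<Sum>m\<le>n. (1 / pi) *\<^sub>R Hs (n - m) m e x)" for n e x
  have u1: "(u n has_derivative (\<lambda>h. G n x \<bullet> h)) (at x)" if x: "x \<in> \<Omega>" for n x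
  proof (rule has_derivative_transform_within_open[OF _ op x])
    have "((\<lambda>x. \<Sum>m\<le>n. 1 / pi * ?D (n - m) m x) has_derivative (\<lambda>h. \<Sum>m\<le>n. 1 / pi * (Gr (n - m) m x \<bullet> h))) (at x)"
      by (intro has_derivative_sum has_derivative_mult_right d1 x)
    then show "((\<lambda>x. \<Sum>m\<le>n. 1 / pi * ?D (n - m) m x) has_derivative (\<lambda>h. G n x \<bullet> h)) (at x)"
      by (simp add: G_def inner_sum_left)
  qed (simp add: u sum_distrib_left)
  have u2: "((\<lambda>x. G n x \<bullet> e) has_derivative (\<lambda>h. H n e x \<bullet> h)) (at x)" if x: "x \<in> \<Omega>" for n e x
    unfolding G_def H_def inner_sum_left inner_scaleR_left
    by (intro has_derivative_sum has_derivative_mult_right d2 x)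
  have u3: "continuous_on \<Omega> (H n e)" for n e
    unfolding H_def[abs_def] by (intro continuous_intros c2)
  have gh: "gradient_hessian \<Omega> (u n) (G n) (H n)" for n
    unfolding gradient_hessian_def using u1 u2 u3 by blast
  note C2 = C2_on_of_fields[OF op gh]
  have "laplacian (u n) x - \<gamma>\<^sup>2 * u n x = (\<Sum>m<n. \<beta> (n - m) * u m x)" if x: "x \<in> \<Omega>" for n x
  proof -
    have "laplacian (u n) x = (\<Sum>b\<in>Basis. \<Sum>m\<le>n. 1 / pi * (Hs (n - m) m b x \<bullet> b))"
      by (simp add: C2(2)[OF x] H_def inner_sum_left)
    also have "\<dots> = (\<Sum>m\<le>n. 1 / pi * (\<Sum>b\<in>Basis. Hs (n - m) m b x \<bullet> b))"
      by (subst sum.swap) (simp add: sum_distrib_left)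
    also have "\<dots> = (\<Sum>m\<le>n. 1 / pi * (\<gamma>\<^sup>2 * ?D (n - m) m x + (\<Sum>j<n - m. \<beta> (n - m - j) * ?D j m x)))"
      by (simp only: pde[OF x])
    also have "\<dots> = \<gamma>\<^sup>2 * (1 / pi * (\<Sum>m\<le>n. ?D (n - m) m x))
        + 1 / pi * (\<Sum>m\<le>n. \<Sum>j<n - m. \<beta> (n - m - j) * ?D j m x)"
      by (simp only: distrib_left sum.distrib sum_distrib_left mult.left_commute)
    also have "\<gamma>\<^sup>2 * (1 / pi * (\<Sum>m\<le>n. ?D (n - m) m x)) = \<gamma>\<^sup>2 * u n x" by (simp only: u[OF x])
    also have "1 / pi * (\<Sum>m\<le>n. \<Sum>j<n - m. \<beta> (n - m - j) * ?D j m x) = (\<Sum>i<n. \<beta> (n - i) * u i x)"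
      unfolding sum_convolution_reindex[of \<beta> n "\<lambda>j m. ?D j m x"] u[OF x]
      by (simp add: sum_distrib_left mult_ac)
    finally show ?thesis by simp
  qed
  moreover have "has_normal_derivative \<nu> (u n) x (f_coeff n x)" if x: "x \<in> frontier \<Omega>" for n x
  proof -
    have "((\<lambda>h. \<Sum>m\<le>n. 1 / pi * (Gr (n - m) m (x - h *\<^sub>R \<nu> x) \<bullet> \<nu> x)) \<longlongrightarrow>
        (\<Sum>m\<le>n. 1 / pi * (pi * op_T \<gamma> \<beta> C \<nu> (n - m) (q m) x))) (at_right 0)"
      by (intro tendsto_sum tendsto_mult_left T x)
    moreover have "(\<Sum>m\<le>n. 1 / pi * (pi * op_T \<gamma> \<beta> C \<nu> (n - m) (q m) x)) = f_coeff n x"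
      using integral_eqs[OF x, of n] by (simp add: lessThan_Suc flip: lessThan_Suc_atMost)
    moreover have "(\<Sum>m\<le>n. 1 / pi * (Gr (n - m) m y \<bullet> \<nu> x)) = G n y \<bullet> \<nu> x" for y
      by (simp add: G_def inner_sum_left)
    ultimately have "((\<lambda>h. G n (x - h *\<^sub>R \<nu> x) \<bullet> \<nu> x) \<longlongrightarrow> f_coeff n x) (at_right 0)" by simp
    moreover have "\<forall>\<^sub>F h in at_right 0. G n (x - h *\<^sub>R \<nu> x) \<bullet> \<nu> x = dir_deriv (\<nu> x) (u n) (x - h *\<^sub>R \<nu> x)"
      using inside[OF x] by eventually_elim (rule dir_deriv_eq[OF u1, symmetric])
    ultimately show ?thesis
      unfolding has_normal_derivative_def by (rule Lim_transform_eventually)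
  qed
  ultimately show ?thesis using C2(1) by blast
qed

end
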